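(* Let $M\subset\mathbb{R}^n$ be a complete connected smooth Riemannian submanifold without boundary, let $M$ be isometric to a Riemannian product $N\times\mathbb{R}$, and let $f:M\to\mathbb{R}$ be a non-trivial affine function. Then all geodesic curves on $M$ are $f$-eikonal helix curves.
   Context: $M$ carries the metric induced from $\mathbb{R}^n$. A function $f:M\to\mathbb{R}$ is affine if for each unit speed geodesic $\alpha:(-\infty,\infty)\to M$ there are constants $a,b\in\mathbb{R}$ such that $f(\alpha(s))=as+b$ for all $s\in(-\infty,\infty)$; non-trivial means non-constant. $\nabla f$ is the gradient of $f$ on $M$. A curve $\alpha$ on $M$ with unit tangent $T$ is an $f$-eikonal helix curve if $\|\nabla f\|$ is constant along $\alpha$ ($f$ is eikonal along $\alpha$) and the angle between $\nabla f$ and $T$ is constant along $\alpha$, i.e. $\langle\nabla f,T\rangle$ is constant along $\alpha$. Geodesics are taken to be parametrized by arc length. *)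

theory Defs
  imports "HOL-Analysis.Analysis"
begin

text \<open>For open \<open>S\<close>: all iterated directional derivatives up to order \<open>k\<close> exist as total
  derivatives and are continuous, i.e. \<open>f\<close> is of class $C^k$ on \<open>S\<close>.\<close>

primrec C_k_on ::
    "nat \<Rightarrow> 'a::real_normed_vector set \<Rightarrow> ('a \<Rightarrow> 'b::real_normed_vector) \<Rightarrow> bool" where
  "C_k_on 0 S f \<longleftrightarrow> continuous_on S f"
| "C_k_on (Suc k) S f \<longleftrightarrow>
     (\<forall>x\<in>S. f differentiable (at x)) \<and>
     (\<forall>v. C_k_on k S (\<lambda>x. frechet_derivative f (at x) v))"

definition smooth_on ::
    "'a::real_normed_vector set \<Rightarrow> ('a \<Rightarrow> 'b::real_normed_vector) \<Rightarrow> bool" where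
  "smooth_on S f \<longleftrightarrow> (\<forall>k. C_k_on k S f)"

text \<open>Smoothness of a map on an arbitrary subset, such as a submanifold: local extendability to a
  smooth map of the ambient space.\<close>

definition smooth_map_on ::
    "'a::real_normed_vector set \<Rightarrow> ('a \<Rightarrow> 'b::real_normed_vector) \<Rightarrow> bool" where
  "smooth_map_on M f \<longleftrightarrow>
     (\<forall>p\<in>M. \<exists>U F. open U \<and> p \<in> U \<and> smooth_on U F \<and> (\<forall>x\<in>U \<inter> M. F x = f x))"

text \<open>Embedded \<open>d\<close>-dimensional submanifolds without boundary, by slice charts.\<close>

definition smooth_submanifold :: "nat \<Rightarrow> 'a::euclidean_space set \<Rightarrow> bool" where
  "smooth_submanifold d M \<longleftrightarrow>
     (\<forall>p\<in>M. \<exists>(U::'a set) (V::'a set) \<phi> \<psi> (E::'a set).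
        open U \<and> p \<in> U \<and> open V \<and> homeomorphism U V \<phi> \<psi> \<and> smooth_on U \<phi> \<and> smooth_on V \<psi> \<and>
        subspace E \<and> dim E = d \<and> \<phi> ` (U \<inter> M) = V \<inter> E)"

definition tangent_space :: "'a::euclidean_space set \<Rightarrow> 'a \<Rightarrow> 'a set" where
  "tangent_space M p =
     {v. \<exists>\<gamma> e. e > 0 \<and> smooth_on {-e<..<e} \<gamma> \<and> \<gamma> ` {-e<..<e} \<subseteq> M \<and> \<gamma> 0 = p \<and>
            (\<gamma> has_vector_derivative v) (at (0::real))}"

text \<open>A Riemannian metric on a submanifold \<open>N\<close>, not necessarily the induced one; only the values
  \<open>g p u v\<close> with \<open>p \<in> N\<close> and \<open>u, v\<close> tangent at \<open>p\<close> are relevant.\<close>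

definition riemannian_metric_on ::
    "'a::euclidean_space set \<Rightarrow> ('a \<Rightarrow> 'a \<Rightarrow> 'a \<Rightarrow> real) \<Rightarrow> bool" where
  "riemannian_metric_on N g \<longleftrightarrow>
     (\<forall>p\<in>N. \<forall>u\<in>tangent_space N p. \<forall>v\<in>tangent_space N p.
        g p u v = g p v u \<and> (u \<noteq> 0 \<longrightarrow> g p u u > 0) \<and>
        (\<forall>w\<in>tangent_space N p. \<forall>a b. g p (a *\<^sub>R u + b *\<^sub>R v) w = a * g p u w + b * g p v w)) \<and>
     (\<forall>X Y. smooth_map_on N X \<and> smooth_map_on N Y \<and>
        (\<forall>p\<in>N. X p \<in> tangent_space N p \<and> Y p \<in> tangent_space N p) \<longrightarrow>
        smooth_map_on N (\<lambda>p. g p (X p) (Y p)))"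

text \<open>A Riemannian manifold of dimension \<open>d\<close> is modelled as an embedded submanifold of some
  Euclidean space with an arbitrary Riemannian metric; by Whitney's embedding theorem this covers
  all abstract Riemannian manifolds.\<close>

definition riemannian_manifold ::
    "nat \<Rightarrow> 'a::euclidean_space set \<Rightarrow> ('a \<Rightarrow> 'a \<Rightarrow> 'a \<Rightarrow> real) \<Rightarrow> bool" where
  "riemannian_manifold d N g \<longleftrightarrow> smooth_submanifold d N \<and> riemannian_metric_on N g"

definition induced_metric :: "'a::euclidean_space \<Rightarrow> 'a \<Rightarrow> 'a \<Rightarrow> real" where
  "induced_metric p u v = u \<bullet> v"

text \<open>The product of \<open>(N, g)\<close> with the real line carries the metric
  $g \oplus dt^2$ on the set \<open>N \<times> UNIV\<close>.\<close>

definition product_line_metric ::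
    "('a \<Rightarrow> 'a \<Rightarrow> 'a \<Rightarrow> real) \<Rightarrow> 'a \<times> real \<Rightarrow> 'a \<times> real \<Rightarrow> 'a \<times> real \<Rightarrow> real" where
  "product_line_metric g p u v = g (fst p) (fst u) (fst v) + snd u * snd v"

text \<open>Isometries are diffeomorphisms whose differentials preserve the metrics. The derivative
  within \<open>A\<close> is determined on the tangent space only, which is where it is used.\<close>

definition riemannian_isometry ::
    "'a::euclidean_space set \<Rightarrow> ('a \<Rightarrow> 'a \<Rightarrow> 'a \<Rightarrow> real) \<Rightarrow>
     'b::euclidean_space set \<Rightarrow> ('b \<Rightarrow> 'b \<Rightarrow> 'b \<Rightarrow> real) \<Rightarrow> ('a \<Rightarrow> 'b) \<Rightarrow> bool" where
  "riemannian_isometry A g B h \<Phi> \<longleftrightarrow>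
     bij_betw \<Phi> A B \<and> smooth_map_on A \<Phi> \<and> smooth_map_on B (inv_into A \<Phi>) \<and>
     (\<forall>p\<in>A. \<exists>D. (\<Phi> has_derivative D) (at p within A) \<and>
        (\<forall>u\<in>tangent_space A p. \<forall>v\<in>tangent_space A p. h (\<Phi> p) (D u) (D v) = g p u v))"

definition isometric ::
    "'a::euclidean_space set \<Rightarrow> ('a \<Rightarrow> 'a \<Rightarrow> 'a \<Rightarrow> real) \<Rightarrow>
     'b::euclidean_space set \<Rightarrow> ('b \<Rightarrow> 'b \<Rightarrow> 'b \<Rightarrow> real) \<Rightarrow> bool" where
  "isometric A g B h \<longleftrightarrow> (\<exists>\<Phi>. riemannian_isometry A g B h \<Phi>)"

text \<open>From here on, \<open>M\<close> carries the induced metric. Its Levi-Civita covariant derivative of a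
  vector field along a curve is the tangential part of the ordinary derivative.\<close>

definition tangential_part :: "'a::euclidean_space set \<Rightarrow> 'a \<Rightarrow> 'a \<Rightarrow> 'a" where
  "tangential_part M p x =
     (THE u. u \<in> tangent_space M p \<and> (\<forall>w\<in>tangent_space M p. (x - u) \<bullet> w = 0))"

definition covariant_derivative ::
    "'a::euclidean_space set \<Rightarrow> (real \<Rightarrow> 'a) \<Rightarrow> (real \<Rightarrow> 'a) \<Rightarrow> real \<Rightarrow> 'a" where
  "covariant_derivative M \<alpha> X s = tangential_part M (\<alpha> s) (vector_derivative X (at s))"

definition velocity :: "(real \<Rightarrow> 'a::real_normed_vector) \<Rightarrow> real \<Rightarrow> 'a" where
  "velocity \<alpha> s = vector_derivative \<alpha> (at s)"

definition smooth_curve :: "'a::euclidean_space set \<Rightarrow> real set \<Rightarrow> (real \<Rightarrow> 'a) \<Rightarrow> bool" where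
  "smooth_curve M I \<alpha> \<longleftrightarrow> open I \<and> is_interval I \<and> I \<noteq> {} \<and> smooth_on I \<alpha> \<and> \<alpha> ` I \<subseteq> M"

definition geodesic :: "'a::euclidean_space set \<Rightarrow> real set \<Rightarrow> (real \<Rightarrow> 'a) \<Rightarrow> bool" where
  "geodesic M I \<alpha> \<longleftrightarrow>
     smooth_curve M I \<alpha> \<and> (\<forall>s\<in>I. covariant_derivative M \<alpha> (velocity \<alpha>) s = 0)"

definition unit_speed :: "real set \<Rightarrow> (real \<Rightarrow> 'a::real_normed_vector) \<Rightarrow> bool" where
  "unit_speed I \<alpha> \<longleftrightarrow> (\<forall>s\<in>I. norm (velocity \<alpha> s) = 1)"

text \<open>Completeness in the geodesic sense: the exponential map at every point is defined on the
  whole tangent space.\<close>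

definition geodesically_complete :: "'a::euclidean_space set \<Rightarrow> bool" where
  "geodesically_complete M \<longleftrightarrow>
     (\<forall>p\<in>M. \<forall>v\<in>tangent_space M p. \<exists>\<gamma>. geodesic M UNIV \<gamma> \<and> \<gamma> 0 = p \<and> velocity \<gamma> 0 = v)"

definition affine_function :: "'a::euclidean_space set \<Rightarrow> ('a \<Rightarrow> real) \<Rightarrow> bool" where
  "affine_function M f \<longleftrightarrow>
     (\<forall>\<alpha>. geodesic M UNIV \<alpha> \<and> unit_speed UNIV \<alpha> \<longrightarrow> (\<exists>a b. \<forall>s. f (\<alpha> s) = a * s + b))"

text \<open>The differential at \<open>p\<close> of a function on \<open>M\<close> is its derivative within \<open>M\<close>, restricted to
  tangent vectors; the gradient is the tangent vector representing it.\<close>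

definition has_gradient ::
    "'a::euclidean_space set \<Rightarrow> ('a \<Rightarrow> real) \<Rightarrow> 'a \<Rightarrow> 'a \<Rightarrow> bool" where
  "has_gradient M f p G \<longleftrightarrow>
     G \<in> tangent_space M p \<and> (f has_derivative (\<lambda>v. G \<bullet> v)) (at p within M)"

definition gradient :: "'a::euclidean_space set \<Rightarrow> ('a \<Rightarrow> real) \<Rightarrow> 'a \<Rightarrow> 'a" where
  "gradient M f p = (THE G. has_gradient M f p G)"

text \<open>The gradient is required to exist along the curve, so that the two constancy conditions are
  meaningful. For a unit speed curve the velocity is the unit tangent.\<close>

definition eikonal_helix_curve ::
    "'a::euclidean_space set \<Rightarrow> ('a \<Rightarrow> real) \<Rightarrow> real set \<Rightarrow> (real \<Rightarrow> 'a) \<Rightarrow> bool" where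
  "eikonal_helix_curve M f I \<alpha> \<longleftrightarrow>
     smooth_curve M I \<alpha> \<and> unit_speed I \<alpha> \<and>
     (\<forall>s\<in>I. \<exists>G. has_gradient M f (\<alpha> s) G) \<and>
     (\<lambda>s. norm (gradient M f (\<alpha> s))) constant_on I \<and>
     (\<lambda>s. gradient M f (\<alpha> s) \<bullet> velocity \<alpha> s) constant_on I"

end

theory Submission
  imports Defs
begin

text \<open>Affinity of \<open>f\<close> along geodesics alone, without any a priori continuity, makes \<open>f\<close>
  differentiable. In a slice chart two geodesics of small speed differ, up to a small relative error,
  like straight lines, so nearby points have a geodesic midpoint which is Lipschitz in the endpoints
  and differs from the affine midpoint quadratically; \<open>f\<close> takes the mean value there.
  Iterating midpoints of points on geodesics through \<open>p\<close> in independent directions gives a continuous map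
  \<open>F\<close> with \<open>F t = p + t + O(\<bar>t\<bar>\<^sup>2)\<close> along which \<open>f\<close> is exactly affine in \<open>t\<close>; by Brouwer's theorem \<open>F\<close>
  covers a neighbourhood of \<open>p\<close>. Since accelerations of geodesics are normal and tangent
  spaces turn in a Lipschitz way, \<open>f q - f p\<close> equals the inner product of the gradient at \<open>p\<close> with \<open>q - p\<close>
  up to \<open>O(\<bar>q - p\<bar>\<^sup>3)\<close>. Comparing this along three nearby points shows that the
  gradient is parallel, hence of constant length and with constant inner product with the velocity
  of any geodesic.\<close>

section \<open>Second-order calculus of smooth maps\<close>

text \<open>Smooth dependence of geodesics on their initial data is never invoked. It is replaced by
  one absorption estimate (\<open>coordinate_geodesic_diff\<close>), from which the shooting
  argument for two end points and the continuity of midpoints both follow; the fraction 1/8 in it is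
  the contraction factor of the shooting map. Consequently \<open>F\<close> is only known to be
  continuous and quadratically close to a linear map, not close to it in the Lipschitz sense, so its
  local surjectivity is obtained from a topological theorem rather than from a contraction.
  Exactness is the other guiding point: every error sits in the position of points and none in the
  values of \<open>f\<close>, so no estimate presupposes regularity of \<open>f\<close>. Finally,
  the geodesic of the conclusion may live on a bounded interval, whereas affinity speaks of
  geodesics on the whole line. The two constants are therefore not read off from an affine formula
  along that geodesic, but from derivatives that vanish at each time: tested against tangent
  vectors, the gradient varies only quadratically.\<close>

lemma frechet_derivative_eqI:
  "(f has_derivative f') (at x) \<Longrightarrow> frechet_derivative f (at x) = f'"
  using frechet_derivative_at by metis

lemma C_k_on_cong:
  assumes "open S" "\<And>x. x \<in> S \<Longrightarrow> f x = g x" "C_k_on k S f"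
  shows "C_k_on k S g"
  using assms(2,3)
proof (induction k arbitrary: f g)
  case 0
  then show ?case using continuous_on_cong by fastforce
next
  case (Suc k)
  have der: "(g has_derivative frechet_derivative f (at x)) (at x)" if "x \<in> S" for x
  proof (rule has_derivative_transform_within_open[OF _ \<open>open S\<close> that Suc.prems(1)])
    show "(f has_derivative frechet_derivative f (at x)) (at x)"
      using Suc.prems(2) that by (auto simp: frechet_derivative_works)
  qed auto
  have "C_k_on k S (\<lambda>x. frechet_derivative g (at x) v)" for v
    by (rule Suc.IH[of "\<lambda>x. frechet_derivative f (at x) v"])
      (use Suc.prems(2) frechet_derivative_eqI[OF der] in auto)
  then show ?case using der by (auto simp: differentiable_def)
qed

text \<open>Serves \<open>C_k_on_line\<close>: the derivative of a restriction to a line, applied to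
  \<open>h\<close>, is \<open>h\<close> times a directional derivative of \<open>f\<close>.\<close>

lemma C_k_on_scaleR:
  assumes "open S" "C_k_on k S f"
  shows "C_k_on k S (\<lambda>x. h *\<^sub>R f x)"
  using assms(2)
proof (induction k arbitrary: f)
  case 0
  then show ?case by (auto intro: continuous_intros)
next
  case (Suc k)
  have der: "((\<lambda>x. h *\<^sub>R f x) has_derivative (\<lambda>v. h *\<^sub>R frechet_derivative f (at x) v)) (at x)"
    if "x \<in> S" for x
    using Suc.prems that by (auto simp: frechet_derivative_works intro!: derivative_intros)
  have "C_k_on k S (\<lambda>x. frechet_derivative (\<lambda>x. h *\<^sub>R f x) (at x) v)" for v
  proof (rule C_k_on_cong[OF \<open>open S\<close>])
    show "C_k_on k S (\<lambda>x. h *\<^sub>R frechet_derivative f (at x) v)"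
      using Suc by auto
  qed (simp add: frechet_derivative_eqI[OF der])
  then show ?case using der by (auto simp: differentiable_def)
qed

text \<open>Affine lines are the only substitution whose smoothness the proof needs: they give the
  tangent curves of a chart, time shifts and time rescalings. The induction closes because the
  derivative is, up to a scalar, again the restriction of a directional derivative to the same
  line.\<close>

lemma C_k_on_line:
  fixes a v :: "'a::real_normed_vector"
  assumes "open S" "C_k_on k S f"
  shows "C_k_on k {t. a + t *\<^sub>R v \<in> S} (\<lambda>t::real. f (a + t *\<^sub>R v))"
  using assms(2)
proof (induction k arbitrary: f)
  case 0
  then show ?case by (auto intro!: continuous_intros continuous_on_compose2[of S f])
next
  case (Suc k)
  let ?T = "{t. a + t *\<^sub>R v \<in> S}"
  have "?T = (\<lambda>t. a + t *\<^sub>R v) -` S"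
    by auto
  then have "open ?T"
    using \<open>open S\<close> by (auto intro!: open_vimage continuous_intros)
  have der: "((\<lambda>t. f (a + t *\<^sub>R v)) has_derivative
      (\<lambda>h. h *\<^sub>R frechet_derivative f (at (a + t *\<^sub>R v)) v)) (at t)" if "t \<in> ?T" for t
  proof -
    have f: "(f has_derivative frechet_derivative f (at (a + t *\<^sub>R v))) (at (a + t *\<^sub>R v))"
      using Suc.prems that by (auto simp: frechet_derivative_works)
    have l: "((\<lambda>t. a + t *\<^sub>R v) has_derivative (\<lambda>h. h *\<^sub>R v)) (at t)"
      by (auto intro!: derivative_eq_intros)
    show ?thesis
      using has_derivative_compose[OF l f] linear_scale[OF has_derivative_linear[OF f]] by simp
  qed
  have "C_k_on k ?T (\<lambda>t. frechet_derivative (\<lambda>t. f (a + t *\<^sub>R v)) (at t) h)" for h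
  proof (rule C_k_on_cong[OF \<open>open ?T\<close>])
    show "C_k_on k ?T (\<lambda>t. h *\<^sub>R frechet_derivative f (at (a + t *\<^sub>R v)) v)"
      using Suc by (intro C_k_on_scaleR \<open>open ?T\<close>) auto
  qed (simp add: frechet_derivative_eqI[OF der])
  then show ?case using der by (auto simp: differentiable_def)
qed

lemma smooth_on_line:
  assumes "open S" "smooth_on S f"
  shows "smooth_on {t. a + t *\<^sub>R v \<in> S} (\<lambda>t::real. f (a + t *\<^sub>R v))"
  using C_k_on_line[OF assms(1)] assms(2) unfolding smooth_on_def by blast

lemma C_k_on_subset: "C_k_on k S f \<Longrightarrow> T \<subseteq> S \<Longrightarrow> C_k_on k T f"
  by (induction k arbitrary: f) (auto intro: continuous_on_subset)

lemma smooth_on_subset: "smooth_on S f \<Longrightarrow> T \<subseteq> S \<Longrightarrow> smooth_on T f"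
  unfolding smooth_on_def using C_k_on_subset by blast

lemma smooth_on_has_derivative:
  assumes "smooth_on S f" "x \<in> S"
  shows "(f has_derivative frechet_derivative f (at x)) (at x)"
proof -
  have "C_k_on (Suc 0) S f" using assms by (simp only: smooth_on_def)
  then show ?thesis using assms by (auto simp: frechet_derivative_works)
qed

lemma smooth_on_frechet_derivative:
  assumes "smooth_on S f"
  shows "smooth_on S (\<lambda>x. frechet_derivative f (at x) v)"
  unfolding smooth_on_def
proof
  fix k
  have "C_k_on (Suc k) S f" using assms by (simp only: smooth_on_def)
  then show "C_k_on k S (\<lambda>x. frechet_derivative f (at x) v)" by simp
qed

lemma smooth_on_continuous_on: "smooth_on S f \<Longrightarrow> continuous_on S f"
  unfolding smooth_on_def using C_k_on.simps(1) by metis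

lemma frechet_derivative_expand:
  fixes f :: "'a::euclidean_space \<Rightarrow> 'b::real_normed_vector"
  assumes "f differentiable (at x)"
  shows "frechet_derivative f (at x) v = (\<Sum>b\<in>Basis. (v \<bullet> b) *\<^sub>R frechet_derivative f (at x) b)"
proof -
  have lin: "linear (frechet_derivative f (at x))"
    using assms has_derivative_linear frechet_derivative_works by blast
  have "frechet_derivative f (at x) v = frechet_derivative f (at x) (\<Sum>b\<in>Basis. (v \<bullet> b) *\<^sub>R b)"
    by (simp add: euclidean_representation)
  also have "\<dots> = (\<Sum>b\<in>Basis. (v \<bullet> b) *\<^sub>R frechet_derivative f (at x) b)"
    using lin by (simp add: linear_sum linear_scale)
  finally show ?thesis .
qed

section \<open>Uniform bounds on closed balls\<close>

lemma norm_frechet_derivative_le: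
  fixes f :: "'a::euclidean_space \<Rightarrow> 'b::real_normed_vector"
  assumes "f differentiable (at x)"
  shows "norm (frechet_derivative f (at x) v) \<le> (\<Sum>b\<in>Basis. norm (frechet_derivative f (at x) b)) * norm v"
proof -
  have "norm (frechet_derivative f (at x) v) \<le> (\<Sum>b\<in>Basis. norm ((v \<bullet> b) *\<^sub>R frechet_derivative f (at x) b))"
    by (subst frechet_derivative_expand[OF assms]) (rule norm_sum)
  also have "\<dots> \<le> (\<Sum>b\<in>Basis. norm (frechet_derivative f (at x) b) * norm v)"
    by (rule sum_mono) (simp add: mult.commute[of _ "norm v"] Basis_le_norm mult_right_mono)
  finally show ?thesis by (simp add: sum_distrib_right)
qed

text \<open>Closed balls are compact, which bounds \<open>f\<close> and its derivative along each
  basis vector, and convex, which turns the derivative bound into a Lipschitz bound.\<close>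

lemma smooth_on_bounded_Lipschitz:
  fixes f :: "'a::euclidean_space \<Rightarrow> 'b::real_normed_vector"
  assumes f: "smooth_on S f" and sub: "cball z r \<subseteq> S"
  shows "\<exists>K\<ge>0. \<forall>x\<in>cball z r. \<forall>y\<in>cball z r.
    norm (f x) \<le> K \<and> norm (f x - f y) \<le> K * norm (x - y) \<and>
    (\<forall>v. norm (frechet_derivative f (at x) v) \<le> K * norm v)"
proof -
  have bd: "\<exists>K\<ge>0. \<forall>x\<in>cball z r. norm (g x) \<le> K" if "smooth_on S g" for g :: "'a \<Rightarrow> 'b"
  proof -
    have "compact (g ` cball z r)"
      using smooth_on_continuous_on[OF smooth_on_subset[OF that sub]]
      by (intro compact_continuous_image) auto
    from compact_imp_bounded[OF this] obtain K where "\<forall>x\<in>cball z r. norm (g x) \<le> K"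
      by (auto simp: bounded_iff)
    then show ?thesis by (intro exI[of _ "max K 0"]) fastforce
  qed
  obtain K0 where K0: "K0 \<ge> 0" "\<And>x. x\<in>cball z r \<Longrightarrow> norm (f x) \<le> K0"
    using bd[OF f] by blast
  have "\<forall>b. \<exists>K\<ge>0. \<forall>x\<in>cball z r. norm (frechet_derivative f (at x) b) \<le> K"
    using bd[OF smooth_on_frechet_derivative[OF f]] by blast
  then obtain k where k: "\<And>b. k b \<ge> 0"
      "\<And>b x. x\<in>cball z r \<Longrightarrow> norm (frechet_derivative f (at x) b) \<le> k b"
    by metis
  define K1 where "K1 = (\<Sum>b\<in>Basis. k b)"
  have der: "(f has_derivative frechet_derivative f (at x)) (at x)" if "x \<in> cball z r" for x
    using smooth_on_has_derivative[OF f] that sub by auto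
  have K1: "norm (frechet_derivative f (at x) v) \<le> K1 * norm v" if "x\<in>cball z r" for x v
  proof -
    have "norm (frechet_derivative f (at x) v) \<le> (\<Sum>b\<in>Basis. norm (frechet_derivative f (at x) b)) * norm v"
      using der[OF that] by (intro norm_frechet_derivative_le) (auto simp: differentiable_def)
    also have "\<dots> \<le> K1 * norm v"
      unfolding K1_def using k that by (intro mult_right_mono sum_mono) auto
    finally show ?thesis .
  qed
  have "norm (f x - f y) \<le> K1 * norm (x - y)" if "x\<in>cball z r" "y\<in>cball z r" for x y
  proof (rule differentiable_bound[OF convex_cball])
    show "(f has_derivative frechet_derivative f (at x)) (at x within cball z r)" if "x \<in> cball z r" for x
      using der[OF that] has_derivative_at_withinI by blast
    show "onorm (frechet_derivative f (at x)) \<le> K1" if "x \<in> cball z r" for x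
      using K1[OF that] by (rule onorm_le)
  qed (use that in auto)
  moreover have "K1 \<ge> 0"
    using k(1) by (auto simp: K1_def intro: sum_nonneg)
  ultimately show ?thesis
  proof (intro exI[of _ "max K0 K1"] conjI ballI allI)
    fix x y v assume *: "x\<in>cball z r" "y\<in>cball z r"
    show "norm (f x) \<le> max K0 K1" using K0 * by (meson max.coboundedI1)
    show "norm (f x - f y) \<le> max K0 K1 * norm (x - y)"
      using \<open>\<And>y x. \<lbrakk>x \<in> cball z r; y \<in> cball z r\<rbrakk> \<Longrightarrow> norm (f x - f y) \<le> K1 * norm (x - y)\<close>[OF *]
      by (meson max.cobounded2 mult_right_mono norm_ge_zero order_trans)
    show "norm (frechet_derivative f (at x) v) \<le> max K0 K1 * norm v"
      using K1[OF *(1)] by (meson max.cobounded2 mult_right_mono norm_ge_zero order_trans)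
  qed (use K0 in auto)
qed

text \<open>The bilinear second derivative. Its first argument is expanded in the basis because
  \<open>C_k_on\<close> supplies directional derivatives in fixed directions; in this form it is
  linear in \<open>v\<close> for every \<open>f\<close>.\<close>

definition second_derivative ::
    "('a::euclidean_space \<Rightarrow> 'b::real_normed_vector) \<Rightarrow> 'a \<Rightarrow> 'a \<Rightarrow> 'a \<Rightarrow> 'b" where
  "second_derivative f x v w =
     (\<Sum>b\<in>Basis. (v \<bullet> b) *\<^sub>R frechet_derivative (\<lambda>y. frechet_derivative f (at y) b) (at x) w)"

lemma linear_second_derivative1: "linear (\<lambda>v. second_derivative f x v w)"
  by (rule linearI)
    (auto simp: second_derivative_def inner_add_left sum.distrib algebra_simps scaleR_sum_right)

lemma linear_second_derivative2:
  assumes "smooth_on S f" "x \<in> S"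
  shows "linear (second_derivative f x v)"
proof -
  have "linear (frechet_derivative (\<lambda>y. frechet_derivative f (at y) b) (at x))" for b
    using smooth_on_has_derivative[OF smooth_on_frechet_derivative[OF assms(1)] assms(2)]
    by (rule has_derivative_linear)
  then show ?thesis
    by (intro linearI)
      (auto simp: second_derivative_def linear_add linear_scale sum.distrib algebra_simps
         scaleR_sum_right)
qed

text \<open>Second-order chain rule: the acceleration of the image curve. The direction
  \<open>u s\<close> moves with \<open>s\<close>, so the differential is expanded in fixed basis
  directions, where the product rule applies.\<close>

lemma has_vector_derivative_frechet_derivative_compose:
  fixes f :: "'a::euclidean_space \<Rightarrow> 'b::real_normed_vector"
  assumes "smooth_on S f" "open S" "c s \<in> S"
    and c: "(c has_vector_derivative u s) (at s)" and u: "(u has_vector_derivative a) (at s)"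
  shows "((\<lambda>s. frechet_derivative f (at (c s)) (u s)) has_vector_derivative
    frechet_derivative f (at (c s)) a + second_derivative f (c s) (u s) (u s)) (at s)"
proof -
  let ?D = "\<lambda>b x. frechet_derivative f (at x) b"
  have fd: "frechet_derivative f (at x) v = (\<Sum>b\<in>Basis. (v \<bullet> b) *\<^sub>R ?D b x)" if "x \<in> S" for x v
    using smooth_on_has_derivative[OF assms(1) that] differentiableI
    by (intro frechet_derivative_expand) blast
  have cd: "(c has_derivative (\<lambda>h. h *\<^sub>R u s)) (at s)"
    using c by (simp add: has_vector_derivative_def)
  have D: "((\<lambda>t. ?D b (c t)) has_vector_derivative frechet_derivative (?D b) (at (c s)) (u s)) (at s)" for b
  proof -
    have "((\<lambda>t. ?D b (c t)) has_derivative
        (\<lambda>h. frechet_derivative (?D b) (at (c s)) (h *\<^sub>R u s))) (at s)"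
      using has_derivative_compose[OF cd smooth_on_has_derivative[OF smooth_on_frechet_derivative[OF assms(1)] assms(3)]] .
    then show ?thesis
      using linear_scale[OF has_derivative_linear[OF smooth_on_has_derivative[OF smooth_on_frechet_derivative[OF assms(1)] assms(3)]]]
      by (simp add: has_vector_derivative_def)
  qed
  have "((\<lambda>t. \<Sum>b\<in>Basis. (u t \<bullet> b) *\<^sub>R ?D b (c t)) has_vector_derivative
     (\<Sum>b\<in>Basis. (u s \<bullet> b) *\<^sub>R frechet_derivative (?D b) (at (c s)) (u s) + (a \<bullet> b) *\<^sub>R ?D b (c s))) (at s)"
  proof (intro has_vector_derivative_sum has_vector_derivative_scaleR D)
    fix b
    show "((\<lambda>x. u x \<bullet> b) has_field_derivative a \<bullet> b) (at s)"
      using bounded_linear.has_vector_derivative[OF bounded_linear_inner_left u]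
      by (simp add: has_real_derivative_iff_has_vector_derivative)
  qed
  also have "(\<Sum>b\<in>Basis. (u s \<bullet> b) *\<^sub>R frechet_derivative (?D b) (at (c s)) (u s) + (a \<bullet> b) *\<^sub>R ?D b (c s)) =
     frechet_derivative f (at (c s)) a + second_derivative f (c s) (u s) (u s)"
    using assms(3) by (simp add: fd[of _ a] second_derivative_def sum.distrib)
  finally have *: "((\<lambda>t. \<Sum>b\<in>Basis. (u t \<bullet> b) *\<^sub>R ?D b (c t)) has_vector_derivative
     frechet_derivative f (at (c s)) a + second_derivative f (c s) (u s) (u s)) (at s)" .
  have "isCont c s"
    using c has_vector_derivative_continuous by blast
  \<comment> \<open>The basis expansion is available only while \<open>c\<close> stays in
    \<open>S\<close>, so the identity is transferred as one that holds near \<open>s\<close>,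
    including at \<open>s\<close> itself.\<close>
  then have "(c \<longlongrightarrow> c s) (nhds s)"
    by (simp add: continuous_within tendsto_at_iff_tendsto_nhds)
  then have "\<forall>\<^sub>F t in nhds s. c t \<in> S"
    using assms(2,3) by (rule topological_tendstoD)
  then have "\<forall>\<^sub>F t in nhds s. (\<Sum>b\<in>Basis. (u t \<bullet> b) *\<^sub>R ?D b (c t)) = frechet_derivative f (at (c t)) (u t)"
    by eventually_elim (simp add: fd)
  then have "\<forall>\<^sub>F t in nhds s. t \<in> UNIV \<longrightarrow>
      (\<Sum>b\<in>Basis. (u t \<bullet> b) *\<^sub>R ?D b (c t)) = frechet_derivative f (at (c t)) (u t)"
    by eventually_elim blast
  from has_vector_derivative_cong_ev[OF this fd[OF assms(3), symmetric]] * show ?thesis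
    by blast
qed

text \<open>Collects what the geodesic equation needs into one constant. The last bound rests on
  third derivatives, through \<open>smooth_on_bounded_Lipschitz\<close> for iterated directional
  derivatives. Having \<open>K \<ge> 1\<close> makes later powers of \<open>K\<close>
  comparable.\<close>

lemma smooth_on_second_order_bounds:
  fixes f :: "'a::euclidean_space \<Rightarrow> 'b::real_normed_vector"
  assumes f: "smooth_on S f" and sub: "cball z r \<subseteq> S"
  shows "\<exists>K\<ge>1. \<forall>x\<in>cball z r. \<forall>y\<in>cball z r.
    norm (f x - f y) \<le> K * norm (x - y) \<and>
    (\<forall>v. norm (frechet_derivative f (at x) v) \<le> K * norm v) \<and>
    (\<forall>v. norm (frechet_derivative f (at x) v - frechet_derivative f (at y) v) \<le> K * norm (x - y) * norm v) \<and>
    (\<forall>v w. norm (second_derivative f x v w) \<le> K * norm v * norm w) \<and>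
    (\<forall>v w. norm (second_derivative f x v w - second_derivative f y v w) \<le> K * norm (x - y) * norm v * norm w)"
proof -
  let ?D = "\<lambda>b x. frechet_derivative f (at x) b"
  let ?D2 = "\<lambda>b b' x. frechet_derivative (?D b) (at x) b'"
  have sD: "smooth_on S (?D b)" for b
    using f by (rule smooth_on_frechet_derivative)
  obtain K0 where K0: "K0 \<ge> 0" "\<And>x y. x\<in>cball z r \<Longrightarrow> y \<in> cball z r \<Longrightarrow> norm (f x - f y) \<le> K0 * norm (x - y)"
      "\<And>x v. x\<in>cball z r \<Longrightarrow> norm (frechet_derivative f (at x) v) \<le> K0 * norm v"
    using smooth_on_bounded_Lipschitz[OF f sub] by blast
  have "\<forall>b. \<exists>K\<ge>0. \<forall>x\<in>cball z r. \<forall>y\<in>cball z r. norm (?D b x - ?D b y) \<le> K * norm (x - y) \<and>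
      (\<forall>v. norm (frechet_derivative (?D b) (at x) v) \<le> K * norm v)"
    using smooth_on_bounded_Lipschitz[OF sD sub] by meson
  then obtain k1 where k1: "\<And>b. k1 b \<ge> 0"
      "\<And>b x y. x\<in>cball z r \<Longrightarrow> y\<in>cball z r \<Longrightarrow> norm (?D b x - ?D b y) \<le> k1 b * norm (x - y)"
      "\<And>b x v. x\<in>cball z r \<Longrightarrow> norm (frechet_derivative (?D b) (at x) v) \<le> k1 b * norm v"
    by metis
  have "\<forall>b b'. \<exists>K\<ge>0. \<forall>x\<in>cball z r. \<forall>y\<in>cball z r. norm (?D2 b b' x - ?D2 b b' y) \<le> K * norm (x - y)"
    using smooth_on_bounded_Lipschitz[OF smooth_on_frechet_derivative[OF sD] sub] by meson
  then obtain k2 where k2: "\<And>b b'. k2 b b' \<ge> 0"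
      "\<And>b b' x y. x\<in>cball z r \<Longrightarrow> y\<in>cball z r \<Longrightarrow> norm (?D2 b b' x - ?D2 b b' y) \<le> k2 b b' * norm (x - y)"
    by metis
  define K1 where "K1 = (\<Sum>b\<in>Basis. k1 b)"
  define K2 where "K2 = (\<Sum>b\<in>Basis. \<Sum>b'\<in>Basis. k2 b b')"
  have pos: "K1 \<ge> 0" "K2 \<ge> 0"
    using k1 k2 by (auto simp: K1_def K2_def intro!: sum_nonneg)
  have fd: "frechet_derivative f (at x) v = (\<Sum>b\<in>Basis. (v \<bullet> b) *\<^sub>R ?D b x)" if "x \<in> cball z r" for x v
    using smooth_on_has_derivative[OF f] that sub differentiableI
    by (intro frechet_derivative_expand) blast
  have fd2: "frechet_derivative (?D b) (at x) v = (\<Sum>b'\<in>Basis. (v \<bullet> b') *\<^sub>R ?D2 b b' x)" if "x \<in> cball z r" for x v b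
    using smooth_on_has_derivative[OF sD] that sub differentiableI
    by (intro frechet_derivative_expand) blast
  have inn: "\<bar>v \<bullet> b\<bar> \<le> norm v" if "b \<in> Basis" for v b :: 'a
    using that by (rule Basis_le_norm)
  have A: "norm (frechet_derivative f (at x) v - frechet_derivative f (at y) v) \<le> K1 * norm (x - y) * norm v"
    if "x \<in> cball z r" "y \<in> cball z r" for x y v
  proof -
    have "frechet_derivative f (at x) v - frechet_derivative f (at y) v = (\<Sum>b\<in>Basis. (v \<bullet> b) *\<^sub>R (?D b x - ?D b y))"
      using that by (simp add: fd[of x v] fd[of y v] sum_subtractf algebra_simps)
    also have "norm \<dots> \<le> (\<Sum>b\<in>Basis. norm v * (k1 b * norm (x - y)))"
      by (rule order_trans[OF norm_sum], rule sum_mono)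
        (use inn k1 that in \<open>auto intro!: mult_mono\<close>)
    also have "\<dots> = K1 * norm (x - y) * norm v"
      by (simp add: K1_def sum_distrib_left sum_distrib_right algebra_simps)
    finally show ?thesis .
  qed
  have B: "norm (second_derivative f x v w) \<le> K1 * norm v * norm w" if "x \<in> cball z r" for x v w
  proof -
    have "norm (second_derivative f x v w) \<le> (\<Sum>b\<in>Basis. norm v * (k1 b * norm w))"
      unfolding second_derivative_def
      by (rule order_trans[OF norm_sum], rule sum_mono)
        (use inn k1 that in \<open>auto intro!: mult_mono\<close>)
    also have "\<dots> = K1 * norm v * norm w"
      by (simp add: K1_def sum_distrib_left sum_distrib_right algebra_simps)
    finally show ?thesis .
  qed
  have C: "norm (second_derivative f x v w - second_derivative f y v w) \<le> K2 * norm (x - y) * norm v * norm w"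
    if "x \<in> cball z r" "y \<in> cball z r" for x y v w
  proof -
    have eq: "second_derivative f x v w - second_derivative f y v w =
        (\<Sum>b\<in>Basis. \<Sum>b'\<in>Basis. ((v \<bullet> b) * (w \<bullet> b')) *\<^sub>R (?D2 b b' x - ?D2 b b' y))"
      using that
      by (simp add: second_derivative_def fd2[of x _ w] fd2[of y _ w] sum_subtractf scaleR_diff_right scaleR_sum_right)
    have "norm (second_derivative f x v w - second_derivative f y v w)
        \<le> (\<Sum>b\<in>Basis. \<Sum>b'\<in>Basis. (norm v * norm w) * (k2 b b' * norm (x - y)))"
      unfolding eq
    proof (intro order_trans[OF norm_sum] sum_mono)
      fix b b' :: 'a assume b: "b \<in> Basis" "b' \<in> Basis"
      have "\<bar>(v \<bullet> b) * (w \<bullet> b')\<bar> \<le> norm v * norm w"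
        unfolding abs_mult using inn[OF b(1)] inn[OF b(2)] by (intro mult_mono) auto
      then show "norm (((v \<bullet> b) * (w \<bullet> b')) *\<^sub>R (?D2 b b' x - ?D2 b b' y))
          \<le> (norm v * norm w) * (k2 b b' * norm (x - y))"
        unfolding norm_scaleR using k2(2)[OF that] by (intro mult_mono) auto
    qed
    also have "\<dots> = K2 * norm (x - y) * norm v * norm w"
      by (simp add: K2_def sum_distrib_left sum_distrib_right algebra_simps)
    finally show ?thesis .
  qed
  define K where "K = 1 + K0 + K1 + K2"
  have le: "K0 \<le> K" "K1 \<le> K" "K2 \<le> K" "K \<ge> 1"
    using K0 pos by (auto simp: K_def)
  show ?thesis
  proof (intro exI[of _ K] conjI ballI allI)
    fix x y v w assume x: "x \<in> cball z r" and y: "y \<in> cball z r"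
    show "norm (f x - f y) \<le> K * norm (x - y)"
      using K0(2)[OF x y] le by (meson mult_right_mono norm_ge_zero order_trans)
    show "norm (frechet_derivative f (at x) v) \<le> K * norm v"
      using K0(3)[OF x] le by (meson mult_right_mono norm_ge_zero order_trans)
    show "norm (frechet_derivative f (at x) v - frechet_derivative f (at y) v) \<le> K * norm (x - y) * norm v"
      using A[OF x y, of v] le by (meson mult_right_mono norm_ge_zero order_trans)
    show "norm (second_derivative f x v w) \<le> K * norm v * norm w"
      using B[OF x, of v w] le by (meson mult_right_mono norm_ge_zero order_trans)
    show "norm (second_derivative f x v w - second_derivative f y v w) \<le> K * norm (x - y) * norm v * norm w"
      using C[OF x y, of v w] le by (meson mult_right_mono norm_ge_zero order_trans)
  qed (rule le)
qed

section \<open>The geodesic equation in coordinates\<close>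

lemma vector_derivative_bound_unit_interval:
  fixes f :: "real \<Rightarrow> 'a::euclidean_space"
  assumes "\<And>s. s \<in> {0..1} \<Longrightarrow> (f has_vector_derivative f' s) (at s within {0..1})"
    and "\<And>s. s \<in> {0..1} \<Longrightarrow> norm (f' s) \<le> B" and "s \<in> {0..1}"
  shows "norm (f s - f 0) \<le> B"
proof -
  have "B \<ge> 0" using order_trans[OF norm_ge_zero assms(2)[of 0]] by auto
  have "norm (f s - f 0) \<le> B * norm (s - 0)"
  proof (rule differentiable_bound[where S="{0..1}" and f'="\<lambda>s h. h *\<^sub>R f' s"])
    show "(f has_derivative (\<lambda>h. h *\<^sub>R f' x)) (at x within {0..1})" if "x \<in> {0..1}" for x
      using assms(1)[OF that] by (simp add: has_vector_derivative_def)
    show "onorm (\<lambda>h. h *\<^sub>R f' x) \<le> B" if "x \<in> {0..1}" for x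
      using assms(2)[OF that] by (intro onorm_le) (simp add: mult.commute[of B] mult_left_mono)
  qed (use assms(3) in auto)
  also have "\<dots> \<le> B * 1"
    using \<open>B \<ge> 0\<close> assms(3) by (intro mult_left_mono) auto
  finally show ?thesis by simp
qed

lemma second_order_Taylor_unit_interval:
  fixes f :: "real \<Rightarrow> 'a::euclidean_space"
  assumes f: "\<And>s. s \<in> {0..1} \<Longrightarrow> (f has_vector_derivative f' s) (at s within {0..1})"
    and f': "\<And>s. s \<in> {0..1} \<Longrightarrow> (f' has_vector_derivative f'' s) (at s within {0..1})"
    and B: "\<And>s. s \<in> {0..1} \<Longrightarrow> norm (f'' s) \<le> B" and s: "s \<in> {0..1}"
  shows "norm (f s - f 0 - s *\<^sub>R f' 0) \<le> B"
proof -
  have 1: "norm (f' s - f' 0) \<le> B" if "s \<in> {0..1}" for s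
    using vector_derivative_bound_unit_interval[OF f' B that] .
  have "norm ((f s - s *\<^sub>R f' 0) - (f 0 - 0 *\<^sub>R f' 0)) \<le> B"
    by (rule vector_derivative_bound_unit_interval[where f="\<lambda>s. f s - s *\<^sub>R f' 0" and f'="\<lambda>s. f' s - f' 0"])
      (use 1 s f in \<open>auto intro!: derivative_eq_intros\<close>)
  then show ?thesis by (simp add: algebra_simps)
qed

text \<open>\<open>D\<close> and \<open>H\<close> stand for the first and second derivative of a
  local parametrization, and \<open>E\<close> for the slice that it maps to the submanifold. The
  lower bound on \<open>D\<close> makes the metric pulled back to \<open>E\<close> uniformly
  nondegenerate.\<close>

locale geodesic_equation =
  fixes E :: "'a::euclidean_space set" and z :: 'a and R K :: real
    and D :: "'a \<Rightarrow> 'a \<Rightarrow> 'a" and H :: "'a \<Rightarrow> 'a \<Rightarrow> 'a \<Rightarrow> 'a"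
  assumes E: "subspace E" and K: "K \<ge> 1"
    and linear_D: "x \<in> cball z R \<Longrightarrow> linear (D x)"
    and linear_H1: "x \<in> cball z R \<Longrightarrow> linear (\<lambda>v. H x v w)"
    and linear_H2: "x \<in> cball z R \<Longrightarrow> linear (H x v)"
    and D_lower: "x \<in> cball z R \<Longrightarrow> norm v \<le> K * norm (D x v)"
    and D_upper: "x \<in> cball z R \<Longrightarrow> norm (D x v) \<le> K * norm v"
    and D_Lipschitz: "x \<in> cball z R \<Longrightarrow> y \<in> cball z R \<Longrightarrow>
      norm (D x v - D y v) \<le> K * norm (x - y) * norm v"
    and H_upper: "x \<in> cball z R \<Longrightarrow> norm (H x v w) \<le> K * norm v * norm w"
    and H_Lipschitz: "x \<in> cball z R \<Longrightarrow> y \<in> cball z R \<Longrightarrow>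
      norm (H x v w - H y v w) \<le> K * norm (x - y) * norm v * norm w"
begin

text \<open>Weak form of the geodesic equation: the ambient acceleration of the image curve is
  normal to the image of \<open>E\<close>. Testing against vectors of \<open>E\<close> replaces
  Christoffel symbols and needs no inverse of the metric.\<close>

definition acceleration :: "'a \<Rightarrow> 'a \<Rightarrow> 'a \<Rightarrow> bool" where
  "acceleration x u a \<longleftrightarrow> a \<in> E \<and> (\<forall>e\<in>E. D x e \<bullet> (D x a + H x u u) = 0)"

text \<open>Time is normalized to the unit interval, so smallness always means small speed.\<close>

definition coordinate_geodesic :: "(real \<Rightarrow> 'a) \<Rightarrow> (real \<Rightarrow> 'a) \<Rightarrow> bool" where
  "coordinate_geodesic c u \<longleftrightarrow> (\<forall>s\<in>{0..1}. c s \<in> cball z R \<and> c s \<in> E \<and> u s \<in> E \<and>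
     (c has_vector_derivative u s) (at s within {0..1}) \<and>
     (\<exists>a. (u has_vector_derivative a) (at s within {0..1}) \<and> acceleration (c s) (u s) a))"

text \<open>Testing the equation with \<open>e = a\<close> gives
  \<open>norm (D x a) \<le> norm (H x u u)\<close>; the lower bound on \<open>D\<close> and the
  bound on \<open>H\<close> each cost one factor \<open>K\<close>.\<close>

lemma acceleration_bound:
  assumes x: "x \<in> cball z R" and a: "acceleration x u a"
  shows "norm a \<le> K^2 * (norm u)^2"
proof -
  have "D x a \<bullet> D x a = - (D x a \<bullet> H x u u)"
    using a by (auto simp: acceleration_def inner_add_right eq_neg_iff_add_eq_0)
  also have "\<dots> \<le> norm (D x a) * norm (H x u u)"
    using norm_cauchy_schwarz[of "D x a" "- H x u u"] by simp
  finally have "norm (D x a) * norm (D x a) \<le> norm (D x a) * norm (H x u u)"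
    by (simp add: power2_norm_eq_inner[symmetric] power2_eq_square)
  then have "norm (D x a) \<le> norm (H x u u)"
    by (metis mult_left_le_imp_le norm_ge_zero norm_le_zero_iff order_le_less not_less order_trans)
  also have "\<dots> \<le> K * norm u * norm u" using H_upper[OF x] .
  finally have "norm (D x a) \<le> K * norm u * norm u" .
  then have "K * norm (D x a) \<le> K * (K * norm u * norm u)"
    using K by (intro mult_left_mono) auto
  then show ?thesis using D_lower[OF x, of a] by (simp add: power2_eq_square algebra_simps)
qed

text \<open>Both equations are tested with the same coordinate vector \<open>w = a - b\<close>,
  which is mapped by \<open>D x\<close> in one and by \<open>D y\<close> in the other. Every
  mismatch is a Lipschitz term. Since \<open>H\<close> is quadratic in the velocity, a change of
  position costs \<open>\<rho>^2\<close> and a change of velocity only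
  \<open>\<rho>\<close>.\<close>

lemma acceleration_diff_bound:
  assumes x: "x \<in> cball z R" and y: "y \<in> cball z R"
    and a: "acceleration x u a" and b: "acceleration y v b"
    and u: "norm u \<le> \<rho>" and v: "norm v \<le> \<rho>"
  shows "norm (a - b) \<le> 4 * K^6 * (\<rho>^2 * norm (x - y) + \<rho> * norm (u - v))"
proof -
  define w where "w = a - b"
  define d where "d = norm (x - y)"
  define q where "q = norm (u - v)"
  have pos: "d \<ge> 0" "q \<ge> 0" "\<rho> \<ge> 0" "K \<ge> 0"
    using order_trans[OF norm_ge_zero u] K by (auto simp: d_def q_def)
  have w: "w \<in> E" using a b E by (auto simp: w_def acceleration_def subspace_diff)
  have a0: "D x w \<bullet> D x a = - (D x w \<bullet> H x u u)"
    using a w by (auto simp: acceleration_def inner_add_right eq_neg_iff_add_eq_0)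
  have b0: "D y w \<bullet> D y b = - (D y w \<bullet> H y v v)"
    using b w by (auto simp: acceleration_def inner_add_right eq_neg_iff_add_eq_0)
  have "D x w \<bullet> D x w = D x w \<bullet> (D x a - D x b)"
    using linear_diff[OF linear_D[OF x]] by (simp add: w_def)
  also have "\<dots> = - (D x w \<bullet> (H x u u - H y v v)) - (D x w - D y w) \<bullet> (H y v v + D y b)
      - D x w \<bullet> (D x b - D y b)"
    using a0 b0 by (simp add: algebra_simps inner_diff_right inner_diff_left inner_add_right)
  also have "\<dots> \<le> norm (D x w) * norm (H x u u - H y v v) + norm (D x w - D y w) * norm (H y v v + D y b)
      + norm (D x w) * norm (D x b - D y b)"
    using norm_cauchy_schwarz[of "D x w" "- (H x u u - H y v v)"]
      norm_cauchy_schwarz[of "D x w - D y w" "- (H y v v + D y b)"]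
      norm_cauchy_schwarz[of "D x w" "- (D x b - D y b)"]
    by (simp only: norm_minus_cancel inner_minus_right)
  finally have main: "(norm (D x w))^2 \<le> norm (D x w) * norm (H x u u - H y v v)
      + norm (D x w - D y w) * norm (H y v v + D y b) + norm (D x w) * norm (D x b - D y b)"
    by (simp add: power2_norm_eq_inner)
  have Dw: "norm (D x w) \<le> K * norm w" using D_upper[OF x] .
  have Hd: "norm (H x u u - H y v v) \<le> K * \<rho>^2 * d + 2 * K * \<rho> * q"
  proof -
    have "H x u u - H y v v = (H x u u - H y u u) + H y (u - v) u + H y v (u - v)"
      using linear_diff[OF linear_H1[OF y], of u v u] linear_diff[OF linear_H2[OF y], of v u v] by simp
    then have "norm (H x u u - H y v v) \<le> norm (H x u u - H y u u) + norm (H y (u - v) u) + norm (H y v (u - v))"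
      by (metis norm_triangle_mono norm_triangle_ineq order_refl)
    also have "\<dots> \<le> K * d * norm u * norm u + K * q * norm u + K * norm v * q"
      using H_Lipschitz[OF x y, of u u] H_upper[OF y] unfolding d_def q_def by (intro add_mono) auto
    also have "\<dots> \<le> K * d * \<rho> * \<rho> + K * q * \<rho> + K * \<rho> * q"
      using u v pos by (intro add_mono mult_mono mult_nonneg_nonneg) auto
    finally show ?thesis by (simp add: power2_eq_square algebra_simps)
  qed
  have b1: "norm b \<le> K^2 * \<rho>^2"
  proof -
    have "(norm v)^2 \<le> \<rho>^2" using v by (intro power_mono) auto
    then show ?thesis using acceleration_bound[OF y b] K
      by (meson mult_left_mono order_trans zero_le_power2)
  qed
  have HD: "norm (H y v v + D y b) \<le> K * \<rho>^2 + K^3 * \<rho>^2"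
  proof -
    have "norm (H y v v) \<le> K * \<rho> * \<rho>"
      using H_upper[OF y, of v v] v pos
      by (meson mult_mono mult_left_mono mult_nonneg_nonneg norm_ge_zero order_trans)
    moreover have "norm (D y b) \<le> K * (K^2 * \<rho>^2)"
      using D_upper[OF y, of b] b1 pos by (meson mult_left_mono order_trans)
    ultimately show ?thesis
      using norm_triangle_ineq[of "H y v v" "D y b"] by (simp add: power2_eq_square power3_eq_cube)
  qed
  have Db: "norm (D x b - D y b) \<le> K^3 * \<rho>^2 * d"
  proof -
    have "norm (D x b - D y b) \<le> K * d * (K^2 * \<rho>^2)"
      using D_Lipschitz[OF x y, of b] b1 pos unfolding d_def
      by (meson mult_left_mono mult_nonneg_nonneg norm_ge_zero order_trans)
    then show ?thesis by (simp add: power2_eq_square power3_eq_cube algebra_simps)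
  qed
  have DL: "norm (D x w - D y w) \<le> K * d * norm w"
    using D_Lipschitz[OF x y] by (simp add: d_def)
  define X where "X = K * (K * \<rho>^2 * d + 2 * K * \<rho> * q) + K * d * (K * \<rho>^2 + K^3 * \<rho>^2) + K * (K^3 * \<rho>^2 * d)"
  have "(norm (D x w))^2 \<le> (K * norm w) * (K * \<rho>^2 * d + 2 * K * \<rho> * q)
      + (K * d * norm w) * (K * \<rho>^2 + K^3 * \<rho>^2) + (K * norm w) * (K^3 * \<rho>^2 * d)"
  proof (rule order_trans[OF main])
    have "norm (D x w) * norm (H x u u - H y v v) \<le> (K * norm w) * (K * \<rho>^2 * d + 2 * K * \<rho> * q)"
      using Dw Hd pos by (intro mult_mono) auto
    moreover have "norm (D x w - D y w) * norm (H y v v + D y b) \<le> (K * d * norm w) * (K * \<rho>^2 + K^3 * \<rho>^2)"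
      using DL HD pos by (intro mult_mono) auto
    moreover have "norm (D x w) * norm (D x b - D y b) \<le> (K * norm w) * (K^3 * \<rho>^2 * d)"
      using Dw Db pos by (intro mult_mono) auto
    ultimately show "norm (D x w) * norm (H x u u - H y v v)
      + norm (D x w - D y w) * norm (H y v v + D y b) + norm (D x w) * norm (D x b - D y b)
      \<le> (K * norm w) * (K * \<rho>^2 * d + 2 * K * \<rho> * q)
      + (K * d * norm w) * (K * \<rho>^2 + K^3 * \<rho>^2) + (K * norm w) * (K^3 * \<rho>^2 * d)"
      by linarith
  qed
  also have "\<dots> = norm w * X" by (simp add: X_def algebra_simps)
  finally have 1: "(norm (D x w))^2 \<le> norm w * X" .
  have "(norm w)^2 \<le> (K * norm (D x w))^2"
    using D_lower[OF x, of w] by (intro power_mono) auto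
  also have "\<dots> \<le> K^2 * (norm w * X)"
    using 1 by (simp add: power_mult_distrib mult_left_mono)
  finally have "norm w * norm w \<le> norm w * (K^2 * X)"
    by (simp add: power2_eq_square algebra_simps)
  moreover have "X \<ge> 0" using pos by (auto simp: X_def)
  ultimately have 2: "norm w \<le> K^2 * X"
    by (metis mult_left_le_imp_le norm_ge_zero zero_less_norm_iff mult_nonneg_nonneg zero_le_power2 norm_zero)
  \<comment> \<open>Replacing the lower power by the higher one merges all coefficients into
    \<open>4 * K^6\<close>.\<close>
  have k: "K^4 \<le> K^6" "0 \<le> K^6"
    using K by (auto intro: power_increasing)
  have "K^2 * X = (2 * K^4 + 2 * K^6) * (\<rho>^2 * d) + 2 * K^4 * (\<rho> * q)"
    unfolding X_def by (simp add: algebra_simps flip: power_add) (simp add: power_numeral_reduce algebra_simps)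
  also have "\<dots> \<le> (4 * K^6) * (\<rho>^2 * d) + 4 * K^6 * (\<rho> * q)"
  proof (intro add_mono mult_right_mono)
    show "2 * K^4 + 2 * K^6 \<le> 4 * K^6" "2 * K^4 \<le> 4 * K^6"
      using k by linarith+
  qed (use pos in auto)
  finally show ?thesis using 2 by (simp add: w_def d_def q_def algebra_simps)
qed

lemma coordinate_geodesic_expansion:
  assumes cg: "coordinate_geodesic c u" and u: "\<And>s. s \<in> {0..1} \<Longrightarrow> norm (u s) \<le> \<rho>"
    and s: "s \<in> {0..1}"
  shows "norm (c s - c 0 - s *\<^sub>R u 0) \<le> K^2 * \<rho>^2"
proof -
  obtain a where a: "\<And>s. s \<in> {0..1} \<Longrightarrow> (u has_vector_derivative a s) (at s within {0..1})"
      "\<And>s. s \<in> {0..1} \<Longrightarrow> acceleration (c s) (u s) (a s)"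
    using cg unfolding coordinate_geodesic_def by metis
  have "norm (a s) \<le> K^2 * \<rho>^2" if "s \<in> {0..1}" for s
  proof -
    have "norm (a s) \<le> K^2 * (norm (u s))^2"
      using cg a(2) that by (intro acceleration_bound) (auto simp: coordinate_geodesic_def)
    also have "\<dots> \<le> K^2 * \<rho>^2"
      using u[OF that] by (intro mult_left_mono power_mono) auto
    finally show ?thesis .
  qed
  then show ?thesis
    by (intro second_order_Taylor_unit_interval[OF _ a(1)])
      (use cg s in \<open>auto simp: coordinate_geodesic_def\<close>)
qed

text \<open>A substitute for Gronwall's inequality: the difference of accelerations is at most a
  small multiple of the initial position difference plus the largest velocity difference on the
  interval, and the latter is absorbed. Uniqueness, continuous dependence and the contraction of the
  shooting map all come from this bound.\<close>

lemma coordinate_geodesic_diff: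
  assumes c1: "coordinate_geodesic c1 u1" and c2: "coordinate_geodesic c2 u2"
    and u1: "\<And>s. s \<in> {0..1} \<Longrightarrow> norm (u1 s) \<le> \<rho>"
    and u2: "\<And>s. s \<in> {0..1} \<Longrightarrow> norm (u2 s) \<le> \<rho>"
    and \<rho>: "\<rho> \<le> 1" "160 * K^6 * \<rho> \<le> 1" and s: "s \<in> {0..1}"
  shows "norm (c1 s - c2 s - (c1 0 - c2 0) - s *\<^sub>R (u1 0 - u2 0))
    \<le> (norm (c1 0 - c2 0) + norm (u1 0 - u2 0)) / 8"
proof -
  obtain a where a: "\<And>s. s \<in> {0..1} \<Longrightarrow> (u1 has_vector_derivative a s) (at s within {0..1})"
      "\<And>s. s \<in> {0..1} \<Longrightarrow> acceleration (c1 s) (u1 s) (a s)"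
    using c1 unfolding coordinate_geodesic_def by metis
  obtain b where b: "\<And>s. s \<in> {0..1} \<Longrightarrow> (u2 has_vector_derivative b s) (at s within {0..1})"
      "\<And>s. s \<in> {0..1} \<Longrightarrow> acceleration (c2 s) (u2 s) (b s)"
    using c2 unfolding coordinate_geodesic_def by metis
  define w where "w s = u1 s - u2 s" for s
  define x where "x s = c1 s - c2 s" for s
  have x': "(x has_vector_derivative w s) (at s within {0..1})" if "s \<in> {0..1}" for s
    using c1 c2 that unfolding x_def[abs_def] w_def coordinate_geodesic_def
    by (auto intro!: derivative_intros)
  have w': "(w has_vector_derivative a s - b s) (at s within {0..1})" if "s \<in> {0..1}" for s
    using a(1) b(1) that unfolding w_def[abs_def] by (auto intro!: derivative_intros)
  have "continuous_on {0..1} w"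
    by (rule continuous_on_vector_derivative) (rule w')
  then obtain m where m: "m \<in> {0..1}" "\<And>s. s \<in> {0..1} \<Longrightarrow> norm (w s) \<le> norm (w m)"
    using continuous_attains_sup[of "{0..1}" "\<lambda>s. norm (w s)"] continuous_on_norm by fastforce
  define M where "M = norm (w m)"
  define X where "X = norm (x 0)"
  define W where "W = norm (w 0)"
  define A where "A = 4 * K^6 * (\<rho>^2 * (X + M) + \<rho> * M)"
  have \<rho>0: "\<rho> \<ge> 0" using order_trans[OF norm_ge_zero u1[of 0]] by auto
  have nn: "M \<ge> 0" "X \<ge> 0" "W \<ge> 0" by (auto simp: M_def X_def W_def)
  have xs: "norm (x s) \<le> X + M" if "s \<in> {0..1}" for s
  proof -
    have "norm (x s - x 0) \<le> M"
      unfolding M_def using vector_derivative_bound_unit_interval[OF x' m(2) that] .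
    then show ?thesis unfolding X_def using norm_triangle_sub[of "x s" "x 0"] by simp
  qed
  have A: "norm (a s - b s) \<le> A" if "s \<in> {0..1}" for s
  proof -
    have "norm (a s - b s) \<le> 4 * K^6 * (\<rho>^2 * norm (c1 s - c2 s) + \<rho> * norm (u1 s - u2 s))"
      using c1 c2 a b u1 u2 that
      by (intro acceleration_diff_bound) (auto simp: coordinate_geodesic_def)
    also have "\<dots> \<le> A"
      unfolding A_def using xs[OF that] m(2)[OF that] \<rho>0 K
      by (intro mult_left_mono add_mono) (auto simp: x_def w_def M_def)
    finally show ?thesis .
  qed
  have "norm (w m - w 0) \<le> A"
    using vector_derivative_bound_unit_interval[OF w' A m(1)] .
  then have MA: "M \<le> W + A"
    unfolding M_def W_def using norm_triangle_sub[of "w m" "w 0"] by simp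
  have "\<rho>^2 \<le> \<rho>" using \<rho>(1) \<rho>0 by (simp add: power2_eq_square mult_left_le)
  then have "A \<le> 4 * K^6 * (\<rho> * (X + M) + \<rho> * M)"
    unfolding A_def using nn K by (intro mult_left_mono add_right_mono mult_right_mono) auto
  also have "\<dots> = (160 * K^6 * \<rho>) * (X + 2 * M) / 40"
    by (simp add: algebra_simps)
  also have "\<dots> \<le> 1 * (X + 2 * M) / 40"
    using \<rho>(2) nn by (intro divide_right_mono mult_right_mono) auto
  \<comment> \<open>The constant 160 is 4 times 40. With \<open>M \<le> W + A\<close> this gives
    \<open>38 * A \<le> X + 2 * W\<close>, hence \<open>A \<le> (X + W) / 8\<close>.\<close>
  finally have "40 * A \<le> X + 2 * M" by simp
  then have "A \<le> (X + W) / 8" using MA nn by argo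
  moreover have "norm (x s - x 0 - s *\<^sub>R w 0) \<le> A"
    by (rule second_order_Taylor_unit_interval[OF x' w' A s])
  ultimately show ?thesis unfolding x_def w_def X_def W_def by linarith
qed

end

section \<open>Midpoints\<close>

text \<open>\<open>Q\<close> singles out the coordinate geodesics that come from geodesics of the
  manifold, and \<open>h\<close> is \<open>f\<close> read in the chart. \<open>lines\<close> is
  stated apart from \<open>Q\<close> because it asks for curves that continue on both sides of
  \<open>z\<close>, with \<open>e\<close> of any length; the window and the error constant may
  depend on \<open>e\<close>.\<close>

locale geodesic_family = geodesic_equation E z R K D H
  for E :: "'a::euclidean_space set" and z R K D H +
  fixes Q :: "(real \<Rightarrow> 'a) \<Rightarrow> (real \<Rightarrow> 'a) \<Rightarrow> bool" and h :: "'a \<Rightarrow> real" and r P :: real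
  assumes z: "z \<in> E" and r: "r > 0" and P: "P \<ge> 1"
    and Q_geodesic: "Q c u \<Longrightarrow> coordinate_geodesic c u"
    and Q_affine: "Q c u \<Longrightarrow> \<exists>a b. \<forall>s\<in>{0..1}. h (c s) = a * s + b"
    and Q_exists: "x \<in> E \<Longrightarrow> x \<in> cball z r \<Longrightarrow> v \<in> E \<Longrightarrow> norm v \<le> r \<Longrightarrow>
      \<exists>c u. Q c u \<and> c 0 = x \<and> u 0 = v \<and> (\<forall>s\<in>{0..1}. norm (u s) \<le> P * norm v)"
    and lines: "e \<in> E \<Longrightarrow> \<exists>X k \<delta> C. \<delta> > 0 \<and> C \<ge> 0 \<and> continuous_on {-\<delta>..\<delta>} X \<and>
      (\<forall>t\<in>{-\<delta>..\<delta>}. X t \<in> E \<and> norm (X t - z - t *\<^sub>R e) \<le> C * t^2 \<and> h (X t) = h z + t * k)"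
begin

text \<open>Shooting: after choosing a geodesic from \<open>x\<close> for each small initial
  velocity, the velocity that hits \<open>y\<close> is the fixed point of a contraction.\<close>

lemma two_point_geodesics:
  "\<exists>r1>0. \<forall>x\<in>E \<inter> cball z r1. \<forall>y\<in>E \<inter> cball z r1. \<exists>c u. Q c u \<and> c 0 = x \<and> c 1 = y \<and>
     (\<forall>s\<in>{0..1}. norm (u s) \<le> 2 * P * norm (x - y) \<and> norm (u s) \<le> 1 / (160 * K^6))"
proof -
  define \<rho> where "\<rho> = 1 / (160 * K^6)"
  have K6: "K^6 \<ge> 1" using K by (rule one_le_power)
  then have \<rho>: "\<rho> > 0" "\<rho> \<le> 1" "160 * K^6 * \<rho> \<le> 1" by (auto simp: \<rho>_def divide_le_eq_1)
  \<comment> \<open>Velocities up to \<open>r0\<close> are admissible for \<open>Q_exists\<close>,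
    and \<open>P * r0 \<le> \<rho>\<close> keeps all speeds in the range of
    \<open>coordinate_geodesic_diff\<close>.\<close>
  define r0 where "r0 = min r (\<rho> / P)"
  have r0: "r0 > 0" "r0 \<le> r" "P * r0 \<le> \<rho>"
    using r P \<rho> by (auto simp: r0_def min_def field_simps)
  have "\<exists>c u. Q c u \<and> c 0 = x \<and> c 1 = y \<and>
     (\<forall>s\<in>{0..1}. norm (u s) \<le> 2 * P * norm (x - y) \<and> norm (u s) \<le> \<rho>)"
    if x: "x \<in> E \<inter> cball z (r0/4)" and y: "y \<in> E \<inter> cball z (r0/4)" for x y
  proof -
    define S where "S = E \<inter> cball 0 r0"
    have "\<forall>v. \<exists>c u. v \<in> S \<longrightarrow> Q c u \<and> c 0 = x \<and> u 0 = v \<and> (\<forall>s\<in>{0..1}. norm (u s) \<le> P * norm v)"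
      using Q_exists[of x] x r0 by (force simp: S_def)
    then obtain c u where cu: "\<And>v. v \<in> S \<Longrightarrow> Q (c v) (u v)" "\<And>v. v \<in> S \<Longrightarrow> c v 0 = x"
        "\<And>v. v \<in> S \<Longrightarrow> u v 0 = v" "\<And>v s. v \<in> S \<Longrightarrow> s \<in> {0..1} \<Longrightarrow> norm (u v s) \<le> P * norm v"
      by metis
    have u\<rho>: "norm (u v s) \<le> \<rho>" if "v \<in> S" "s \<in> {0..1}" for v s
    proof -
      have "P * norm v \<le> P * r0" using that P by (auto simp: S_def)
      then show ?thesis using cu(4)[OF that] r0(3) by linarith
    qed
    \<comment> \<open>A fixed point of \<open>T\<close> is a velocity with \<open>c v 1 = y\<close>.
      All these geodesics start at \<open>x\<close>, so the comparison estimate makes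
      \<open>T\<close> contract by 1/8.\<close>
    define T where "T v = y - x - (c v 1 - x - v)" for v
    have T: "norm (T v - T w) \<le> norm (v - w) / 8" if "v \<in> S" "w \<in> S" for v w
    proof -
      have "norm (c v 1 - c w 1 - (c v 0 - c w 0) - 1 *\<^sub>R (u v 0 - u w 0))
          \<le> (norm (c v 0 - c w 0) + norm (u v 0 - u w 0)) / 8"
        using that cu u\<rho> \<rho> Q_geodesic by (intro coordinate_geodesic_diff[where \<rho>=\<rho>]) auto
      then have "norm (c v 1 - c w 1 - (v - w)) \<le> norm (v - w) / 8"
        using that cu by simp
      moreover have "T v - T w = - (c v 1 - c w 1 - (v - w))"
        by (simp add: T_def)
      ultimately show ?thesis by (simp only: norm_minus_cancel)
    qed
    have 0: "0 \<in> S" using E r0 subspace_0 by (auto simp: S_def)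
    have "c 0 1 = x"
    proof -
      have "norm (c 0 1 - c 0 0) \<le> 0"
      proof (rule vector_derivative_bound_unit_interval)
        show "(c 0 has_vector_derivative u 0 s) (at s within {0..1})" if "s \<in> {0..1}" for s
          using Q_geodesic[OF cu(1)[OF 0]] that by (auto simp: coordinate_geodesic_def)
      qed (use cu(4)[OF 0] in auto)
      then show ?thesis using cu(2)[OF 0] by simp
    qed
    then have T0: "T 0 = y - x" by (simp add: T_def)
    \<comment> \<open>The radius \<open>r0/4\<close> leads to \<open>r0 / 2\<close> here, which
      leaves room for the term \<open>norm v / 8\<close> when \<open>T\<close> has to map
      \<open>S\<close> into itself.\<close>
    have xy: "norm (y - x) \<le> r0 / 2"
      using x y norm_triangle_ineq4[of "y - z" "x - z"] by (auto simp: dist_norm norm_minus_commute)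
    have T1: "norm (T v) \<le> norm (y - x) + norm v / 8" if "v \<in> S" for v
      using T[OF that 0] T0 norm_triangle_sub[of "T v" "y - x"] by simp
    have "\<exists>!v\<in>S. T v = v"
    proof (rule Banach_fix)
      show "complete S"
        unfolding S_def using E closed_subspace by (intro compact_imp_complete closed_Int_compact) auto
      show "T ` S \<subseteq> S"
      proof
        fix w assume "w \<in> T ` S"
        then obtain v where v: "v \<in> S" "w = T v" by auto
        have "c v 1 \<in> E"
          using Q_geodesic[OF cu(1)[OF v(1)]] by (auto simp: coordinate_geodesic_def)
        then have "T v \<in> E"
          unfolding T_def using x y v E by (auto simp: S_def intro!: subspace_diff)
        moreover have "norm (T v) \<le> r0"
          using T1[OF v(1)] xy v(1) r0(1) by (auto simp: S_def)
        ultimately show "w \<in> S" using v by (auto simp: S_def)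
      qed
      show "dist (T v) (T w) \<le> 1/8 * dist v w" if "v \<in> S" "w \<in> S" for v w
        using T[OF that] by (simp add: dist_norm)
    qed (use 0 in auto)
    then obtain v where v: "v \<in> S" "T v = v" by auto
    then have "c v 1 = y" by (simp add: T_def)
    have nv: "norm v \<le> 2 * norm (x - y)"
      using T1[OF v(1)] v(2) norm_ge_zero[of "x - y"] by (simp add: norm_minus_commute[of y x] del: norm_ge_zero)
    have "norm (u v s) \<le> 2 * P * norm (x - y)" if "s \<in> {0..1}" for s
    proof -
      have "P * norm v \<le> P * (2 * norm (x - y))" using nv P by (intro mult_left_mono) auto
      then show ?thesis using cu(4)[OF v(1) that] by linarith
    qed
    with \<open>c v 1 = y\<close> cu v u\<rho> show ?thesis by blast
  qed
  then show ?thesis using r0 unfolding \<rho>_def by (intro exI[of _ "r0/4"]) auto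
qed

text \<open>The midpoint is the joining geodesic at time 1/2. The end points determine its initial
  velocity up to a small relative error, whence the Lipschitz dependence. Expanding at times 1/2 and
  1 and subtracting half of the second from the first cancels the velocity and leaves a quadratic
  error.\<close>

lemma midpoint_map:
  "\<exists>r1>0. \<exists>C\<ge>0. \<exists>m. continuous_on ((E \<inter> cball z r1) \<times> (E \<inter> cball z r1)) (\<lambda>p. m (fst p) (snd p)) \<and>
     (\<forall>x\<in>E \<inter> cball z r1. \<forall>y\<in>E \<inter> cball z r1. m x y \<in> E \<and>
        norm (m x y - (1/2) *\<^sub>R (x + y)) \<le> C * (norm (x - y))^2 \<and> h (m x y) = (h x + h y) / 2)"
proof -
  define \<rho> where "\<rho> = 1 / (160 * K^6)"
  have K6: "K^6 \<ge> 1" using K by (rule one_le_power)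
  then have \<rho>: "\<rho> > 0" "\<rho> \<le> 1" "160 * K^6 * \<rho> \<le> 1" by (auto simp: \<rho>_def divide_le_eq_1)
  obtain r1 where r1: "r1 > 0" "\<forall>x\<in>E \<inter> cball z r1. \<forall>y\<in>E \<inter> cball z r1. \<exists>c u. Q c u \<and> c 0 = x \<and> c 1 = y \<and>
     (\<forall>s\<in>{0..1}. norm (u s) \<le> 2 * P * norm (x - y) \<and> norm (u s) \<le> \<rho>)"
    using two_point_geodesics unfolding \<rho>_def by blast
  define B where "B = E \<inter> cball z r1"
  have "\<forall>x y. \<exists>c u. x \<in> B \<and> y \<in> B \<longrightarrow> Q c u \<and> c 0 = x \<and> c 1 = y \<and>
     (\<forall>s\<in>{0..1}. norm (u s) \<le> 2 * P * norm (x - y) \<and> norm (u s) \<le> \<rho>)"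
    using r1(2) unfolding B_def by blast
  then obtain c u where cu': "\<forall>x y. x \<in> B \<and> y \<in> B \<longrightarrow> Q (c x y) (u x y) \<and> c x y 0 = x \<and> c x y 1 = y \<and>
     (\<forall>s\<in>{0..1}. norm (u x y s) \<le> 2 * P * norm (x - y) \<and> norm (u x y s) \<le> \<rho>)"
    by metis
  have cu: "Q (c x y) (u x y)" "c x y 0 = x" "c x y 1 = y"
      "\<And>s. s \<in> {0..1} \<Longrightarrow> norm (u x y s) \<le> 2 * P * norm (x - y)"
      "\<And>s. s \<in> {0..1} \<Longrightarrow> norm (u x y s) \<le> \<rho>" if "x \<in> B" "y \<in> B" for x y
    using cu' that by blast+
  define m where "m x y = c x y (1/2)" for x y
  have Lip: "norm (m x y - m x' y') \<le> 3 * (norm (x - x') + norm (y - y'))"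
    if B: "x \<in> B" "y \<in> B" "x' \<in> B" "y' \<in> B" for x y x' y'
  proof -
    define dx where "dx = x - x'"
    define dy where "dy = y - y'"
    define dv where "dv = u x y 0 - u x' y' 0"
    define dm where "dm = m x y - m x' y'"
    have *: "norm (c x y s - c x' y' s - dx - s *\<^sub>R dv) \<le> (norm dx + norm dv) / 8" if "s \<in> {0..1}" for s
      using coordinate_geodesic_diff[of "c x y" "u x y" "c x' y'" "u x' y'" \<rho> s] that B cu \<rho> Q_geodesic
      by (simp add: dx_def dv_def)
    have 1: "norm (dy - dx - dv) \<le> (norm dx + norm dv) / 8"
      using *[of 1] B cu(3) by (simp add: dy_def)
    have 2: "norm (dm - dx - (1/2) *\<^sub>R dv) \<le> (norm dx + norm dv) / 8"
      using *[of "1/2"] by (simp add: dm_def m_def)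
    \<comment> \<open>The estimate at time 1 is solved for \<open>dv\<close>; the term
      \<open>norm dv / 8\<close> on the right is absorbed.\<close>
    have "dv = dy - dx - (dy - dx - dv)" by simp
    then have "norm dv \<le> norm dy + norm dx + norm (dy - dx - dv)"
      by (metis norm_triangle_ineq4 norm_triangle_le_diff add_mono order_refl)
    then have 3: "norm dv \<le> 2 * (norm dx + norm dy)" using 1 norm_ge_zero[of dx] norm_ge_zero[of dy] by argo
    have "dm = (dm - dx - (1/2) *\<^sub>R dv) + dx + (1/2) *\<^sub>R dv" by simp
    then have "norm dm \<le> norm (dm - dx - (1/2) *\<^sub>R dv) + norm dx + norm ((1/2) *\<^sub>R dv)"
      by (metis norm_triangle_ineq norm_triangle_mono order_refl)
    moreover have "norm ((1/2) *\<^sub>R dv) = norm dv / 2" by simp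
    ultimately have "norm dm \<le> 3 * (norm dx + norm dy)"
      using 2 3 norm_ge_zero[of dx] norm_ge_zero[of dy] by argo
    then show ?thesis unfolding dm_def dx_def dy_def .
  qed
  have cont: "continuous_on (B \<times> B) (\<lambda>p. m (fst p) (snd p))"
    unfolding continuous_on_def
  proof
    fix p assume p: "p \<in> B \<times> B"
    have "((\<lambda>q. 3 * (norm (fst q - fst p) + norm (snd q - snd p))) \<longlongrightarrow> 3 * (norm (fst p - fst p) + norm (snd p - snd p)))
        (at p within B \<times> B)"
      by (intro tendsto_intros)
    then have "((\<lambda>q. 3 * (norm (fst q - fst p) + norm (snd q - snd p))) \<longlongrightarrow> 0) (at p within B \<times> B)"
      by simp
    then have "((\<lambda>q. m (fst q) (snd q) - m (fst p) (snd p)) \<longlongrightarrow> 0) (at p within B \<times> B)"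
    proof (rule Lim_null_comparison[rotated])
      show "\<forall>\<^sub>F q in at p within B \<times> B. norm (m (fst q) (snd q) - m (fst p) (snd p))
          \<le> 3 * (norm (fst q - fst p) + norm (snd q - snd p))"
        unfolding eventually_at_filter using Lip p by (auto simp: mem_Times_iff)
    qed
    then show "((\<lambda>p. m (fst p) (snd p)) \<longlongrightarrow> m (fst p) (snd p)) (at p within B \<times> B)"
      by (simp add: LIM_zero_iff)
  qed
  \<comment> \<open>The constant is 3/2 times \<open>K^2 * (2 * P)^2\<close>: the error at time 1/2
    plus half the error at time 1.\<close>
  have "m x y \<in> E \<and> norm (m x y - (1/2) *\<^sub>R (x + y)) \<le> (6 * K^2 * P^2) * (norm (x - y))^2
      \<and> h (m x y) = (h x + h y) / 2" if B: "x \<in> B" "y \<in> B" for x y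
  proof (intro conjI)
    note cg = Q_geodesic[OF cu(1)[OF B]]
    show "m x y \<in> E" using cg by (auto simp: m_def coordinate_geodesic_def)
    define v where "v = u x y 0"
    define Y where "Y = K^2 * (2 * P * norm (x - y))^2"
    have *: "norm (c x y s - x - s *\<^sub>R v) \<le> Y" if "s \<in> {0..1}" for s
      using coordinate_geodesic_expansion[OF cg cu(4)[OF B] that] cu(2)[OF B] by (simp add: v_def Y_def)
    have 1: "norm (y - x - v) \<le> Y" using *[of 1] cu(3)[OF B] by simp
    have 2: "norm (m x y - x - (1/2) *\<^sub>R v) \<le> Y" using *[of "1/2"] by (simp add: m_def)
    have "x = (1/2) *\<^sub>R x + (1/2) *\<^sub>R x" by (simp flip: scaleR_left_distrib)
    then have "m x y - (1/2) *\<^sub>R (x + y) = (m x y - x - (1/2) *\<^sub>R v) - (1/2) *\<^sub>R (y - x - v)"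
      by (simp add: algebra_simps)
    then have "norm (m x y - (1/2) *\<^sub>R (x + y)) \<le> norm (m x y - x - (1/2) *\<^sub>R v) + norm ((1/2) *\<^sub>R (y - x - v))"
      by (metis norm_triangle_ineq4)
    also have "\<dots> \<le> Y + (1/2) * Y" using 1 2 by simp
    also have "\<dots> = (6 * K^2 * P^2) * (norm (x - y))^2" by (simp add: Y_def power_mult_distrib)
    finally show "norm (m x y - (1/2) *\<^sub>R (x + y)) \<le> (6 * K^2 * P^2) * (norm (x - y))^2" .
    obtain a b where ab: "\<forall>s\<in>{0..1}. h (c x y s) = a * s + b" using Q_affine[OF cu(1)[OF B]] by blast
    have "h x = b" "h y = a + b" "h (m x y) = a * (1/2) + b"
      using bspec[OF ab, of 0] bspec[OF ab, of 1] bspec[OF ab, of "1/2"] cu(2,3)[OF B] by (auto simp: m_def)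
    then show "h (m x y) = (h x + h y) / 2" by simp
  qed
  then show ?thesis
    using r1(1) cont unfolding B_def
    by (intro exI[of _ r1] exI[of _ "6 * K^2 * P^2"] exI[of _ m] conjI) auto
qed

end

section \<open>First-order expansion of an affine function\<close>

context geodesic_family
begin

lemma slopes:
  "\<exists>k. \<forall>e\<in>E. \<exists>X \<delta> C. \<delta> > 0 \<and> C \<ge> 0 \<and> continuous_on {-\<delta>..\<delta>} X \<and>
      (\<forall>t\<in>{-\<delta>..\<delta>}. X t \<in> E \<and> norm (X t - z - t *\<^sub>R e) \<le> C * t^2 \<and> h (X t) = h z + t * k e)"
  by (rule bchoice) (use lines in metis)

text \<open>Induction over the directions: the new point is the midpoint of a point already built
  and a point on the curve in the new direction. The slopes of \<open>h\<close> in the single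
  directions then add up exactly, although nothing relates them beforehand.\<close>

lemma affine_parametrization:
  assumes k: "\<And>e. e \<in> E \<Longrightarrow> \<exists>X \<delta> C. \<delta> > 0 \<and> C \<ge> 0 \<and> continuous_on {-\<delta>..\<delta>} X \<and>
      (\<forall>t\<in>{-\<delta>..\<delta>}. X t \<in> E \<and> norm (X t - z - t *\<^sub>R e) \<le> C * t^2 \<and> h (X t) = h z + t * k e)"
    and "finite B" "B \<subseteq> E" "\<And>e. e \<in> B \<Longrightarrow> norm e = 1"
  shows "\<exists>F \<delta> C. \<delta> > 0 \<and> C \<ge> 0 \<and> continuous_on (cball 0 \<delta>) F \<and>
      (\<forall>t\<in>cball 0 \<delta>. F t \<in> E \<and> norm (F t - z - (\<Sum>b\<in>B. (t \<bullet> b) *\<^sub>R b)) \<le> C * (norm t)^2 \<and>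
        h (F t) = h z + (\<Sum>b\<in>B. (t \<bullet> b) * k b))"
  using assms(2-)
proof (induction B rule: finite_induct)
  case empty
  then show ?case using z by (intro exI[of _ "\<lambda>_. z"] exI[of _ 1] exI[of _ 0]) auto
next
  case (insert e B)
  obtain F \<delta> C where F: "\<delta> > 0" "C \<ge> 0" "continuous_on (cball 0 \<delta>) F"
      "\<And>t. t \<in> cball 0 \<delta> \<Longrightarrow> F t \<in> E"
      "\<And>t. t \<in> cball 0 \<delta> \<Longrightarrow> norm (F t - z - (\<Sum>b\<in>B. (t \<bullet> b) *\<^sub>R b)) \<le> C * (norm t)^2"
      "\<And>t. t \<in> cball 0 \<delta> \<Longrightarrow> h (F t) = h z + (\<Sum>b\<in>B. (t \<bullet> b) * k b)"
    using insert by auto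
  have e: "e \<in> E" "norm e = 1" using insert by auto
  obtain X \<epsilon> L where X: "\<epsilon> > 0" "L \<ge> 0" "continuous_on {-\<epsilon>..\<epsilon>} X"
    and X': "\<forall>t\<in>{-\<epsilon>..\<epsilon>}. X t \<in> E \<and> norm (X t - z - t *\<^sub>R e) \<le> L * t^2 \<and> h (X t) = h z + t * k e"
    using k[OF e(1)] by blast
  have Xt: "X t \<in> E" "norm (X t - z - t *\<^sub>R e) \<le> L * t^2" "h (X t) = h z + t * k e"
    if "t \<in> {-\<epsilon>..\<epsilon>}" for t
    using X' that by blast+
  obtain r1 Cm m where m: "r1 > 0" "Cm \<ge> 0"
      "continuous_on ((E \<inter> cball z r1) \<times> (E \<inter> cball z r1)) (\<lambda>p. m (fst p) (snd p))"
    and m': "\<forall>x\<in>E \<inter> cball z r1. \<forall>y\<in>E \<inter> cball z r1. m x y \<in> E \<and>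
        norm (m x y - (1/2) *\<^sub>R (x + y)) \<le> Cm * (norm (x - y))^2 \<and> h (m x y) = (h x + h y) / 2"
    using midpoint_map by blast
  have mxy: "m x y \<in> E" "norm (m x y - (1/2) *\<^sub>R (x + y)) \<le> Cm * (norm (x - y))^2"
      "h (m x y) = (h x + h y) / 2" if "x \<in> E \<inter> cball z r1" "y \<in> E \<inter> cball z r1" for x y
    using m' that by blast+
  define S where "S t = (\<Sum>b\<in>B. (t \<bullet> b) *\<^sub>R b)" for t
  define n where "n = real (card B)"
  have nS: "norm (S t) \<le> n * norm t" for t
  proof -
    have "norm (S t) \<le> (\<Sum>b\<in>B. norm t)"
      unfolding S_def
    proof (intro order_trans[OF norm_sum] sum_mono)
      fix b assume "b \<in> B"
      then have "norm b = 1" using insert.prems by auto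
      then show "norm ((t \<bullet> b) *\<^sub>R b) \<le> norm t"
        using Cauchy_Schwarz_ineq2[of t b] by simp
    qed
    then show ?thesis by (simp add: n_def)
  qed
  \<comment> \<open>The sum of the constants in \<open>F2\<close> and \<open>X2\<close>: it bounds
    the distance of both arguments of \<open>m\<close> from \<open>z\<close>, and their mutual
    distance, in units of \<open>norm t\<close>.\<close>
  define A where "A = 2 * n + 4 * C + 2 + 4 * L"
  have A: "A \<ge> 1" using F(2) X(2) by (auto simp: A_def n_def)
  \<comment> \<open>The halves make room for doubled arguments, the bound 1 allows
    \<open>(norm t)^2 \<le> norm t\<close>, and \<open>r1 / A\<close> keeps both points in the
    domain of \<open>m\<close>.\<close>
  define \<gamma> where "\<gamma> = min 1 (min (\<delta> / 2) (min (\<epsilon> / 2) (r1 / A)))"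
  have \<gamma>: "\<gamma> > 0" "\<gamma> \<le> 1" "2 * \<gamma> \<le> \<delta>" "2 * \<gamma> \<le> \<epsilon>" "A * \<gamma> \<le> r1"
  proof -
    show "\<gamma> > 0" "\<gamma> \<le> 1" "2 * \<gamma> \<le> \<delta>" "2 * \<gamma> \<le> \<epsilon>"
      using F(1) X(1) m(1) A by (auto simp: \<gamma>_def)
    have "\<gamma> \<le> r1 / A" by (simp add: \<gamma>_def)
    then show "A * \<gamma> \<le> r1" using A by (simp add: field_simps)
  qed
  \<comment> \<open>Doubling both arguments compensates the averaging in the midpoint, in the
    position as well as in the value of \<open>h\<close>.\<close>
  define G where "G t = m (F (2 *\<^sub>R t)) (X (2 * (t \<bullet> e)))" for t
  have te: "\<bar>t \<bullet> e\<bar> \<le> norm t" for t using Cauchy_Schwarz_ineq2[of t e] e by simp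
  have in1: "2 *\<^sub>R t \<in> cball 0 \<delta>" and in2: "2 * (t \<bullet> e) \<in> {-\<epsilon>..\<epsilon>}" if "t \<in> cball 0 \<gamma>" for t
    using that \<gamma> te[of t] by auto
  have S2: "S (2 *\<^sub>R t) = 2 *\<^sub>R S t" for t by (simp add: S_def scaleR_sum_right)
  have F1: "norm (F (2 *\<^sub>R t) - z - 2 *\<^sub>R S t) \<le> 4 * C * (norm t)^2" if "t \<in> cball 0 \<gamma>" for t
    using F(5)[OF in1[OF that]] unfolding S_def[symmetric] S2 by (simp add: power_mult_distrib)
  have X1: "norm (X (2 * (t \<bullet> e)) - z - (2 * (t \<bullet> e)) *\<^sub>R e) \<le> 4 * L * (norm t)^2" if "t \<in> cball 0 \<gamma>" for t
  proof -
    have "(t \<bullet> e)^2 \<le> (norm t)^2" using te[of t] by (simp add: abs_le_square_iff[symmetric])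
    then have "L * (2 * (t \<bullet> e))^2 \<le> 4 * L * (norm t)^2"
      using X(2) by (simp add: power_mult_distrib mult_left_mono)
    then show ?thesis using Xt(2)[OF in2[OF that]] by linarith
  qed
  have sq: "(norm t)^2 \<le> norm t" if "t \<in> cball 0 \<gamma>" for t :: 'a
    using that \<gamma> by (simp add: power2_eq_square mult_left_le)
  have F2: "norm (F (2 *\<^sub>R t) - z) \<le> (2 * n + 4 * C) * norm t" if "t \<in> cball 0 \<gamma>" for t
  proof -
    have "norm (F (2 *\<^sub>R t) - z) \<le> norm (F (2 *\<^sub>R t) - z - 2 *\<^sub>R S t) + norm (2 *\<^sub>R S t)"
      by (metis norm_triangle_sub add.commute)
    also have "\<dots> \<le> 4 * C * norm t + 2 * (n * norm t)"
    proof (rule add_mono)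
      show "norm (F (2 *\<^sub>R t) - z - 2 *\<^sub>R S t) \<le> 4 * C * norm t"
        using F1[OF that] mult_left_mono[OF sq[OF that], of "4 * C"] F(2) by linarith
    qed (use nS[of t] in auto)
    finally show ?thesis by (simp add: algebra_simps)
  qed
  have X2: "norm (X (2 * (t \<bullet> e)) - z) \<le> (2 + 4 * L) * norm t" if "t \<in> cball 0 \<gamma>" for t
  proof -
    have "norm (X (2 * (t \<bullet> e)) - z) \<le> norm (X (2 * (t \<bullet> e)) - z - (2 * (t \<bullet> e)) *\<^sub>R e) + norm ((2 * (t \<bullet> e)) *\<^sub>R e)"
      by (metis norm_triangle_sub add.commute)
    also have "\<dots> \<le> 4 * L * norm t + 2 * norm t"
    proof (rule add_mono)
      show "norm (X (2 * (t \<bullet> e)) - z - (2 * (t \<bullet> e)) *\<^sub>R e) \<le> 4 * L * norm t"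
        using X1[OF that] mult_left_mono[OF sq[OF that], of "4 * L"] X(2) by linarith
    qed (use te[of t] e in \<open>auto simp: abs_mult\<close>)
    finally show ?thesis by (simp add: algebra_simps)
  qed
  have Ale: "(2 * n + 4 * C) * norm t \<le> r1" "(2 + 4 * L) * norm t \<le> r1" if "t \<in> cball 0 \<gamma>" for t :: 'a
  proof -
    have "A * norm t \<le> A * \<gamma>" using that A by (intro mult_left_mono) auto
    then have *: "A * norm t \<le> r1" using \<gamma> by linarith
    have "(2 * n + 4 * C) * norm t \<le> A * norm t" "(2 + 4 * L) * norm t \<le> A * norm t"
      using F(2) X(2) by (intro mult_right_mono; simp add: A_def n_def)+
    then show "(2 * n + 4 * C) * norm t \<le> r1" "(2 + 4 * L) * norm t \<le> r1"
      using * by linarith+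
  qed
  have FE: "F (2 *\<^sub>R t) \<in> E \<inter> cball z r1" and XE: "X (2 * (t \<bullet> e)) \<in> E \<inter> cball z r1"
    if "t \<in> cball 0 \<gamma>" for t
    using F(4)[OF in1[OF that]] Xt(1)[OF in2[OF that]] F2[OF that] X2[OF that] Ale[OF that]
    by (auto simp: dist_norm norm_minus_commute)
  have "continuous_on (cball 0 \<gamma>) (\<lambda>t. (F (2 *\<^sub>R t), X (2 * (t \<bullet> e))))"
    using in1 in2
    by (intro continuous_on_Pair continuous_on_compose2[OF F(3)] continuous_on_compose2[OF X(3)] continuous_intros) blast+
  then have cont: "continuous_on (cball 0 \<gamma>) G"
    unfolding G_def using continuous_on_compose2[OF m(3), of "cball 0 \<gamma>" "\<lambda>t. (F (2 *\<^sub>R t), X (2 * (t \<bullet> e)))"] FE XE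
    by (auto simp: image_subset_iff)
  have main: "G t \<in> E \<and> norm (G t - z - (\<Sum>b\<in>insert e B. (t \<bullet> b) *\<^sub>R b)) \<le> (2 * C + 2 * L + Cm * A^2) * (norm t)^2 \<and>
        h (G t) = h z + (\<Sum>b\<in>insert e B. (t \<bullet> b) * k b)" if t: "t \<in> cball 0 \<gamma>" for t
  proof (intro conjI)
    show "G t \<in> E" unfolding G_def using mxy(1)[OF FE[OF t] XE[OF t]]  .
    have h1: "h (F (2 *\<^sub>R t)) = h z + (\<Sum>b\<in>B. (2 * (t \<bullet> b)) * k b)"
      using F(6)[OF in1[OF t]] by simp
    have "(\<Sum>b\<in>B. (2 * (t \<bullet> b)) * k b) = 2 * (\<Sum>b\<in>B. (t \<bullet> b) * k b)"
      by (simp add: sum_distrib_left mult.assoc)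
    then show "h (G t) = h z + (\<Sum>b\<in>insert e B. (t \<bullet> b) * k b)"
      using mxy(3)[OF FE[OF t] XE[OF t]] h1 Xt(3)[OF in2[OF t]] insert.hyps by (simp add: G_def)
    define f where "f = F (2 *\<^sub>R t) - z"
    define x where "x = X (2 * (t \<bullet> e)) - z"
    have f: "norm f \<le> (2 * n + 4 * C) * norm t" and x: "norm x \<le> (2 + 4 * L) * norm t"
      using F2[OF t] X2[OF t] by (auto simp: f_def x_def)
    have "norm (f - x) \<le> A * norm t"
      using norm_triangle_ineq4[of f x] f x by (simp add: A_def algebra_simps)
    then have "(norm (f - x))^2 \<le> A^2 * (norm t)^2"
      using power_mono[of "norm (f - x)" "A * norm t" 2] by (simp add: power_mult_distrib)
    then have 1: "Cm * (norm (f - x))^2 \<le> Cm * A^2 * (norm t)^2"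
      using mult_left_mono[OF _ m(2)] by (simp add: mult.assoc)
    have "F (2 *\<^sub>R t) - X (2 * (t \<bullet> e)) = f - x" by (simp add: f_def x_def)
    then have 2: "norm (G t - (1/2) *\<^sub>R (F (2 *\<^sub>R t) + X (2 * (t \<bullet> e)))) \<le> Cm * A^2 * (norm t)^2"
      using mxy(2)[OF FE[OF t] XE[OF t]] 1 by (simp add: G_def)
    have z2: "z = (1/2) *\<^sub>R (z + z)" by (simp flip: scaleR_2)
    have s: "(\<Sum>b\<in>insert e B. (t \<bullet> b) *\<^sub>R b) = (t \<bullet> e) *\<^sub>R e + S t"
      using insert.hyps by (simp add: S_def)
    have "G t - z - (\<Sum>b\<in>insert e B. (t \<bullet> b) *\<^sub>R b) =
      (G t - (1/2) *\<^sub>R (F (2 *\<^sub>R t) + X (2 * (t \<bullet> e)))) + (1/2) *\<^sub>R (f - 2 *\<^sub>R S t)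
        + (1/2) *\<^sub>R (x - (2 * (t \<bullet> e)) *\<^sub>R e)"
      unfolding s f_def x_def by (subst z2) (simp add: algebra_simps)
    also have "norm \<dots> \<le> norm (G t - (1/2) *\<^sub>R (F (2 *\<^sub>R t) + X (2 * (t \<bullet> e)))) + norm ((1/2) *\<^sub>R (f - 2 *\<^sub>R S t))
        + norm ((1/2) *\<^sub>R (x - (2 * (t \<bullet> e)) *\<^sub>R e))"
      by (intro norm_triangle_mono norm_triangle_ineq order_refl)
    also have "\<dots> \<le> Cm * A^2 * (norm t)^2 + 2 * C * (norm t)^2 + 2 * L * (norm t)^2"
      using 2 F1[OF t] X1[OF t] by (intro add_mono) (auto simp: f_def x_def)
    finally show "norm (G t - z - (\<Sum>b\<in>insert e B. (t \<bullet> b) *\<^sub>R b)) \<le> (2 * C + 2 * L + Cm * A^2) * (norm t)^2"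
      by (simp add: algebra_simps)
  qed
  show ?case
    using \<gamma>(1) cont main F(2) X(2) m(2)
    by (intro exI[of _ G] exI[of _ \<gamma>] exI[of _ "2 * C + 2 * L + Cm * A^2"] conjI) auto
qed

text \<open>Once \<open>y\<close> is written as \<open>F t\<close>, the value \<open>h y\<close> is
  known exactly and \<open>t\<close> differs from \<open>y - z\<close> only quadratically. The
  functional is linear by construction, being assembled from the slopes along an orthonormal
  basis.\<close>

lemma first_order_expansion:
  "\<exists>k. linear k \<and> (\<exists>\<delta>>0. \<exists>C. \<forall>y\<in>E \<inter> cball z \<delta>. \<bar>h y - h z - k (y - z)\<bar> \<le> C * (norm (y - z))^2)"
proof -
  obtain B where B: "B \<subseteq> E" "pairwise orthogonal B" "\<And>b. b \<in> B \<Longrightarrow> norm b = 1" "independent B" "span B = E"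
    using orthonormal_basis_subspace[OF E] by metis
  have fB: "finite B" using B(4) independent_imp_finite by blast
  have rep: "(\<Sum>b\<in>B. (t \<bullet> b) *\<^sub>R b) = t" if "t \<in> E" for t
  proof -
    have "t - (\<Sum>b\<in>B. (t \<bullet> b) *\<^sub>R b) \<in> span B"
      using that B by (intro span_diff span_sum span_scale) (auto intro: span_base)
    moreover have "(t - (\<Sum>b\<in>B. (t \<bullet> b) *\<^sub>R b)) \<bullet> c = 0" if c: "c \<in> B" for c
    proof -
      have "(\<Sum>b\<in>B. (t \<bullet> b) *\<^sub>R b) \<bullet> c = (\<Sum>b\<in>B. (t \<bullet> b) * (b \<bullet> c))"
        by (simp add: inner_sum_left)
      also have "\<dots> = (\<Sum>b\<in>B. if b = c then t \<bullet> c else 0)"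
      proof (rule sum.cong[OF refl])
        fix b assume b: "b \<in> B"
        show "(t \<bullet> b) * (b \<bullet> c) = (if b = c then t \<bullet> c else 0)"
          using B(2,3) b c by (auto simp: pairwise_def orthogonal_def power2_norm_eq_inner[symmetric])
      qed
      also have "\<dots> = t \<bullet> c" using fB c by simp
      finally show ?thesis by (simp add: inner_diff_left)
    qed
    ultimately have "t - (\<Sum>b\<in>B. (t \<bullet> b) *\<^sub>R b) = 0"
      using orthogonal_to_span[of "t - (\<Sum>b\<in>B. (t \<bullet> b) *\<^sub>R b)" B] orthogonal_self
      unfolding orthogonal_def by blast
    then show ?thesis by simp
  qed
  obtain k where k: "\<And>e. e \<in> E \<Longrightarrow> \<exists>X \<delta> C. \<delta> > 0 \<and> C \<ge> 0 \<and> continuous_on {-\<delta>..\<delta>} X \<and>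
      (\<forall>t\<in>{-\<delta>..\<delta>}. X t \<in> E \<and> norm (X t - z - t *\<^sub>R e) \<le> C * t^2 \<and> h (X t) = h z + t * k e)"
    using slopes by blast
  obtain F \<delta> C where F: "\<delta> > 0" "C \<ge> 0" "continuous_on (cball 0 \<delta>) F"
    and F': "\<forall>t\<in>cball 0 \<delta>. F t \<in> E \<and> norm (F t - z - (\<Sum>b\<in>B. (t \<bullet> b) *\<^sub>R b)) \<le> C * (norm t)^2 \<and>
        h (F t) = h z + (\<Sum>b\<in>B. (t \<bullet> b) * k b)"
    using affine_parametrization[OF k fB B(1,3)] by blast
  have Ft: "F t \<in> E" "norm (F t - z - (\<Sum>b\<in>B. (t \<bullet> b) *\<^sub>R b)) \<le> C * (norm t)^2"
      "h (F t) = h z + (\<Sum>b\<in>B. (t \<bullet> b) * k b)" if "t \<in> cball 0 \<delta>" for t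
    using F' that by blast+
  define l where "l t = (\<Sum>b\<in>B. (t \<bullet> b) * k b)" for t
  have lin: "linear l"
    by (rule linearI) (auto simp: l_def inner_add_left sum.distrib algebra_simps sum_distrib_left)
  obtain L where L: "\<And>t. norm (l t) \<le> L * norm t" "L > 0"
    using linear_bounded_pos[OF lin] by metis
  \<comment> \<open>\<open>4 * C * \<epsilon> \<le> 1\<close> makes the quadratic error of
    \<open>F\<close> on the ball of radius \<open>2 * \<eta>\<close> at most
    \<open>\<eta>\<close>.\<close>
  define \<epsilon> where "\<epsilon> = min (\<delta> / 2) (1 / (4 * C + 4))"
  have \<epsilon>: "\<epsilon> > 0" "2 * \<epsilon> \<le> \<delta>" "4 * C * \<epsilon> \<le> 1"
    using F by (auto simp: \<epsilon>_def min_def field_simps)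
  have "\<bar>h y - h z - l (y - z)\<bar> \<le> (L * (4 * C)) * (norm (y - z))^2" if y: "y \<in> E \<inter> cball z \<epsilon>" for y
  proof -
    define \<eta> where "\<eta> = norm (y - z)"
    have \<eta>: "\<eta> \<le> \<epsilon>" "\<eta> \<ge> 0" using y by (auto simp: \<eta>_def dist_norm norm_minus_commute)
    define S where "S = E \<inter> cball 0 (2 * \<eta>)"
    \<comment> \<open>A fixed point of \<open>T\<close> solves \<open>F t = y\<close>. All terms
      stay in \<open>E\<close>, so Brouwer's theorem is applied to a closed ball of
      \<open>E\<close>.\<close>
    define T where "T t = t - (F t - z) + (y - z)" for t
    have S\<delta>: "S \<subseteq> cball 0 \<delta>" using \<eta> \<epsilon> by (auto simp: S_def)
    have F5: "norm (F t - z - t) \<le> C * (norm t)^2" if "t \<in> S" for t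
      using Ft(2)[of t] that S\<delta> rep[of t] by (auto simp: S_def)
    have TS: "T t \<in> S" if t: "t \<in> S" for t
    proof -
      have "T t \<in> E" unfolding T_def
        using t E z y Ft(1)[of t] S\<delta> by (intro subspace_add subspace_diff) (auto simp: S_def)
      moreover have "norm (T t) \<le> 2 * \<eta>"
      proof -
        have "T t = (y - z) - (F t - z - t)" by (simp add: T_def)
        then have "norm (T t) \<le> \<eta> + norm (F t - z - t)"
          unfolding \<eta>_def by (metis norm_triangle_ineq4)
        also have "\<dots> \<le> \<eta> + C * (2 * \<eta>)^2"
          using F5[OF t] t F(2)
            mult_left_mono[OF power_mono[of "norm t" "2 * \<eta>" 2] F(2)] by (auto simp: S_def)
        also have "C * (2 * \<eta>)^2 = (4 * C * \<eta>) * \<eta>" by (simp add: power2_eq_square)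
        also have "\<dots> \<le> 1 * \<eta>"
          using \<epsilon>(3) mult_left_mono[OF \<eta>(1), of "4 * C"] F(2) \<eta>(2) by (intro mult_right_mono) auto
        finally show ?thesis by simp
      qed
      ultimately show ?thesis by (simp add: S_def)
    qed
    have "compact S"
      unfolding S_def using closed_subspace[OF E] by (intro closed_Int_compact) auto
    moreover have "convex S"
      unfolding S_def using subspace_imp_convex[OF E] by (intro convex_Int) auto
    moreover have "S \<noteq> {}" using subspace_0[OF E] \<eta> by (auto simp: S_def)
    moreover have "continuous_on S T"
      unfolding T_def by (intro continuous_intros continuous_on_subset[OF F(3) S\<delta>])
    ultimately obtain t where t: "t \<in> S" "T t = t"
      using brouwer[of S T] TS by (metis Pi_I)
    then have Fty: "F t = y" by (simp add: T_def)
    have t2: "norm t \<le> 2 * \<eta>" using t by (simp add: S_def)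
    have hy: "h y = h z + l t" using Ft(3)[of t] t S\<delta> Fty by (auto simp: l_def)
    have "norm (y - z - t) \<le> C * (2 * \<eta>)^2"
      using F5[OF t(1)] Fty mult_left_mono[OF power_mono[OF t2, of 2] F(2)] by simp
    then have "norm (l (y - z - t)) \<le> L * (C * (2 * \<eta>)^2)"
      using L(1)[of "y - z - t"] L(2) by (meson mult_left_mono less_imp_le order_trans)
    moreover have "h y - h z - l (y - z) = - l (y - z - t)"
      using hy linear_diff[OF lin, of "y - z" t] by simp
    ultimately show ?thesis by (simp add: \<eta>_def power_mult_distrib)
  qed
  then show ?thesis using lin \<epsilon>(1) by blast
qed

end

section \<open>Slice charts and geodesics of submanifolds\<close>

lemma orthogonal_decomposition:
  fixes S :: "'a::euclidean_space set"
  assumes "subspace S"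
  obtains y n where "y \<in> S" "\<And>w. w \<in> S \<Longrightarrow> n \<bullet> w = 0" "x = y + n"
proof -
  obtain y n where "y \<in> span S" "\<And>w. w \<in> span S \<Longrightarrow> orthogonal n w" "x = y + n"
    using orthogonal_subspace_decomp_exists[of S x] by blast
  then show ?thesis
    using that[of y n] span_eq_iff[THEN iffD2, OF assms] by (simp add: orthogonal_def)
qed

text \<open>Pair the curve with the component of \<open>w\<close> normal to \<open>E\<close>: the
  product vanishes near \<open>t\<close>, so its derivative, the squared length of that component,
  is zero.\<close>

lemma vector_derivative_in_subspace:
  fixes c :: "real \<Rightarrow> 'a::euclidean_space"
  assumes E: "subspace E" and c: "(c has_vector_derivative w) (at t)"
    and S: "open S" "t \<in> S" "\<And>s. s \<in> S \<Longrightarrow> c s \<in> E"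
  shows "w \<in> E"
proof -
  obtain y n where yn: "y \<in> E" "\<And>w. w \<in> E \<Longrightarrow> n \<bullet> w = 0" "w = y + n"
    using orthogonal_decomposition[OF E] by metis
  have "((\<lambda>s. n \<bullet> c s) has_vector_derivative n \<bullet> w) (at t)"
    using bounded_linear.has_vector_derivative[OF bounded_linear_inner_right c] .
  moreover have "((\<lambda>s. n \<bullet> c s) has_vector_derivative 0) (at t)"
    by (rule has_vector_derivative_transform_within_open[OF has_vector_derivative_const S(1,2)])
      (use S(3) yn(2) in auto)
  ultimately have "n \<bullet> w = 0"
    using vector_derivative_unique_at by blast
  then have "n = 0" using yn by (simp add: inner_add_right)
  then show ?thesis using yn by simp
qed

lemma smooth_on_cong: "open S \<Longrightarrow> (\<And>x. x \<in> S \<Longrightarrow> f x = g x) \<Longrightarrow> smooth_on S f \<Longrightarrow> smooth_on S g"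
  unfolding smooth_on_def using C_k_on_cong by blast

lemma smooth_on_velocity:
  fixes \<alpha> :: "real \<Rightarrow> 'a::real_normed_vector"
  assumes "smooth_on I \<alpha>" "open I"
  shows "s \<in> I \<Longrightarrow> (\<alpha> has_vector_derivative velocity \<alpha> s) (at s)" "smooth_on I (velocity \<alpha>)"
proof -
  have fd: "(\<alpha> has_vector_derivative frechet_derivative \<alpha> (at s) 1) (at s)" if "s \<in> I" for s
  proof -
    note der = smooth_on_has_derivative[OF assms(1) that]
    define k where "k = frechet_derivative \<alpha> (at s) 1"
    have "frechet_derivative \<alpha> (at s) = (\<lambda>h. h *\<^sub>R k)"
    proof
      fix h
      show "frechet_derivative \<alpha> (at s) h = h *\<^sub>R k"
        using linear_scale[OF has_derivative_linear[OF der], of h 1] by (simp add: k_def)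
    qed
    then show ?thesis using der by (simp add: has_vector_derivative_def k_def[symmetric])
  qed
  show "s \<in> I \<Longrightarrow> (\<alpha> has_vector_derivative velocity \<alpha> s) (at s)"
    using fd[of s] by (simp add: velocity_def vector_derivative_at)
  show "smooth_on I (velocity \<alpha>)"
    by (rule smooth_on_cong[OF assms(2) _ smooth_on_frechet_derivative[OF assms(1), of 1]])
      (simp add: velocity_def vector_derivative_at[OF fd])
qed

definition acceleration_vector :: "(real \<Rightarrow> 'a::real_normed_vector) \<Rightarrow> real \<Rightarrow> 'a" where
  "acceleration_vector \<alpha> s = vector_derivative (velocity \<alpha>) (at s)"

lemma velocity_has_vector_derivative:
  assumes "smooth_on I \<alpha>" "open I" "s \<in> I"
  shows "(velocity \<alpha> has_vector_derivative acceleration_vector \<alpha> s) (at s)"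
  using smooth_on_velocity(1)[OF smooth_on_velocity(2)[OF assms(1,2)] assms(2,3)]
  by (simp add: acceleration_vector_def velocity_def)

text \<open>Replaces the definite description in \<open>tangential_part\<close> by orthogonality;
  the subspace hypothesis gives existence and uniqueness of the decomposition.\<close>

lemma tangential_part_eq_0_iff:
  assumes "subspace (tangent_space M p)"
  shows "tangential_part M p x = 0 \<longleftrightarrow> (\<forall>w\<in>tangent_space M p. x \<bullet> w = 0)"
proof -
  let ?T = "tangent_space M p"
  obtain y n where yn: "y \<in> ?T" "\<And>w. w \<in> ?T \<Longrightarrow> n \<bullet> w = 0" "x = y + n"
    using orthogonal_decomposition[OF assms] by metis
  have "tangential_part M p x = y"
    unfolding tangential_part_def
  proof (rule the_equality)
    show "y \<in> ?T \<and> (\<forall>w\<in>?T. (x - y) \<bullet> w = 0)" using yn by simp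
    fix u assume u: "u \<in> ?T \<and> (\<forall>w\<in>?T. (x - u) \<bullet> w = 0)"
    then have "y - u \<in> ?T" using yn assms by (intro subspace_diff) auto
    then have "(x - u) \<bullet> (y - u) = 0" "n \<bullet> (y - u) = 0" using u yn by auto
    then have "(y - u) \<bullet> (y - u) = 0" using yn(3) by (simp add: algebra_simps inner_add_left inner_diff_left)
    then show "u = y" by simp
  qed
  moreover have "(\<forall>w\<in>?T. x \<bullet> w = 0) \<longleftrightarrow> y = 0"
    using yn by (auto simp: inner_add_left)
  ultimately show ?thesis by simp
qed

locale slice_chart =
  fixes M U V E :: "'a::euclidean_space set" and \<phi> \<psi> :: "'a \<Rightarrow> 'a"
  assumes U: "open U" and V: "open V" and homeo: "homeomorphism U V \<phi> \<psi>"
    and \<phi>: "smooth_on U \<phi>" and \<psi>: "smooth_on V \<psi>" and E: "subspace E"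
    and slice: "\<phi> ` (U \<inter> M) = V \<inter> E"
begin

abbreviation "d\<phi> x \<equiv> frechet_derivative \<phi> (at x)"
abbreviation "d\<psi> x \<equiv> frechet_derivative \<psi> (at x)"

lemma \<psi>_\<phi>: "x \<in> U \<Longrightarrow> \<psi> (\<phi> x) = x" and \<phi>_\<psi>: "y \<in> V \<Longrightarrow> \<phi> (\<psi> y) = y"
  and \<phi>_in: "x \<in> U \<Longrightarrow> \<phi> x \<in> V" and \<psi>_in: "y \<in> V \<Longrightarrow> \<psi> y \<in> U"
  using homeo by (auto simp: homeomorphism_def)

lemma \<phi>_slice: "x \<in> U \<Longrightarrow> x \<in> M \<Longrightarrow> \<phi> x \<in> E"
  using slice by blast

lemma \<psi>_slice: assumes "y \<in> V" "y \<in> E" shows "\<psi> y \<in> M"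
proof -
  have "y \<in> \<phi> ` (U \<inter> M)" using slice assms by simp
  then show ?thesis using \<psi>_\<phi> by auto
qed

lemma d\<phi>: "x \<in> U \<Longrightarrow> (\<phi> has_derivative d\<phi> x) (at x)" and d\<psi>: "y \<in> V \<Longrightarrow> (\<psi> has_derivative d\<psi> y) (at y)"
  using smooth_on_has_derivative \<phi> \<psi> by blast+

lemma d\<phi>_d\<psi>: assumes "y \<in> V" shows "d\<phi> (\<psi> y) (d\<psi> y v) = v"
proof -
  have "((\<lambda>y. \<phi> (\<psi> y)) has_derivative (\<lambda>v. d\<phi> (\<psi> y) (d\<psi> y v))) (at y)"
    using has_derivative_compose[OF d\<psi> d\<phi>] assms \<psi>_in by blast
  moreover have "((\<lambda>y. \<phi> (\<psi> y)) has_derivative (\<lambda>v. v)) (at y)"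
    by (rule has_derivative_transform_within_open[OF has_derivative_ident V assms]) (simp add: \<phi>_\<psi>)
  ultimately have "(\<lambda>v. d\<phi> (\<psi> y) (d\<psi> y v)) = (\<lambda>v. v)"
    using has_derivative_unique by blast
  then show ?thesis by meson
qed

lemma d\<psi>_d\<phi>: assumes "x \<in> U" shows "d\<psi> (\<phi> x) (d\<phi> x v) = v"
proof -
  have "((\<lambda>y. \<psi> (\<phi> y)) has_derivative (\<lambda>v. d\<psi> (\<phi> x) (d\<phi> x v))) (at x)"
    using has_derivative_compose[OF d\<phi> d\<psi>] assms \<phi>_in by blast
  moreover have "((\<lambda>y. \<psi> (\<phi> y)) has_derivative (\<lambda>v. v)) (at x)"
    by (rule has_derivative_transform_within_open[OF has_derivative_ident U assms]) (simp add: \<psi>_\<phi>)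
  ultimately have "(\<lambda>v. d\<psi> (\<phi> x) (d\<phi> x v)) = (\<lambda>v. v)"
    using has_derivative_unique by blast
  then show ?thesis by meson
qed

lemma chart_curve_derivative:
  assumes "(\<gamma> has_vector_derivative v) (at s)" "\<gamma> s \<in> U"
  shows "((\<lambda>t. \<phi> (\<gamma> t)) has_vector_derivative d\<phi> (\<gamma> s) v) (at s)"
proof -
  have "((\<lambda>t. \<phi> (\<gamma> t)) has_derivative (\<lambda>h. d\<phi> (\<gamma> s) (h *\<^sub>R v))) (at s)"
    using has_derivative_compose[of \<gamma> "\<lambda>h. h *\<^sub>R v" s UNIV \<phi> "d\<phi> (\<gamma> s)"] d\<phi>[OF assms(2)] assms(1)
    by (simp add: has_vector_derivative_def)
  then show ?thesis
    using linear_scale[OF has_derivative_linear[OF d\<phi>[OF assms(2)]]] by (simp add: has_vector_derivative_def)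
qed

lemma curve_in_U:
  assumes "open I" "s \<in> I" "continuous_on I \<gamma>" "\<gamma> s \<in> U"
  shows "\<exists>J. open J \<and> s \<in> J \<and> J \<subseteq> I \<and> (\<forall>t\<in>J. \<gamma> t \<in> U)"
proof -
  have "open (\<gamma> -` U \<inter> I)"
    using continuous_on_open_vimage[OF assms(1)] assms(3) U by blast
  then show ?thesis using assms by (intro exI[of _ "\<gamma> -` U \<inter> I"]) auto
qed

text \<open>A curve in \<open>M\<close>, read in the chart, runs in \<open>E\<close>, hence so does
  its velocity; conversely, straight lines in the slice are mapped to curves in
  \<open>M\<close>.\<close>

lemma tangent_space_eq:
  assumes y: "y \<in> V" "y \<in> E"
  shows "tangent_space M (\<psi> y) = d\<psi> y ` E"
proof (intro equalityI subsetI)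
  fix v assume "v \<in> tangent_space M (\<psi> y)"
  then obtain \<gamma> e where \<gamma>: "e > 0" "smooth_on {-e<..<e} \<gamma>" "\<gamma> ` {-e<..<e} \<subseteq> M" "\<gamma> 0 = \<psi> y"
      "(\<gamma> has_vector_derivative v) (at (0::real))"
    by (auto simp: tangent_space_def)
  have "continuous_on {-e<..<e} \<gamma>" "0 \<in> {-e<..<e}" "\<gamma> 0 \<in> U"
    using \<gamma> smooth_on_continuous_on \<psi>_in y by auto
  from curve_in_U[OF open_greaterThanLessThan this(2,1,3)]
  obtain J where J: "open J" "0 \<in> J" "J \<subseteq> {-e<..<e}" "\<forall>t\<in>J. \<gamma> t \<in> U"
    by (elim exE conjE)
  have "d\<phi> (\<psi> y) v \<in> E"
  proof (rule vector_derivative_in_subspace[OF E _ J(1,2), of "\<lambda>t. \<phi> (\<gamma> t)"])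
    show "((\<lambda>t. \<phi> (\<gamma> t)) has_vector_derivative d\<phi> (\<psi> y) v) (at 0)"
      using chart_curve_derivative[OF \<gamma>(5)] \<gamma>(4) \<psi>_in y by simp
  qed (use J \<gamma>(3) \<phi>_slice in \<open>auto simp: image_subset_iff\<close>)
  moreover have "v = d\<psi> y (d\<phi> (\<psi> y) v)"
    using d\<psi>_d\<phi>[of "\<psi> y"] \<psi>_in \<phi>_\<psi> y by simp
  ultimately show "v \<in> d\<psi> y ` E" by blast
next
  fix w assume "w \<in> d\<psi> y ` E"
  then obtain v where v: "v \<in> E" "w = d\<psi> y v" by auto
  define S where "S = {t::real. y + t *\<^sub>R v \<in> V}"
  have "S = (\<lambda>t. y + t *\<^sub>R v) -` V" by (auto simp: S_def)
  then have "open S" using V by (auto intro!: open_vimage continuous_intros)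
  moreover have "0 \<in> S" using y by (simp add: S_def)
  ultimately obtain e where e: "e > 0" "ball 0 e \<subseteq> S" using openE by blast
  have eS: "{-e<..<e} \<subseteq> S" using e(2) by (auto simp: subset_iff dist_real_def)
  have "smooth_on {-e<..<e} (\<lambda>t. \<psi> (y + t *\<^sub>R v))"
    using smooth_on_subset[OF smooth_on_line[OF V \<psi>] eS[unfolded S_def]] .
  moreover have "(\<lambda>t. \<psi> (y + t *\<^sub>R v)) ` {-e<..<e} \<subseteq> M"
    using eS subspace_add[OF E y(2) subspace_scale[OF E v(1)]] by (auto simp: S_def intro: \<psi>_slice)
  moreover have "((\<lambda>t. \<psi> (y + t *\<^sub>R v)) has_vector_derivative w) (at 0)"
  proof -
    have l: "((\<lambda>t. y + t *\<^sub>R v) has_derivative (\<lambda>h. h *\<^sub>R v)) (at 0)"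
      by (auto intro!: derivative_eq_intros)
    have "((\<lambda>t. \<psi> (y + t *\<^sub>R v)) has_derivative (\<lambda>h. d\<psi> y (h *\<^sub>R v))) (at 0)"
      using has_derivative_compose[OF l, of \<psi> "d\<psi> y"] d\<psi>[OF y(1)] by simp
    then show ?thesis
      using linear_scale[OF has_derivative_linear[OF d\<psi>[OF y(1)]]] v(2) by (simp add: has_vector_derivative_def)
  qed
  ultimately show "w \<in> tangent_space M (\<psi> y)"
    using e(1) unfolding tangent_space_def by (intro CollectI exI[of _ "\<lambda>t. \<psi> (y + t *\<^sub>R v)"] exI[of _ e]) auto
qed

lemma subspace_tangent_space: "x \<in> U \<Longrightarrow> x \<in> M \<Longrightarrow> subspace (tangent_space M x)"
  using tangent_space_eq[of "\<phi> x"] \<phi>_in \<phi>_slice \<psi>_\<phi> has_derivative_linear[OF d\<psi>] E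
  by (auto intro: linear_subspace_image)

end

lemma slice_chart_exists:
  assumes "smooth_submanifold d M" "p \<in> M"
  obtains U V E \<phi> \<psi> where "slice_chart M U V E \<phi> \<psi>" "p \<in> U"
proof -
  from bspec[OF assms(1)[unfolded smooth_submanifold_def] assms(2)] show ?thesis
    by (elim exE conjE, intro that slice_chart.intro) assumption+
qed

lemma subspace_tangent_space:
  "smooth_submanifold d M \<Longrightarrow> p \<in> M \<Longrightarrow> subspace (tangent_space M p)"
  using slice_chart_exists slice_chart.subspace_tangent_space by metis

section \<open>Basic properties of geodesics\<close>

lemma velocity_in_tangent_space:
  fixes \<alpha> :: "real \<Rightarrow> 'a::euclidean_space"
  assumes "smooth_curve M I \<alpha>" "s \<in> I"
  shows "velocity \<alpha> s \<in> tangent_space M (\<alpha> s)"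
proof -
  have I: "open I" "smooth_on I \<alpha>" "\<alpha> ` I \<subseteq> M" using assms by (auto simp: smooth_curve_def)
  obtain e where e: "e > 0" "ball s e \<subseteq> I" using I(1) assms(2) openE by blast
  have sub: "{-e<..<e} \<subseteq> {t. s + t *\<^sub>R 1 \<in> I}"
    using e(2) by (auto simp: subset_iff dist_real_def)
  have "smooth_on {-e<..<e} (\<lambda>t. \<alpha> (s + t *\<^sub>R 1))"
    using smooth_on_subset[OF smooth_on_line[OF I(1,2)] sub] .
  moreover have "((\<lambda>t. \<alpha> (s + t *\<^sub>R 1)) has_vector_derivative velocity \<alpha> s) (at 0)"
  proof -
    have "((\<lambda>t::real. s + t *\<^sub>R 1) has_vector_derivative 1) (at 0)"
      by (auto intro!: derivative_eq_intros)
    from vector_diff_chain_at[OF this, of \<alpha> "velocity \<alpha> s"] smooth_on_velocity(1)[OF I(2,1) assms(2)]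
    show ?thesis by (simp add: o_def)
  qed
  moreover have "(\<lambda>t. \<alpha> (s + t *\<^sub>R 1)) ` {-e<..<e} \<subseteq> M" using sub I(3) by auto
  ultimately show ?thesis
    using e(1) unfolding tangent_space_def by (intro CollectI exI[of _ "\<lambda>t. \<alpha> (s + t *\<^sub>R 1)"] exI[of _ e]) auto
qed

lemma geodesic_iff:
  assumes "smooth_submanifold d M"
  shows "geodesic M I \<alpha> \<longleftrightarrow> smooth_curve M I \<alpha> \<and>
    (\<forall>s\<in>I. \<forall>w\<in>tangent_space M (\<alpha> s). acceleration_vector \<alpha> s \<bullet> w = 0)"
proof -
  have "covariant_derivative M \<alpha> (velocity \<alpha>) s = 0 \<longleftrightarrow> (\<forall>w\<in>tangent_space M (\<alpha> s). acceleration_vector \<alpha> s \<bullet> w = 0)"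
    if "smooth_curve M I \<alpha>" "s \<in> I" for s
    using that subspace_tangent_space[OF assms]
    by (auto simp: smooth_curve_def covariant_derivative_def acceleration_vector_def image_subset_iff
        tangential_part_eq_0_iff)
  then show ?thesis unfolding geodesic_def by blast
qed

lemma geodesicD:
  assumes "smooth_submanifold d M" "geodesic M I \<alpha>" "s \<in> I"
  shows "open I" "is_interval I" "smooth_on I \<alpha>" "\<alpha> s \<in> M"
    "(\<alpha> has_vector_derivative velocity \<alpha> s) (at s)"
    "(velocity \<alpha> has_vector_derivative acceleration_vector \<alpha> s) (at s)"
    "velocity \<alpha> s \<in> tangent_space M (\<alpha> s)"
    "w \<in> tangent_space M (\<alpha> s) \<Longrightarrow> acceleration_vector \<alpha> s \<bullet> w = 0"
proof -
  have g: "smooth_curve M I \<alpha>"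
    "\<forall>s\<in>I. \<forall>w\<in>tangent_space M (\<alpha> s). acceleration_vector \<alpha> s \<bullet> w = 0"
    using assms geodesic_iff by blast+
  then show "open I" "is_interval I" "smooth_on I \<alpha>" "\<alpha> s \<in> M"
    "w \<in> tangent_space M (\<alpha> s) \<Longrightarrow> acceleration_vector \<alpha> s \<bullet> w = 0"
    using assms(3) by (auto simp: smooth_curve_def)
  then show "(\<alpha> has_vector_derivative velocity \<alpha> s) (at s)"
    "(velocity \<alpha> has_vector_derivative acceleration_vector \<alpha> s) (at s)"
    using smooth_on_velocity(1) velocity_has_vector_derivative assms(3) by blast+
  show "velocity \<alpha> s \<in> tangent_space M (\<alpha> s)"
    using velocity_in_tangent_space g(1) assms(3) by blast
qed

text \<open>The velocity is tangent and the acceleration normal, so the derivative of the squared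
  speed vanishes.\<close>

lemma geodesic_constant_speed:
  assumes "smooth_submanifold d M" "geodesic M UNIV \<gamma>"
  shows "norm (velocity \<gamma> s) = norm (velocity \<gamma> 0)"
proof -
  note g = geodesicD[OF assms UNIV_I]
  have "((\<lambda>s. velocity \<gamma> s \<bullet> velocity \<gamma> s) has_derivative (\<lambda>h. 0)) (at s within UNIV)" for s
  proof -
    have "((\<lambda>s. velocity \<gamma> s \<bullet> velocity \<gamma> s) has_derivative
      (\<lambda>h. velocity \<gamma> s \<bullet> (h *\<^sub>R acceleration_vector \<gamma> s) + (h *\<^sub>R acceleration_vector \<gamma> s) \<bullet> velocity \<gamma> s)) (at s)"
      using has_derivative_inner[OF g(6)[unfolded has_vector_derivative_def] g(6)[unfolded has_vector_derivative_def]] .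
    then show ?thesis using g(8)[OF g(7)] by (simp add: inner_commute)
  qed
  then have "\<exists>c. \<forall>s\<in>UNIV. velocity \<gamma> s \<bullet> velocity \<gamma> s = c"
    by (intro has_derivative_zero_constant) auto
  then have "velocity \<gamma> s \<bullet> velocity \<gamma> s = velocity \<gamma> 0 \<bullet> velocity \<gamma> 0"
    by auto
  then show ?thesis by (simp add: norm_eq_sqrt_inner)
qed

lemma geodesic_distance_le:
  assumes "smooth_submanifold d M" "geodesic M UNIV \<gamma>" "s \<in> {0..1}"
  shows "norm (\<gamma> s - \<gamma> 0) \<le> norm (velocity \<gamma> 0)"
proof (rule vector_derivative_bound_unit_interval[OF _ _ assms(3)])
  show "(\<gamma> has_vector_derivative velocity \<gamma> s) (at s within {0..1})" for s
    using geodesicD(5)[OF assms(1,2) UNIV_I] by (rule has_vector_derivative_at_within)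
  show "norm (velocity \<gamma> s) \<le> norm (velocity \<gamma> 0)" for s
    using geodesic_constant_speed[OF assms(1,2), of s] by simp
qed

text \<open>The factor \<open>a\<close> may be negative or zero: this yields both sides of the
  curves required by \<open>lines\<close>. It also provides unit speed in
  \<open>affine_along_geodesic\<close>.\<close>

lemma geodesic_rescale:
  assumes "smooth_submanifold d M" "geodesic M UNIV \<gamma>"
  shows "geodesic M UNIV (\<lambda>t. \<gamma> (t * a))" "velocity (\<lambda>t. \<gamma> (t * a)) s = a *\<^sub>R velocity \<gamma> (s * a)"
proof -
  note g = geodesicD[OF assms UNIV_I]
  have l: "((\<lambda>t::real. t * a) has_vector_derivative a) (at s)" for s
    by (auto intro!: derivative_eq_intros)
  have 1: "((\<lambda>t. \<gamma> (t * a)) has_vector_derivative a *\<^sub>R velocity \<gamma> (s * a)) (at s)" for s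
    using vector_diff_chain_at[OF l g(5)] by (simp add: o_def)
  then have v: "velocity (\<lambda>t. \<gamma> (t * a)) = (\<lambda>s. a *\<^sub>R velocity \<gamma> (s * a))"
    unfolding velocity_def by (intro ext vector_derivative_at) auto
  then show "velocity (\<lambda>t. \<gamma> (t * a)) s = a *\<^sub>R velocity \<gamma> (s * a)" by simp
  have "((\<lambda>t. velocity \<gamma> (t * a)) has_vector_derivative a *\<^sub>R acceleration_vector \<gamma> (s * a)) (at s)" for s
    using vector_diff_chain_at[OF l g(6)] by (simp add: o_def)
  then have "((\<lambda>s. a *\<^sub>R velocity \<gamma> (s * a)) has_vector_derivative a *\<^sub>R a *\<^sub>R acceleration_vector \<gamma> (s * a)) (at s)" for s
    using bounded_linear.has_vector_derivative[OF bounded_linear_scaleR_right] by blast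
  then have acc: "acceleration_vector (\<lambda>t. \<gamma> (t * a)) s = a *\<^sub>R a *\<^sub>R acceleration_vector \<gamma> (s * a)" for s
    unfolding acceleration_vector_def v by (rule vector_derivative_at)
  have "smooth_on UNIV (\<lambda>t. \<gamma> (t * a))"
    using smooth_on_line[OF open_UNIV g(3), of 0 a] by simp
  then have "smooth_curve M UNIV (\<lambda>t. \<gamma> (t * a))"
    using g(4) by (auto simp: smooth_curve_def)
  then show "geodesic M UNIV (\<lambda>t. \<gamma> (t * a))"
    using g(8) geodesic_iff[OF assms(1)] by (simp add: acc)
qed

text \<open>Affinity is postulated for unit speed only. The speed is constant, so a geodesic can be
  rescaled to unit speed unless it is a constant curve.\<close>

lemma affine_along_geodesic:
  assumes M: "smooth_submanifold d M" and f: "affine_function M f" and \<gamma>: "geodesic M UNIV \<gamma>"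
  shows "\<exists>a b. \<forall>s. f (\<gamma> s) = a * s + b"
proof (cases "velocity \<gamma> 0 = 0")
  case True
  have "(\<gamma> has_derivative (\<lambda>h. 0)) (at s within UNIV)" for s
    using geodesicD(5)[OF M \<gamma> UNIV_I, of s] geodesic_constant_speed[OF M \<gamma>, of s] True
    by (simp add: has_vector_derivative_def)
  then have "\<exists>c. \<forall>s\<in>UNIV. \<gamma> s = c"
    by (intro has_derivative_zero_constant) auto
  then obtain c where "\<And>s. \<gamma> s = c"
    by auto
  then show ?thesis by (intro exI[of _ 0] exI[of _ "f c"]) simp
next
  case False
  define r where "r = norm (velocity \<gamma> 0)"
  have r: "r > 0" using False by (simp add: r_def)
  let ?g = "\<lambda>t. \<gamma> (t * (1 / r))"
  have "unit_speed UNIV ?g"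
    unfolding unit_speed_def
  proof
    fix s
    have "norm (velocity \<gamma> (s * (1 / r))) = r"
      using geodesic_constant_speed[OF M \<gamma>] by (simp only: r_def)
    then show "norm (velocity ?g s) = 1"
      unfolding geodesic_rescale(2)[OF M \<gamma>] norm_scaleR using r by simp
  qed
  then obtain a b where ab: "\<And>s. f (?g s) = a * s + b"
    using f geodesic_rescale(1)[OF M \<gamma>] unfolding affine_function_def by blast
  have "f (\<gamma> s) = (a * r) * s + b" for s
    using ab[of "s * r"] r by (simp add: algebra_simps)
  then show ?thesis by blast
qed

text \<open>Nested balls on both sides of the chart: \<open>\<phi>\<close> maps radius
  \<open>R2\<close> at \<open>p\<close> into radius \<open>R\<close> at \<open>\<phi> p\<close>, and
  \<open>\<psi>\<close> maps the latter into radius \<open>R1\<close> at \<open>p\<close>. Bounds on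
  \<open>\<phi>\<close> hold over \<open>R1\<close> and those on \<open>\<psi>\<close> over
  \<open>R\<close>, so a curve within \<open>R2\<close> enjoys both.\<close>

locale chart_neighbourhood = slice_chart M U V E \<phi> \<psi>
  for M U V E :: "'a::euclidean_space set" and \<phi> \<psi> +
  fixes p :: 'a and d :: nat and R1 R2 R K :: real
  assumes M: "smooth_submanifold d M" and p: "p \<in> M" and K: "K \<ge> 1"
    and R: "R > 0" "R2 > 0" "R2 \<le> R1"
    and R1_U: "cball p R1 \<subseteq> U" and R_V: "cball (\<phi> p) R \<subseteq> V"
    and \<psi>_R: "x \<in> cball (\<phi> p) R \<Longrightarrow> \<psi> x \<in> cball p R1"
    and \<phi>_R2: "x \<in> cball p R2 \<Longrightarrow> \<phi> x \<in> cball (\<phi> p) R"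
    and \<phi>_Lipschitz: "x \<in> cball p R1 \<Longrightarrow> y \<in> cball p R1 \<Longrightarrow> norm (\<phi> x - \<phi> y) \<le> K * norm (x - y)"
    and d\<phi>_bound: "x \<in> cball p R1 \<Longrightarrow> norm (d\<phi> x v) \<le> K * norm v"
    and \<psi>_Lipschitz: "x \<in> cball (\<phi> p) R \<Longrightarrow> y \<in> cball (\<phi> p) R \<Longrightarrow> norm (\<psi> x - \<psi> y) \<le> K * norm (x - y)"
    and d\<psi>_bound: "x \<in> cball (\<phi> p) R \<Longrightarrow> norm (d\<psi> x v) \<le> K * norm v"
    and d\<psi>_Lipschitz: "x \<in> cball (\<phi> p) R \<Longrightarrow> y \<in> cball (\<phi> p) R \<Longrightarrow>
      norm (d\<psi> x v - d\<psi> y v) \<le> K * norm (x - y) * norm v"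
    and d2\<psi>_bound: "x \<in> cball (\<phi> p) R \<Longrightarrow> norm (second_derivative \<psi> x v w) \<le> K * norm v * norm w"
    and d2\<psi>_Lipschitz: "x \<in> cball (\<phi> p) R \<Longrightarrow> y \<in> cball (\<phi> p) R \<Longrightarrow>
      norm (second_derivative \<psi> x v w - second_derivative \<psi> y v w) \<le> K * norm (x - y) * norm v * norm w"

lemma (in slice_chart) chart_neighbourhood_exists:
  assumes M: "smooth_submanifold d M" and p: "p \<in> M" "p \<in> U"
  shows "\<exists>R1 R2 R K. chart_neighbourhood M U V E \<phi> \<psi> p d R1 R2 R K"
proof -
  obtain R1 where R1: "R1 > 0" "cball p R1 \<subseteq> U"
    using U p(2) open_contains_cball by blast
  obtain K1 where K1: "K1 \<ge> 1" "\<forall>x\<in>cball p R1. \<forall>y\<in>cball p R1.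
      norm (\<phi> x - \<phi> y) \<le> K1 * norm (x - y) \<and> (\<forall>v. norm (d\<phi> x v) \<le> K1 * norm v)"
    using smooth_on_second_order_bounds[OF \<phi> R1(2)] by blast
  have "open (\<psi> -` ball p R1 \<inter> V)"
    using continuous_on_open_vimage[OF V] smooth_on_continuous_on[OF \<psi>] open_ball by blast
  moreover have "\<phi> p \<in> \<psi> -` ball p R1 \<inter> V"
    using p \<phi>_in \<psi>_\<phi> R1 by simp
  ultimately obtain R where R: "R > 0" "cball (\<phi> p) R \<subseteq> \<psi> -` ball p R1 \<inter> V"
    using open_contains_cball by blast
  then have RV: "cball (\<phi> p) R \<subseteq> V" by blast
  have \<psi>R: "\<psi> x \<in> cball p R1" if "x \<in> cball (\<phi> p) R" for x
    using R(2) that by (auto simp: subset_iff)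
  obtain K2 where K2: "K2 \<ge> 1" "\<forall>x\<in>cball (\<phi> p) R. \<forall>y\<in>cball (\<phi> p) R.
    norm (\<psi> x - \<psi> y) \<le> K2 * norm (x - y) \<and> (\<forall>v. norm (d\<psi> x v) \<le> K2 * norm v) \<and>
    (\<forall>v. norm (d\<psi> x v - d\<psi> y v) \<le> K2 * norm (x - y) * norm v) \<and>
    (\<forall>v w. norm (second_derivative \<psi> x v w) \<le> K2 * norm v * norm w) \<and>
    (\<forall>v w. norm (second_derivative \<psi> x v w - second_derivative \<psi> y v w) \<le> K2 * norm (x - y) * norm v * norm w)"
    using smooth_on_second_order_bounds[OF \<psi> RV] by blast
  have "open (\<phi> -` ball (\<phi> p) R \<inter> U)"
    using continuous_on_open_vimage[OF U] smooth_on_continuous_on[OF \<phi>] open_ball by blast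
  moreover have "p \<in> \<phi> -` ball (\<phi> p) R \<inter> U"
    using p R by simp
  ultimately obtain R2 where R2: "R2 > 0" "cball p R2 \<subseteq> \<phi> -` ball (\<phi> p) R \<inter> U"
    using open_contains_cball by blast
  have \<phi>R: "\<phi> x \<in> cball (\<phi> p) R" if "x \<in> cball p (min R1 R2)" for x
    using R2(2) that by (auto simp: subset_iff)
  define K where "K = max K1 K2"
  have K: "K \<ge> 1" "K1 \<le> K" "K2 \<le> K" using K1 by (auto simp: K_def)
  note mono = order_trans[OF _ mult_right_mono]
  have mono3: "b \<le> K2 * x * y \<Longrightarrow> 0 \<le> x \<Longrightarrow> 0 \<le> y \<Longrightarrow> b \<le> K * x * y"
    and mono4: "b \<le> K2 * x * y * w \<Longrightarrow> 0 \<le> x \<Longrightarrow> 0 \<le> y \<Longrightarrow> 0 \<le> w \<Longrightarrow> b \<le> K * x * y * w" for b x y w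
    using K(3) by (meson mult_right_mono order_trans)+
  have "chart_neighbourhood M U V E \<phi> \<psi> p d R1 (min R1 R2) R K"
  proof (unfold_locales)
    fix x y v w
    show "norm (\<phi> x - \<phi> y) \<le> K * norm (x - y)" if "x \<in> cball p R1" "y \<in> cball p R1"
      using K1(2) that K(2) mono norm_ge_zero by blast
    show "norm (d\<phi> x v) \<le> K * norm v" if "x \<in> cball p R1"
      using K1(2) that K(2) mono norm_ge_zero by blast
    show "norm (\<psi> x - \<psi> y) \<le> K * norm (x - y)" if "x \<in> cball (\<phi> p) R" "y \<in> cball (\<phi> p) R"
      using K2(2) that K(3) mono norm_ge_zero by blast
    show "norm (d\<psi> x v) \<le> K * norm v" if "x \<in> cball (\<phi> p) R"
      using K2(2) that K(3) mono norm_ge_zero by blast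
    show "norm (d\<psi> x v - d\<psi> y v) \<le> K * norm (x - y) * norm v"
      if "x \<in> cball (\<phi> p) R" "y \<in> cball (\<phi> p) R"
      by (rule mono3) (use K2(2) that in auto)
    show "norm (second_derivative \<psi> x v w) \<le> K * norm v * norm w" if "x \<in> cball (\<phi> p) R"
      by (rule mono3) (use K2(2) that in auto)
    show "norm (second_derivative \<psi> x v w - second_derivative \<psi> y v w) \<le> K * norm (x - y) * norm v * norm w"
      if "x \<in> cball (\<phi> p) R" "y \<in> cball (\<phi> p) R"
      by (rule mono4) (use K2(2) that in auto)
  qed (use M p K(1) R(1) R1 R2(1) RV \<psi>R \<phi>R in auto)
  then show ?thesis by blast
qed

context chart_neighbourhood
begin

abbreviation "z \<equiv> \<phi> p"

lemma z_slice: "z \<in> E" "z \<in> V" and \<psi>_z: "\<psi> z = p"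
proof -
  have "p \<in> U" using R1_U R by auto
  then show "z \<in> E" "z \<in> V" "\<psi> z = p" using p \<phi>_slice \<phi>_in \<psi>_\<phi> by auto
qed

lemma R2_R1: "x \<in> cball p R2 \<Longrightarrow> x \<in> cball p R1" and R2_U: "x \<in> cball p R2 \<Longrightarrow> x \<in> U"
  using R R1_U by auto

text \<open>The lower bound on \<open>d\<psi>\<close> comes from the upper bound on
  \<open>d\<phi>\<close>, which is its inverse.\<close>

sublocale geodesic_equation E z R K d\<psi> "second_derivative \<psi>"
proof (rule geodesic_equation.intro)
  fix x y v w
  assume x: "x \<in> cball z R"
  then have xV: "x \<in> V" using R_V by blast
  show "linear (d\<psi> x)" using has_derivative_linear[OF d\<psi>[OF xV]] .
  show "linear (\<lambda>v. second_derivative \<psi> x v w)" by (rule linear_second_derivative1)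
  show "linear (second_derivative \<psi> x v)" by (rule linear_second_derivative2[OF \<psi> xV])
  have "norm (d\<phi> (\<psi> x) (d\<psi> x v)) \<le> K * norm (d\<psi> x v)"
    using d\<phi>_bound[OF \<psi>_R[OF x]] .
  then show "norm v \<le> K * norm (d\<psi> x v)" by (simp add: d\<phi>_d\<psi>[OF xV])
qed (fact E K d\<psi>_bound d\<psi>_Lipschitz d2\<psi>_bound d2\<psi>_Lipschitz)+

text \<open>The geodesic is global, so that affinity of \<open>f\<close> applies to it, while only
  its part over the unit interval has to stay in the chart.\<close>

definition chart_geodesic :: "(real \<Rightarrow> 'a) \<Rightarrow> (real \<Rightarrow> 'a) \<Rightarrow> bool" where
  "chart_geodesic c u \<longleftrightarrow> (\<exists>\<gamma>. geodesic M UNIV \<gamma> \<and> (\<forall>s\<in>{0..1}. \<gamma> s \<in> cball p R2) \<and>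
     c = (\<lambda>s. \<phi> (\<gamma> s)) \<and> u = (\<lambda>s. d\<phi> (\<gamma> s) (velocity \<gamma> s)))"

text \<open>The second-order chain rule is used twice: with \<open>\<phi>\<close> it yields the
  coordinate acceleration \<open>a\<close>; with \<open>\<psi>\<close> it recovers the ambient
  acceleration from \<open>a\<close>, which is normal because \<open>\<gamma>\<close> is a
  geodesic.\<close>

lemma coordinate_geodesic_chart_geodesic:
  assumes "chart_geodesic c u"
  shows "coordinate_geodesic c u"
  unfolding coordinate_geodesic_def
proof
  fix s :: real assume s: "s \<in> {0..1}"
  obtain \<gamma> where \<gamma>: "geodesic M UNIV \<gamma>" "\<forall>s\<in>{0..1}. \<gamma> s \<in> cball p R2"
      and cu: "c = (\<lambda>s. \<phi> (\<gamma> s))" "u = (\<lambda>s. d\<phi> (\<gamma> s) (velocity \<gamma> s))"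
    using assms by (auto simp: chart_geodesic_def)
  note g = geodesicD[OF M \<gamma>(1) UNIV_I]
  have sU: "\<gamma> s \<in> U" using \<gamma>(2) s R2_U by blast
  \<comment> \<open>Lying in \<open>E\<close> passes to derivatives only if it holds near
    \<open>s\<close>. Since \<open>\<gamma>\<close> is global, a two-sided neighbourhood exists even
    at the end points of the unit interval.\<close>
  obtain J where J: "open J" "s \<in> J" "J \<subseteq> UNIV" "\<forall>t\<in>J. \<gamma> t \<in> U"
    using curve_in_U[OF open_UNIV UNIV_I smooth_on_continuous_on[OF g(3)] sU] by (elim exE conjE)
  have cE: "c t \<in> E" if "t \<in> J" for t using bspec[OF J(4) that] g(4) \<phi>_slice by (auto simp: cu)
  have c': "(c has_vector_derivative u t) (at t)" if "t \<in> J" for t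
    using chart_curve_derivative[OF g(5) bspec[OF J(4) that]] by (simp add: cu)
  have uE: "u t \<in> E" if "t \<in> J" for t
    using vector_derivative_in_subspace[OF E c'[OF that] J(1) that cE] .
  define a where "a = d\<phi> (\<gamma> s) (acceleration_vector \<gamma> s) + second_derivative \<phi> (\<gamma> s) (velocity \<gamma> s) (velocity \<gamma> s)"
  have u': "(u has_vector_derivative a) (at s)"
    unfolding cu a_def by (rule has_vector_derivative_frechet_derivative_compose[OF \<phi> U sU g(5,6)])
  have aE: "a \<in> E"
    using vector_derivative_in_subspace[OF E u' J(1,2) uE] .
  have csV: "c s \<in> V" using \<phi>_in[OF sU] by (simp add: cu)
  have "((\<lambda>t. d\<psi> (c t) (u t)) has_vector_derivative d\<psi> (c s) a + second_derivative \<psi> (c s) (u s) (u s)) (at s)"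
    by (rule has_vector_derivative_frechet_derivative_compose[OF \<psi> V csV c'[OF J(2)] u'])
  then have "(velocity \<gamma> has_vector_derivative d\<psi> (c s) a + second_derivative \<psi> (c s) (u s) (u s)) (at s)"
    by (rule has_vector_derivative_transform_within_open[OF _ J(1,2)]) (use J(4) d\<psi>_d\<phi> in \<open>simp add: cu\<close>)
  then have acc: "acceleration_vector \<gamma> s = d\<psi> (c s) a + second_derivative \<psi> (c s) (u s) (u s)"
    using g(6) vector_derivative_unique_at by blast
  have "acceleration (c s) (u s) a"
    unfolding acceleration_def
  proof (intro conjI ballI aE)
    fix e assume "e \<in> E"
    then have "d\<psi> (c s) e \<in> tangent_space M (\<gamma> s)"
      using tangent_space_eq[OF csV cE[OF J(2)]] \<psi>_\<phi>[OF sU] by (auto simp: cu)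
    from g(8)[OF this] show "d\<psi> (c s) e \<bullet> (d\<psi> (c s) a + second_derivative \<psi> (c s) (u s) (u s)) = 0"
      by (simp add: acc inner_commute)
  qed
  then show "c s \<in> cball z R \<and> c s \<in> E \<and> u s \<in> E \<and> (c has_vector_derivative u s) (at s within {0..1}) \<and>
      (\<exists>a. (u has_vector_derivative a) (at s within {0..1}) \<and> acceleration (c s) (u s) a)"
    using \<phi>_R2 \<gamma>(2) s cE uE J(2) c' u' by (auto simp: cu intro: has_vector_derivative_at_within)
qed

text \<open>If \<open>x\<close> is within \<open>r\<close> of \<open>z\<close> and the coordinate
  velocity is at most \<open>r\<close>, the geodesic starts within \<open>K * r\<close> of
  \<open>p\<close> and moves at most \<open>K * r\<close> in unit time; together it stays within
  \<open>R2\<close>.\<close>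

definition r where "r = min R (R2 / (2 * K))"

lemma r: "r > 0" "r \<le> R" "2 * (K * r) \<le> R2"
proof -
  have "r \<le> R2 / (2 * K)" by (simp add: r_def)
  then show "2 * (K * r) \<le> R2" using K by (simp add: field_simps)
qed (use R K in \<open>auto simp: r_def\<close>)

lemma short_geodesic:
  assumes x: "x \<in> E" "x \<in> cball z r" and v: "v \<in> E" "norm v \<le> r"
    and \<gamma>: "geodesic M UNIV \<gamma>" "\<gamma> 0 = \<psi> x" "velocity \<gamma> 0 = d\<psi> x v"
  shows "chart_geodesic (\<lambda>s. \<phi> (\<gamma> s)) (\<lambda>s. d\<phi> (\<gamma> s) (velocity \<gamma> s))"
    "\<phi> (\<gamma> 0) = x" "d\<phi> (\<gamma> 0) (velocity \<gamma> 0) = v"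
    "s \<in> {0..1} \<Longrightarrow> norm (d\<phi> (\<gamma> s) (velocity \<gamma> s)) \<le> K^2 * norm v"
    "s \<in> {0..1} \<Longrightarrow> \<gamma> s \<in> cball p R2"
proof -
  have xR: "x \<in> cball z R" using x r by auto
  then have xV: "x \<in> V" using R_V by blast
  have vel: "norm (velocity \<gamma> 0) \<le> K * norm v"
    using d\<psi>_bound[OF xR] \<gamma>(3) by simp
  have in2: "\<gamma> s \<in> cball p R2" if "s \<in> {0..1}" for s
  proof -
    have "K * norm v \<le> K * r" using v K by (intro mult_left_mono) auto
    moreover have "norm (\<psi> x - \<psi> z) \<le> K * norm (x - z)"
      using \<psi>_Lipschitz[OF xR, of z] R by simp
    moreover have "K * norm (x - z) \<le> K * r"
      using x(2) K by (intro mult_left_mono) (auto simp: dist_norm norm_minus_commute)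
    ultimately have "norm (\<gamma> s - \<gamma> 0) \<le> K * r" "norm (\<gamma> 0 - p) \<le> K * r"
      using geodesic_distance_le[OF M \<gamma>(1) that] vel \<gamma>(2) \<psi>_z by auto
    then have "norm (\<gamma> s - p) \<le> R2"
      using norm_triangle_ineq[of "\<gamma> s - \<gamma> 0" "\<gamma> 0 - p"] r(3) by simp
    then show ?thesis by (simp add: dist_norm norm_minus_commute)
  qed
  then show "s \<in> {0..1} \<Longrightarrow> \<gamma> s \<in> cball p R2" .
  show "chart_geodesic (\<lambda>s. \<phi> (\<gamma> s)) (\<lambda>s. d\<phi> (\<gamma> s) (velocity \<gamma> s))"
    using \<gamma>(1) in2 unfolding chart_geodesic_def by blast
  show "\<phi> (\<gamma> 0) = x" "d\<phi> (\<gamma> 0) (velocity \<gamma> 0) = v"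
    using \<gamma> \<phi>_\<psi>[OF xV] d\<phi>_d\<psi>[OF xV] by auto
  show "norm (d\<phi> (\<gamma> s) (velocity \<gamma> s)) \<le> K^2 * norm v" if "s \<in> {0..1}"
  proof -
    have "norm (d\<phi> (\<gamma> s) (velocity \<gamma> s)) \<le> K * norm (velocity \<gamma> s)"
      using d\<phi>_bound[OF R2_R1[OF in2[OF that]]] .
    also have "\<dots> \<le> K * (K * norm v)"
      using vel K unfolding geodesic_constant_speed[OF M \<gamma>(1), of s] by (intro mult_left_mono) auto
    finally show ?thesis by (simp add: power2_eq_square mult.assoc)
  qed
qed

lemma complete_geodesic:
  assumes "geodesically_complete M" "x \<in> E" "x \<in> cball z R" "v \<in> E"
  obtains \<gamma> where "geodesic M UNIV \<gamma>" "\<gamma> 0 = \<psi> x" "velocity \<gamma> 0 = d\<psi> x v"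
proof -
  have xV: "x \<in> V" using assms R_V by blast
  have "\<psi> x \<in> M" "d\<psi> x v \<in> tangent_space M (\<psi> x)"
    using \<psi>_slice[OF xV] tangent_space_eq[OF xV] assms by auto
  then show ?thesis using assms(1) that unfolding geodesically_complete_def by blast
qed

text \<open>The speed factor is \<open>K^2\<close>: one \<open>K\<close> for \<open>d\<psi>\<close>
  at the start and one for \<open>d\<phi>\<close> at time \<open>s\<close>, the ambient speed being
  constant in between.\<close>

lemma geodesic_family:
  assumes complete: "geodesically_complete M" and f: "affine_function M f"
  shows "geodesic_family E z R K d\<psi> (second_derivative \<psi>) chart_geodesic (\<lambda>x. f (\<psi> x)) r (K^2)"
proof (rule geodesic_family.intro[OF geodesic_equation_axioms geodesic_family_axioms.intro])
  show "z \<in> E" by (rule z_slice)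
  show "r > 0" by (rule r)
  show "1 \<le> K^2" using K by (rule one_le_power)
  show "coordinate_geodesic c u" if "chart_geodesic c u" for c u
    using coordinate_geodesic_chart_geodesic[OF that] .
  show "\<exists>a b. \<forall>s\<in>{0..1}. f (\<psi> (c s)) = a * s + b" if cg: "chart_geodesic c u" for c u
  proof -
    obtain \<gamma> where \<gamma>: "geodesic M UNIV \<gamma>" "\<forall>s\<in>{0..1}. \<gamma> s \<in> cball p R2" "c = (\<lambda>s. \<phi> (\<gamma> s))"
      using cg by (auto simp: chart_geodesic_def)
    obtain a b where "\<forall>s. f (\<gamma> s) = a * s + b" using affine_along_geodesic[OF M f \<gamma>(1)] by blast
    then have "\<forall>s\<in>{0..1}. f (\<psi> (c s)) = a * s + b"
      using \<gamma> R2_U \<psi>_\<phi> by simp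
    then show ?thesis by blast
  qed
  show "\<exists>c u. chart_geodesic c u \<and> c 0 = x \<and> u 0 = v \<and> (\<forall>s\<in>{0..1}. norm (u s) \<le> K^2 * norm v)"
    if xv: "x \<in> E" "x \<in> cball z r" "v \<in> E" "norm v \<le> r" for x v
  proof -
    have "x \<in> cball z R" using xv r by auto
    then obtain \<gamma> where "geodesic M UNIV \<gamma>" "\<gamma> 0 = \<psi> x" "velocity \<gamma> 0 = d\<psi> x v"
      by (rule complete_geodesic[OF complete xv(1) _ xv(3)])
    from short_geodesic[OF xv this] show ?thesis by blast
  qed
  show "\<exists>X k \<delta> C. \<delta> > 0 \<and> C \<ge> 0 \<and> continuous_on {-\<delta>..\<delta>} X \<and>
      (\<forall>t\<in>{-\<delta>..\<delta>}. X t \<in> E \<and> norm (X t - z - t *\<^sub>R e) \<le> C * t^2 \<and> f (\<psi> (X t)) = f (\<psi> z) + t * k)"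
    if e: "e \<in> E" for e
  proof -
    obtain \<gamma> where \<gamma>: "geodesic M UNIV \<gamma>" "\<gamma> 0 = \<psi> z" "velocity \<gamma> 0 = d\<psi> z e"
      by (rule complete_geodesic[OF complete z_slice(1) _ e]) (use R in auto)
    obtain a b where ab: "\<And>s. f (\<gamma> s) = a * s + b" using affine_along_geodesic[OF M f \<gamma>(1)] by blast
    \<comment> \<open>The summand 1 covers \<open>e = 0\<close>.\<close>
    define \<delta> where "\<delta> = r / (norm e + 1)"
    have \<delta>: "\<delta> > 0" "\<delta> * norm e \<le> r"
      using r by (auto simp: \<delta>_def field_simps add_pos_nonneg)
    \<comment> \<open>The rescaled geodesic with coordinate velocity \<open>t *\<^sub>R e\<close>
      reaches \<open>\<gamma> t\<close> at time 1; its quadratic error in the speed becomes a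
      multiple of \<open>t^2\<close>.\<close>
    have main: "\<gamma> t \<in> cball p R2 \<and> norm (\<phi> (\<gamma> t) - z - t *\<^sub>R e) \<le> (K^2 * (K^2 * norm e)^2) * t^2"
      if t: "t \<in> {-\<delta>..\<delta>}" for t
    proof -
      have "\<bar>t\<bar> * norm e \<le> \<delta> * norm e" using t by (intro mult_right_mono) auto
      then have te: "t *\<^sub>R e \<in> E" "norm (t *\<^sub>R e) \<le> r"
        using E e \<delta>(2) by (auto intro: subspace_scale)
      have zr: "z \<in> cball z r" using r by simp
      note g = geodesic_rescale[OF M \<gamma>(1), of t]
      have "velocity (\<lambda>s. \<gamma> (s * t)) 0 = d\<psi> z (t *\<^sub>R e)"
        using g(2) \<gamma>(3) linear_scale[OF has_derivative_linear[OF d\<psi>[OF z_slice(2)]]] by simp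
      note sg = short_geodesic[OF z_slice(1) zr te g(1) _ this]
      have "norm (\<phi> (\<gamma> (1 * t)) - \<phi> (\<gamma> (0 * t)) - 1 *\<^sub>R (d\<phi> (\<gamma> (0 * t)) (velocity (\<lambda>s. \<gamma> (s * t)) 0)))
          \<le> K^2 * (K^2 * norm (t *\<^sub>R e))^2"
        by (rule coordinate_geodesic_expansion[OF coordinate_geodesic_chart_geodesic[OF sg(1)] sg(4)])
          (use \<gamma>(2) in auto)
      then have "norm (\<phi> (\<gamma> t) - z - t *\<^sub>R e) \<le> K^2 * (K^2 * norm (t *\<^sub>R e))^2"
        using sg(2,3) \<gamma>(2) by simp
      also have "\<dots> = (K^2 * (K^2 * norm e)^2) * t^2"
        by (simp add: power_mult_distrib)
      finally show ?thesis using sg(5)[of 1] \<gamma>(2) by simp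
    qed
    have "continuous_on {-\<delta>..\<delta>} (\<lambda>t. \<phi> (\<gamma> t))"
    proof (rule continuous_on_compose2[OF smooth_on_continuous_on[OF \<phi>]])
      show "continuous_on {-\<delta>..\<delta>} \<gamma>"
        using smooth_on_continuous_on[OF geodesicD(3)[OF M \<gamma>(1) UNIV_I]] continuous_on_subset by blast
    qed (use main R2_U in auto)
    moreover have "\<phi> (\<gamma> t) \<in> E" "f (\<psi> (\<phi> (\<gamma> t))) = f (\<psi> z) + t * a" if "t \<in> {-\<delta>..\<delta>}" for t
    proof -
      have tU: "\<gamma> t \<in> U" using main[OF that] R2_U by blast
      then show "\<phi> (\<gamma> t) \<in> E" using \<phi>_slice geodesicD(4)[OF M \<gamma>(1) UNIV_I] by blast
      show "f (\<psi> (\<phi> (\<gamma> t))) = f (\<psi> z) + t * a"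
        using \<psi>_\<phi>[OF tU] ab[of t] ab[of 0] \<gamma>(2) by simp
    qed
    ultimately show ?thesis
      using \<delta>(1) main by (intro exI[of _ "\<lambda>t. \<phi> (\<gamma> t)"] exI[of _ a] exI[of _ \<delta>]
          exI[of _ "K^2 * (K^2 * norm e)^2"]) auto
  qed
qed

text \<open>\<open>u'\<close> has the same chart coordinates at \<open>y\<close> as \<open>u\<close>
  has at \<open>x\<close>. The three factors \<open>K\<close> come from
  \<open>d\<psi>_Lipschitz\<close>, \<open>\<phi>_Lipschitz\<close> and the bound of the coordinate
  vector by \<open>u\<close>.\<close>

lemma tangent_space_Lipschitz:
  assumes "x \<in> M" "x \<in> cball p R2" "y \<in> M" "y \<in> cball p R2" "u \<in> tangent_space M x"
  shows "\<exists>u'\<in>tangent_space M y. norm (u - u') \<le> K^3 * norm (x - y) * norm u"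
proof -
  have T: "\<phi> x \<in> E" "\<phi> x \<in> V" "\<phi> x \<in> cball z R" "tangent_space M x = d\<psi> (\<phi> x) ` E"
    if "x \<in> M" "x \<in> cball p R2" for x
    using \<phi>_slice \<phi>_in R2_U that \<phi>_R2 tangent_space_eq[of "\<phi> x"] \<psi>_\<phi> by auto
  obtain e where e: "e \<in> E" "u = d\<psi> (\<phi> x) e" using assms T by blast
  have "norm e \<le> K * norm u"
    using D_lower[OF T(3)[OF assms(1,2)]] e by simp
  have "norm (u - d\<psi> (\<phi> y) e) \<le> K * norm (\<phi> x - \<phi> y) * norm e"
    unfolding e(2) by (intro d\<psi>_Lipschitz T assms)
  also have "\<dots> \<le> K * (K * norm (x - y)) * (K * norm u)"
    using \<phi>_Lipschitz[OF R2_R1 R2_R1] assms \<open>norm e \<le> K * norm u\<close> K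
    by (intro mult_mono mult_nonneg_nonneg) auto
  finally have "norm (u - d\<psi> (\<phi> y) e) \<le> K^3 * norm (x - y) * norm u"
    by (simp add: power3_eq_cube algebra_simps)
  moreover have "d\<psi> (\<phi> y) e \<in> tangent_space M y" using T[OF assms(3,4)] e by blast
  ultimately show ?thesis by blast
qed

end

section \<open>Gradients\<close>

text \<open>Used with \<open>k\<close> a multiple of a squared distance: a quadratically small
  increment has derivative zero, whatever else is known of \<open>e\<close>.\<close>

lemma has_derivative_zero_sandwich:
  fixes e :: "'a::real_normed_vector \<Rightarrow> 'b::real_normed_vector"
  assumes k: "(k has_derivative (\<lambda>h. 0)) (at x within S)" "k x = (0::real)"
    and e: "\<forall>\<^sub>F y in at x within S. norm (e y - e x) \<le> k y"
  shows "(e has_derivative (\<lambda>h. 0)) (at x within S)"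
  unfolding has_derivative_within
proof
  show "bounded_linear (\<lambda>h. 0 :: 'b)" by (rule bounded_linear_zero)
  have "((\<lambda>y. (1 / norm (y - x)) *\<^sub>R (k y - (k x + 0))) \<longlongrightarrow> 0) (at x within S)"
    using k(1) unfolding has_derivative_within by blast
  then show "((\<lambda>y. (1 / norm (y - x)) *\<^sub>R (e y - (e x + 0))) \<longlongrightarrow> 0) (at x within S)"
  proof (rule Lim_null_comparison[rotated])
    show "\<forall>\<^sub>F y in at x within S. norm ((1 / norm (y - x)) *\<^sub>R (e y - (e x + 0)))
        \<le> (1 / norm (y - x)) *\<^sub>R (k y - (k x + 0))"
      using e by eventually_elim (simp add: k(2) divide_right_mono)
  qed
qed

lemma has_derivative_square_distance:
  fixes \<alpha> :: "'a::real_normed_vector \<Rightarrow> 'b::real_inner"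
  assumes "(\<alpha> has_derivative \<alpha>') (at t within S)"
  shows "((\<lambda>s. C * (norm (\<alpha> s - \<alpha> t))^2) has_derivative (\<lambda>h. 0)) (at t within S)"
proof -
  have d: "((\<lambda>s. \<alpha> s - \<alpha> t) has_derivative \<alpha>') (at t within S)"
    using has_derivative_diff[OF assms has_derivative_const[of "\<alpha> t"]] by simp
  show ?thesis
    using has_derivative_mult_right[OF has_derivative_inner[OF d d], of C]
    by (simp add: power2_norm_eq_inner)
qed

lemma has_gradient_along_curve:
  fixes \<gamma> :: "real \<Rightarrow> 'a::euclidean_space"
  assumes G: "has_gradient M f (\<gamma> t) G" and \<gamma>: "(\<gamma> has_vector_derivative v) (at t)"
    and S: "open S" "t \<in> S" "\<gamma> ` S \<subseteq> M"
  shows "((\<lambda>s. f (\<gamma> s)) has_vector_derivative G \<bullet> v) (at t)"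
proof -
  have f: "(f has_derivative (\<lambda>v. G \<bullet> v)) (at (\<gamma> t) within \<gamma> ` S)"
    using G S(3) has_derivative_subset by (auto simp: has_gradient_def)
  have g: "(\<gamma> has_derivative (\<lambda>h. h *\<^sub>R v)) (at t within S)"
    using \<gamma> has_derivative_at_withinI by (auto simp: has_vector_derivative_def)
  have "((f \<circ> \<gamma>) has_derivative ((\<lambda>v. G \<bullet> v) \<circ> (\<lambda>h. h *\<^sub>R v))) (at t within S)"
    using diff_chain_within[OF g f] .
  then show ?thesis
    unfolding at_within_open[OF S(2,1)] by (simp add: has_vector_derivative_def o_def)
qed

text \<open>The derivative within \<open>M\<close> determines inner products with velocities of
  curves in \<open>M\<close>, that is, with all tangent vectors; the difference of two gradients is
  itself tangent.\<close>

lemma has_gradient_unique: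
  assumes T: "subspace (tangent_space M p)" and G: "has_gradient M f p G" "has_gradient M f p G'"
  shows "G = G'"
proof -
  have "G \<bullet> w = G' \<bullet> w" if w: "w \<in> tangent_space M p" for w
  proof -
    obtain \<gamma> e where \<gamma>: "e > 0" "\<gamma> ` {-e<..<e} \<subseteq> M" "\<gamma> 0 = p"
        "(\<gamma> has_vector_derivative w) (at (0::real))"
      using w by (auto simp: tangent_space_def)
    have "((\<lambda>s. f (\<gamma> s)) has_vector_derivative X \<bullet> w) (at 0)" if "has_gradient M f p X" for X
      by (rule has_gradient_along_curve[OF _ \<gamma>(4) open_greaterThanLessThan _ \<gamma>(2)])
        (use that \<gamma>(1,3) in auto)
    then show ?thesis using G vector_derivative_unique_at by blast
  qed
  moreover have "G - G' \<in> tangent_space M p"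
    using G T by (auto simp: has_gradient_def intro: subspace_diff)
  ultimately have "(G - G') \<bullet> (G - G') = 0"
    by (simp add: inner_diff_left)
  then show ?thesis by simp
qed

section \<open>Existence of the gradient and of joining geodesics in a chart\<close>

context chart_neighbourhood
begin

lemma \<psi>_Taylor:
  assumes "y \<in> cball z R"
  shows "norm (\<psi> y - p - d\<psi> z (y - z)) \<le> K * (norm (y - z))^2"
proof -
  define t where "t = y - z"
  have seg: "z + s *\<^sub>R t \<in> cball z R" if "s \<in> {0..1}" for s
  proof -
    have "\<bar>s\<bar> * norm t \<le> 1 * norm t" using that by (intro mult_right_mono) auto
    then show ?thesis using assms by (simp add: dist_norm t_def norm_minus_commute)
  qed
  have "norm ((\<psi> (z + 1 *\<^sub>R t) - 1 *\<^sub>R d\<psi> z t) - (\<psi> (z + 0 *\<^sub>R t) - 0 *\<^sub>R d\<psi> z t)) \<le> K * (norm t)^2"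
  proof (rule vector_derivative_bound_unit_interval[where f="\<lambda>s. \<psi> (z + s *\<^sub>R t) - s *\<^sub>R d\<psi> z t"
        and f'="\<lambda>s. d\<psi> (z + s *\<^sub>R t) t - d\<psi> z t"])
    fix s :: real assume s: "s \<in> {0..1}"
    have sV: "z + s *\<^sub>R t \<in> V" using seg[OF s] R_V by blast
    have l: "((\<lambda>s. z + s *\<^sub>R t) has_derivative (\<lambda>h. h *\<^sub>R t)) (at s within {0..1})"
      by (auto intro!: derivative_eq_intros)
    have "((\<lambda>s. \<psi> (z + s *\<^sub>R t)) has_derivative (\<lambda>h. d\<psi> (z + s *\<^sub>R t) (h *\<^sub>R t))) (at s within {0..1})"
      by (rule has_derivative_compose[OF l d\<psi>[OF sV]])
    then have "((\<lambda>s. \<psi> (z + s *\<^sub>R t)) has_vector_derivative d\<psi> (z + s *\<^sub>R t) t) (at s within {0..1})"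
      using linear_scale[OF has_derivative_linear[OF d\<psi>[OF sV]]] by (simp add: has_vector_derivative_def)
    then show "((\<lambda>s. \<psi> (z + s *\<^sub>R t) - s *\<^sub>R d\<psi> z t) has_vector_derivative d\<psi> (z + s *\<^sub>R t) t - d\<psi> z t) (at s within {0..1})"
      by (auto intro!: derivative_eq_intros)
    have "norm (d\<psi> (z + s *\<^sub>R t) t - d\<psi> z t) \<le> K * norm (z + s *\<^sub>R t - z) * norm t"
      by (rule d\<psi>_Lipschitz) (use seg[OF s] R in auto)
    also have "\<dots> \<le> K * norm t * norm t"
      using s K by (intro mult_right_mono mult_left_mono) (auto intro: mult_left_le_one_le)
    finally show "norm (d\<psi> (z + s *\<^sub>R t) t - d\<psi> z t) \<le> K * (norm t)^2"
      by (simp add: power2_eq_square mult.assoc)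
  qed auto
  then show ?thesis by (simp add: t_def \<psi>_z algebra_simps)
qed

text \<open>The slope functional of the chart expansion is represented by an ambient vector, whose
  tangential part is the gradient: the normal part does not act on tangent vectors.
  Differentiability within \<open>M\<close> follows from a quadratic bound on the increment of
  \<open>f q - G \<bullet> q\<close>.\<close>

lemma gradient_exists:
  assumes complete: "geodesically_complete M" and f: "affine_function M f"
  shows "\<exists>G. has_gradient M f p G"
proof -
  interpret geodesic_family E z R K d\<psi> "second_derivative \<psi>" chart_geodesic "\<lambda>x. f (\<psi> x)" r "K^2"
    by (rule geodesic_family[OF complete f])
  obtain k \<delta> C where k: "linear k" "\<delta> > 0"
      "\<forall>y\<in>E \<inter> cball z \<delta>. \<bar>f (\<psi> y) - f (\<psi> z) - k (y - z)\<bar> \<le> C * (norm (y - z))^2"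
    using first_order_expansion by blast
  define G0 where "G0 = (\<Sum>b\<in>Basis. k (d\<phi> p b) *\<^sub>R b)"
  have pU: "p \<in> U" using R1_U R by auto
  have lin: "linear (\<lambda>v. k (d\<phi> p v))"
    using linear_compose[OF has_derivative_linear[OF d\<phi>[OF pU]] k(1)] by (simp add: o_def)
  have G0: "k (d\<phi> p v) = G0 \<bullet> v" for v
  proof -
    have "k (d\<phi> p v) = k (d\<phi> p (\<Sum>b\<in>Basis. (v \<bullet> b) *\<^sub>R b))" by (simp add: euclidean_representation)
    also have "\<dots> = (\<Sum>b\<in>Basis. (v \<bullet> b) * k (d\<phi> p b))"
      using linear_scale[OF lin] by (simp add: linear_sum[OF lin] del: euclidean_representation)
    also have "\<dots> = G0 \<bullet> v" by (simp add: G0_def inner_sum_left inner_commute[of v] mult.commute)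
    finally show ?thesis .
  qed
  have T: "subspace (tangent_space M p)" using subspace_tangent_space[OF pU p] .
  obtain G n where G: "G \<in> tangent_space M p" "\<And>w. w \<in> tangent_space M p \<Longrightarrow> n \<bullet> w = 0" "G0 = G + n"
    using orthogonal_decomposition[OF T] by metis
  have kG: "k t = G \<bullet> d\<psi> z t" if "t \<in> E" for t
  proof -
    have "d\<psi> z t \<in> tangent_space M p"
      using tangent_space_eq[OF z_slice(2,1)] \<psi>_z that by auto
    then show ?thesis
      using G0[of "d\<psi> z t"] d\<phi>_d\<psi>[OF z_slice(2), of t] G(2,3) by (simp add: \<psi>_z inner_add_left)
  qed
  \<comment> \<open>The first summand is the error of the chart expansion, the second that of
    linearizing \<open>\<psi>\<close>; the factor \<open>K^2\<close> converts squared chart distance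
    into squared ambient distance.\<close>
  define L where "L = (\<bar>C\<bar> + norm G * K) * K^2"
  define \<rho> where "\<rho> = min R2 (\<delta> / K)"
  have \<rho>: "\<rho> > 0" "K * \<rho> \<le> \<delta>"
  proof -
    show "\<rho> > 0" using R k(2) K by (simp add: \<rho>_def)
    have "\<rho> \<le> \<delta> / K" by (simp add: \<rho>_def)
    then show "K * \<rho> \<le> \<delta>" using K by (simp add: field_simps)
  qed
  have bound: "norm ((f q - G \<bullet> q) - (f p - G \<bullet> p)) \<le> L * (norm (q - p))^2" if q: "q \<in> M" "q \<in> cball p \<rho>" for q
  proof -
    have q2: "q \<in> cball p R2" "q \<in> U" using q R2_U by (auto simp: \<rho>_def)
    define t where "t = \<phi> q - z"
    have tE: "t \<in> E" using \<phi>_slice[OF q2(2) q(1)] z_slice E by (auto simp: t_def intro: subspace_diff)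
    have t: "norm t \<le> K * norm (q - p)"
      unfolding t_def using R by (intro \<phi>_Lipschitz R2_R1 q2) auto
    also have "\<dots> \<le> K * \<rho>" using q(2) K by (intro mult_left_mono) (auto simp: dist_norm norm_minus_commute)
    finally have qE: "\<phi> q \<in> E \<inter> cball z \<delta>"
      using \<rho>(2) \<phi>_slice[OF q2(2) q(1)] by (auto simp: t_def dist_norm norm_minus_commute)
    have 1: "\<bar>f q - f p - G \<bullet> d\<psi> z t\<bar> \<le> C * (norm t)^2"
      using bspec[OF k(3) qE] unfolding t_def[symmetric] kG[OF tE] \<psi>_\<phi>[OF q2(2)] \<psi>_z .
    have "norm (q - p - d\<psi> z t) \<le> K * (norm t)^2"
      using \<psi>_Taylor[OF \<phi>_R2[OF q2(1)]] \<psi>_\<phi>[OF q2(2)] by (simp add: t_def)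
    then have 2: "\<bar>G \<bullet> (q - p - d\<psi> z t)\<bar> \<le> norm G * (K * (norm t)^2)"
      using Cauchy_Schwarz_ineq2[of G "q - p - d\<psi> z t"] by (meson mult_left_mono norm_ge_zero order_trans)
    have "(f q - G \<bullet> q) - (f p - G \<bullet> p) = (f q - f p - G \<bullet> d\<psi> z t) - G \<bullet> (q - p - d\<psi> z t)"
      by (simp add: inner_diff_right)
    then have "norm ((f q - G \<bullet> q) - (f p - G \<bullet> p)) \<le> \<bar>f q - f p - G \<bullet> d\<psi> z t\<bar> + \<bar>G \<bullet> (q - p - d\<psi> z t)\<bar>"
      by (simp add: abs_triangle_ineq4)
    also have "\<dots> \<le> \<bar>C\<bar> * (norm t)^2 + norm G * (K * (norm t)^2)"
      using 1 2 mult_right_mono[OF abs_ge_self[of C], of "(norm t)^2"] by simp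
    also have "\<dots> = (\<bar>C\<bar> + norm G * K) * (norm t)^2" by (simp add: algebra_simps)
    also have "\<dots> \<le> (\<bar>C\<bar> + norm G * K) * (K * norm (q - p))^2"
      using t K by (intro mult_left_mono power_mono) auto
    finally show ?thesis by (simp add: L_def power_mult_distrib)
  qed
  have "((\<lambda>q. f q - G \<bullet> q) has_derivative (\<lambda>h. 0)) (at p within M)"
  proof (rule has_derivative_zero_sandwich)
    show "((\<lambda>q. L * (norm (q - p))^2) has_derivative (\<lambda>h. 0)) (at p within M)"
      using has_derivative_square_distance[OF has_derivative_ident] .
    show "\<forall>\<^sub>F q in at p within M. norm ((f q - G \<bullet> q) - (f p - G \<bullet> p)) \<le> L * (norm (q - p))^2"
      unfolding eventually_at
      by (intro exI[of _ \<rho>] conjI ballI impI \<rho>(1) bound) (auto simp: dist_commute)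
  qed simp
  from has_derivative_add[OF this has_derivative_inner_right[OF has_derivative_ident, of G]]
  have "(f has_derivative (\<lambda>v. G \<bullet> v)) (at p within M)" by simp
  then show ?thesis using G(1) by (auto simp: has_gradient_def)
qed

text \<open>Shooting carried back to \<open>M\<close>. The factor \<open>2 * K^4\<close> is
  \<open>2 * K^2\<close> from the shooting, one \<open>K\<close> for the chart distance of the end
  points and one for \<open>d\<psi>\<close>.\<close>

lemma joining_geodesics:
  assumes complete: "geodesically_complete M" and f: "affine_function M f"
  shows "\<exists>\<rho>>0. \<exists>C\<ge>0. \<forall>x\<in>M \<inter> cball p \<rho>. \<forall>y\<in>M \<inter> cball p \<rho>.
    \<exists>\<gamma>. geodesic M UNIV \<gamma> \<and> \<gamma> 0 = x \<and> \<gamma> 1 = y \<and> norm (velocity \<gamma> 0) \<le> C * norm (x - y)"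
proof -
  interpret geodesic_family E z R K d\<psi> "second_derivative \<psi>" chart_geodesic "\<lambda>x. f (\<psi> x)" r "K^2"
    by (rule geodesic_family[OF complete f])
  obtain r1 where r1: "r1 > 0" "\<forall>x\<in>E \<inter> cball z r1. \<forall>y\<in>E \<inter> cball z r1. \<exists>c u. chart_geodesic c u \<and> c 0 = x \<and> c 1 = y \<and>
     (\<forall>s\<in>{0..1}. norm (u s) \<le> 2 * K^2 * norm (x - y) \<and> norm (u s) \<le> 1 / (160 * K^6))"
    using two_point_geodesics by blast
  define \<rho> where "\<rho> = min R2 (r1 / K)"
  have \<rho>: "\<rho> > 0" "K * \<rho> \<le> r1"
  proof -
    show "\<rho> > 0" using R r1 K by (simp add: \<rho>_def)
    have "\<rho> \<le> r1 / K" by (simp add: \<rho>_def)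
    then show "K * \<rho> \<le> r1" using K by (simp add: field_simps)
  qed
  have \<phi>r: "\<phi> x \<in> E \<inter> cball z r1" "x \<in> cball p R2" "x \<in> U" if "x \<in> M \<inter> cball p \<rho>" for x
  proof -
    show x: "x \<in> cball p R2" "x \<in> U" using that R2_U by (auto simp: \<rho>_def)
    have "norm (\<phi> x - z) \<le> K * norm (x - p)" using R by (intro \<phi>_Lipschitz R2_R1 x) auto
    also have "\<dots> \<le> K * \<rho>" using that K by (intro mult_left_mono) (auto simp: dist_norm norm_minus_commute)
    finally show "\<phi> x \<in> E \<inter> cball z r1"
      using \<rho>(2) that \<phi>_slice[OF x(2)] by (auto simp: dist_norm norm_minus_commute)
  qed
  have "\<exists>\<gamma>. geodesic M UNIV \<gamma> \<and> \<gamma> 0 = x \<and> \<gamma> 1 = y \<and> norm (velocity \<gamma> 0) \<le> (2 * K^4) * norm (x - y)"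
    if x: "x \<in> M \<inter> cball p \<rho>" and y: "y \<in> M \<inter> cball p \<rho>" for x y
  proof -
    from bspec[OF bspec[OF r1(2) \<phi>r(1)[OF x]] \<phi>r(1)[OF y]]
    obtain c u where c: "chart_geodesic c u" "c 0 = \<phi> x" "c 1 = \<phi> y"
      and u: "\<forall>s\<in>{0..1}. norm (u s) \<le> 2 * K^2 * norm (\<phi> x - \<phi> y) \<and> norm (u s) \<le> 1 / (160 * K^6)"
      by (elim exE conjE)
    have "norm (u 0) \<le> 2 * K^2 * norm (\<phi> x - \<phi> y)" using u by simp
    note cu = c this
    obtain \<gamma> where \<gamma>: "geodesic M UNIV \<gamma>" "\<forall>s\<in>{0..1}. \<gamma> s \<in> cball p R2"
        "c = (\<lambda>s. \<phi> (\<gamma> s))" "u = (\<lambda>s. d\<phi> (\<gamma> s) (velocity \<gamma> s))"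
      using cu(1) by (auto simp: chart_geodesic_def)
    have \<gamma>U: "\<gamma> 0 \<in> U" "\<gamma> 1 \<in> U" "\<gamma> 0 \<in> cball p R2" using \<gamma>(2) R2_U by auto
    have "\<phi> (\<gamma> 0) = \<phi> x" "\<phi> (\<gamma> 1) = \<phi> y"
      using cu(2,3) unfolding \<gamma>(3) .
    then have "\<gamma> 0 = x" "\<gamma> 1 = y"
      using \<psi>_\<phi>[OF \<gamma>U(1)] \<psi>_\<phi>[OF \<gamma>U(2)] \<psi>_\<phi>[OF \<phi>r(3)[OF x]] \<psi>_\<phi>[OF \<phi>r(3)[OF y]] by argo+
    have "velocity \<gamma> 0 = d\<psi> (\<phi> (\<gamma> 0)) (u 0)"
      using d\<psi>_d\<phi>[OF \<gamma>U(1)] \<gamma>(4) by simp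
    then have "norm (velocity \<gamma> 0) \<le> K * norm (u 0)"
      using d\<psi>_bound[OF \<phi>_R2[OF \<gamma>U(3)]] by simp
    also have "\<dots> \<le> K * (2 * K^2 * (K * norm (x - y)))"
    proof (intro mult_left_mono order_trans[OF cu(4)])
      show "norm (\<phi> x - \<phi> y) \<le> K * norm (x - y)"
        using \<phi>r(2)[OF x] \<phi>r(2)[OF y] by (intro \<phi>_Lipschitz R2_R1)
    qed (use K in auto)
    also have "\<dots> = (2 * K^4) * norm (x - y)"
      by (simp add: power_numeral_reduce)
    finally show ?thesis using \<gamma>(1) \<open>\<gamma> 0 = x\<close> \<open>\<gamma> 1 = y\<close> by blast
  qed
  then show ?thesis using \<rho>(1) K by (intro exI[of _ \<rho>] conjI exI[of _ "2 * K^4"]) auto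
qed

end

section \<open>Local statements without charts\<close>

lemma chart_neighbourhood_at:
  assumes "smooth_submanifold d M" "p \<in> M"
  shows "\<exists>U V E \<phi> \<psi> R1 R2 R K. chart_neighbourhood M U V E \<phi> \<psi> p d R1 R2 R K"
proof -
  obtain U V E \<phi> \<psi> where "slice_chart M U V E \<phi> \<psi>" "p \<in> U"
    by (rule slice_chart_exists[OF assms])
  then show ?thesis using slice_chart.chart_neighbourhood_exists assms by meson
qed

lemma gradient_exists:
  assumes "smooth_submanifold d M" "geodesically_complete M" "affine_function M f" "p \<in> M"
  shows "\<exists>G. has_gradient M f p G"
  using chart_neighbourhood_at[OF assms(1,4)] chart_neighbourhood.gradient_exists[OF _ assms(2,3)] by blast

text \<open>This and the existence of the gradient are all that the remaining estimates take from
  the charts.\<close>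

lemma local_geometry:
  assumes "smooth_submanifold d M" "geodesically_complete M" "affine_function M f" "p \<in> M"
  shows "\<exists>\<rho>>0. \<exists>C\<ge>0. \<forall>x\<in>M \<inter> cball p \<rho>. \<forall>y\<in>M \<inter> cball p \<rho>.
    (\<exists>\<gamma>. geodesic M UNIV \<gamma> \<and> \<gamma> 0 = x \<and> \<gamma> 1 = y \<and> norm (velocity \<gamma> 0) \<le> C * norm (x - y)) \<and>
    (\<forall>u\<in>tangent_space M x. \<exists>u'\<in>tangent_space M y. norm (u - u') \<le> C * norm (x - y) * norm u)"
proof -
  obtain U V E \<phi> \<psi> R1 R2 R K where "chart_neighbourhood M U V E \<phi> \<psi> p d R1 R2 R K"
    using chart_neighbourhood_at[OF assms(1,4)] by blast
  then interpret chart_neighbourhood M U V E \<phi> \<psi> p d R1 R2 R K .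
  obtain \<rho> C where \<rho>: "\<rho> > 0" "C \<ge> 0" "\<forall>x\<in>M \<inter> cball p \<rho>. \<forall>y\<in>M \<inter> cball p \<rho>.
    \<exists>\<gamma>. geodesic M UNIV \<gamma> \<and> \<gamma> 0 = x \<and> \<gamma> 1 = y \<and> norm (velocity \<gamma> 0) \<le> C * norm (x - y)"
    using joining_geodesics[OF assms(2,3)] by blast
  have "\<forall>x\<in>M \<inter> cball p (min \<rho> R2). \<forall>y\<in>M \<inter> cball p (min \<rho> R2).
    (\<exists>\<gamma>. geodesic M UNIV \<gamma> \<and> \<gamma> 0 = x \<and> \<gamma> 1 = y \<and> norm (velocity \<gamma> 0) \<le> (C + K^3) * norm (x - y)) \<and>
    (\<forall>u\<in>tangent_space M x. \<exists>u'\<in>tangent_space M y. norm (u - u') \<le> (C + K^3) * norm (x - y) * norm u)"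
  proof (intro ballI conjI)
    fix x y assume x: "x \<in> M \<inter> cball p (min \<rho> R2)" and y: "y \<in> M \<inter> cball p (min \<rho> R2)"
    have K3: "K^3 \<ge> 0" using K by simp
    have "x \<in> M \<inter> cball p \<rho>" "y \<in> M \<inter> cball p \<rho>" using x y by auto
    from bspec[OF bspec[OF \<rho>(3) this(1)] this(2)]
    obtain \<gamma> where \<gamma>: "geodesic M UNIV \<gamma>" "\<gamma> 0 = x" "\<gamma> 1 = y" "norm (velocity \<gamma> 0) \<le> C * norm (x - y)"
      by (elim exE conjE)
    have "C * norm (x - y) \<le> (C + K^3) * norm (x - y)" using K3 by (intro mult_right_mono) auto
    then have "norm (velocity \<gamma> 0) \<le> (C + K^3) * norm (x - y)" using \<gamma>(4) by linarith
    then show "\<exists>\<gamma>. geodesic M UNIV \<gamma> \<and> \<gamma> 0 = x \<and> \<gamma> 1 = y \<and> norm (velocity \<gamma> 0) \<le> (C + K^3) * norm (x - y)"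
      using \<gamma>(1-3) by (intro exI[of _ \<gamma>] conjI)
    fix u assume "u \<in> tangent_space M x"
    then obtain u' where u': "u' \<in> tangent_space M y" "norm (u - u') \<le> K^3 * norm (x - y) * norm u"
      using tangent_space_Lipschitz[of x y u] x y by auto
    have "K^3 * norm (x - y) * norm u \<le> (C + K^3) * norm (x - y) * norm u"
      using \<rho>(2) by (intro mult_right_mono) auto
    with u' show "\<exists>u'\<in>tangent_space M y. norm (u - u') \<le> (C + K^3) * norm (x - y) * norm u"
      by (meson order_trans)
  qed
  moreover have "min \<rho> R2 > 0" "C + K^3 \<ge> 0" using \<rho> R K by auto
  ultimately show ?thesis by blast
qed

section \<open>The gradient is parallel\<close>

lemma geodesic_Lipschitz:
  assumes "smooth_submanifold d M" "geodesic M UNIV \<gamma>"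
  shows "norm (\<gamma> s - \<gamma> t) \<le> norm (velocity \<gamma> 0) * \<bar>s - t\<bar>"
proof -
  have "norm (\<gamma> s - \<gamma> t) \<le> norm (velocity \<gamma> 0) * norm (s - t)"
  proof (rule differentiable_bound[OF convex_UNIV])
    show "(\<gamma> has_derivative (\<lambda>h. h *\<^sub>R velocity \<gamma> x)) (at x within UNIV)" for x
      using geodesicD(5)[OF assms UNIV_I] by (simp add: has_vector_derivative_def)
    show "onorm (\<lambda>h. h *\<^sub>R velocity \<gamma> x) \<le> norm (velocity \<gamma> 0)" for x
      by (rule onorm_le) (simp add: geodesic_constant_speed[OF assms, of x] mult.commute)
  qed auto
  then show ?thesis by simp
qed

text \<open>Differentiating the velocity against the normal vector \<open>\<gamma>''\<close> only sees how fast the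
  tangent spaces turn, so a Lipschitz bound on the tangent spaces bounds \<open>\<gamma>''\<close>.\<close>

lemma geodesic_acceleration_bound:
  assumes M: "smooth_submanifold d M" and \<gamma>: "geodesic M UNIV \<gamma>" and C: "C \<ge> 0"
    and T: "\<And>x y u. x \<in> M \<inter> cball p \<rho> \<Longrightarrow> y \<in> M \<inter> cball p \<rho> \<Longrightarrow> u \<in> tangent_space M x \<Longrightarrow>
      \<exists>u'\<in>tangent_space M y. norm (u - u') \<le> C * norm (x - y) * norm u"
    and s: "\<gamma> s \<in> ball p \<rho>"
  shows "norm (acceleration_vector \<gamma> s) \<le> C * (norm (velocity \<gamma> 0))^2"
proof -
  note g = geodesicD[OF M \<gamma> UNIV_I]
  define A where "A = acceleration_vector \<gamma> s"
  define \<nu> where "\<nu> = norm (velocity \<gamma> 0)"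
  have "((\<lambda>t. A \<bullet> velocity \<gamma> t) has_vector_derivative A \<bullet> A) (at s)"
    unfolding A_def using bounded_linear.has_vector_derivative[OF bounded_linear_inner_right g(6)] .
  then have "((\<lambda>t. A \<bullet> velocity \<gamma> t) has_field_derivative A \<bullet> A) (at s)"
    by (simp add: has_real_derivative_iff_has_vector_derivative)
  then have lim: "((\<lambda>t. (A \<bullet> velocity \<gamma> t - A \<bullet> velocity \<gamma> s) / (t - s)) \<longlongrightarrow> A \<bullet> A) (at s)"
    by (simp add: has_field_derivative_iff)
  have "isCont \<gamma> s" using g(5) has_vector_derivative_continuous by blast
  then have "\<forall>\<^sub>F t in at s. \<gamma> t \<in> ball p \<rho>"
    using s topological_tendstoD[OF _ open_ball] unfolding isCont_def by blast
  then have "\<forall>\<^sub>F t in at s. (A \<bullet> velocity \<gamma> t - A \<bullet> velocity \<gamma> s) / (t - s) \<le> norm A * (C * \<nu>^2)"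
    using eventually_neq_at_within[of s s UNIV]
  proof eventually_elim
    case (elim t)
    then have ts: "t \<noteq> s" by simp
    have in_ball: "\<gamma> t \<in> M \<inter> cball p \<rho>" "\<gamma> s \<in> M \<inter> cball p \<rho>" using elim s g(4) by auto
    obtain u where u: "u \<in> tangent_space M (\<gamma> s)" "norm (velocity \<gamma> t - u) \<le> C * norm (\<gamma> t - \<gamma> s) * norm (velocity \<gamma> t)"
      using T[OF in_ball g(7)] by blast
    have "norm (velocity \<gamma> t - u) \<le> C * (\<nu> * \<bar>t - s\<bar>) * \<nu>"
    proof (rule order_trans[OF u(2)])
      show "C * norm (\<gamma> t - \<gamma> s) * norm (velocity \<gamma> t) \<le> C * (\<nu> * \<bar>t - s\<bar>) * \<nu>"
        using geodesic_Lipschitz[OF M \<gamma>, of t s] C geodesic_constant_speed[OF M \<gamma>, of t]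
        by (intro mult_mono mult_left_mono) (auto simp: \<nu>_def)
    qed
    \<comment> \<open>Both \<open>velocity \<gamma> s\<close> and \<open>u\<close> are tangent at
      \<open>\<gamma> s\<close>, where \<open>A\<close> is normal.\<close>
    have "A \<bullet> velocity \<gamma> t - A \<bullet> velocity \<gamma> s = A \<bullet> (velocity \<gamma> t - u)"
      using g(8)[OF g(7)] g(8)[OF u(1)] by (simp add: A_def inner_diff_right)
    then have "\<bar>A \<bullet> velocity \<gamma> t - A \<bullet> velocity \<gamma> s\<bar> \<le> norm A * norm (velocity \<gamma> t - u)"
      using Cauchy_Schwarz_ineq2[of A "velocity \<gamma> t - u"] by simp
    also have "\<dots> \<le> norm A * (C * (\<nu> * \<bar>t - s\<bar>) * \<nu>)"
      using \<open>norm (velocity \<gamma> t - u) \<le> C * (\<nu> * \<bar>t - s\<bar>) * \<nu>\<close> by (intro mult_left_mono) auto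
    also have "\<dots> = norm A * (C * \<nu>^2) * \<bar>t - s\<bar>" by (simp add: power2_eq_square)
    finally have "\<bar>A \<bullet> velocity \<gamma> t - A \<bullet> velocity \<gamma> s\<bar> / \<bar>t - s\<bar> \<le> norm A * (C * \<nu>^2)"
      using ts by (simp add: divide_le_eq)
    then show ?case by (metis abs_divide abs_ge_self order_trans)
  qed
  from tendsto_upperbound[OF lim this] have "norm A * norm A \<le> norm A * (C * \<nu>^2)"
    by (simp add: power2_norm_eq_inner[symmetric] power2_eq_square)
  then have "norm A \<le> C * \<nu>^2"
    by (cases "norm A = 0") (auto simp: C)
  then show ?thesis by (simp add: A_def \<nu>_def)
qed

text \<open>The second derivative of \<open>w \<bullet> \<gamma> s\<close> pairs a normal
  acceleration, quadratic in the speed, with a vector that is tangent up to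
  \<open>C * \<epsilon> * norm w\<close>. The result is of third order once
  \<open>\<epsilon>\<close> is comparable to the speed.\<close>

lemma tangent_component_deviation:
  assumes M: "smooth_submanifold d M" and \<gamma>: "geodesic M UNIV \<gamma>" and C: "C \<ge> 0"
    and T: "\<And>x y u. x \<in> M \<inter> cball p \<rho> \<Longrightarrow> y \<in> M \<inter> cball p \<rho> \<Longrightarrow> u \<in> tangent_space M x \<Longrightarrow>
      \<exists>u'\<in>tangent_space M y. norm (u - u') \<le> C * norm (x - y) * norm u"
    and s: "\<And>s. s \<in> {0..1} \<Longrightarrow> \<gamma> s \<in> ball p \<rho>" "\<And>s. s \<in> {0..1} \<Longrightarrow> norm (\<gamma> s - q) \<le> \<epsilon>"
    and q: "q \<in> M \<inter> cball p \<rho>" and w: "w \<in> tangent_space M q"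
  shows "\<bar>w \<bullet> (\<gamma> 1 - \<gamma> 0 - velocity \<gamma> 0)\<bar> \<le> C^2 * \<epsilon> * norm w * (norm (velocity \<gamma> 0))^2"
proof -
  note g = geodesicD[OF M \<gamma> UNIV_I]
  define \<nu> where "\<nu> = norm (velocity \<gamma> 0)"
  have "norm (w \<bullet> \<gamma> 1 - w \<bullet> \<gamma> 0 - 1 *\<^sub>R (w \<bullet> velocity \<gamma> 0)) \<le> C^2 * \<epsilon> * norm w * \<nu>^2"
  proof (rule second_order_Taylor_unit_interval[where f="\<lambda>s. w \<bullet> \<gamma> s" and f'="\<lambda>s. w \<bullet> velocity \<gamma> s"
        and f''="\<lambda>s. w \<bullet> acceleration_vector \<gamma> s"])
    fix t :: real assume t: "t \<in> {0..1}"
    show "((\<lambda>s. w \<bullet> \<gamma> s) has_vector_derivative w \<bullet> velocity \<gamma> t) (at t within {0..1})"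
      using bounded_linear.has_vector_derivative[OF bounded_linear_inner_right g(5)]
      by (rule has_vector_derivative_at_within)
    show "((\<lambda>s. w \<bullet> velocity \<gamma> s) has_vector_derivative w \<bullet> acceleration_vector \<gamma> t) (at t within {0..1})"
      using bounded_linear.has_vector_derivative[OF bounded_linear_inner_right g(6)]
      by (rule has_vector_derivative_at_within)
    have "\<gamma> t \<in> M \<inter> cball p \<rho>" using s(1)[OF t] g(4) by auto
    then obtain w' where w': "w' \<in> tangent_space M (\<gamma> t)" "norm (w - w') \<le> C * norm (q - \<gamma> t) * norm w"
      using T[OF q _ w] by blast
    have "norm (w - w') \<le> C * \<epsilon> * norm w"
    proof (rule order_trans[OF w'(2)])
      show "C * norm (q - \<gamma> t) * norm w \<le> C * \<epsilon> * norm w"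
        using s(2)[OF t] C by (intro mult_right_mono mult_left_mono) (auto simp: norm_minus_commute)
    qed
    have \<epsilon>: "\<epsilon> \<ge> 0" using order_trans[OF norm_ge_zero s(2)[OF t]] .
    have "w \<bullet> acceleration_vector \<gamma> t = (w - w') \<bullet> acceleration_vector \<gamma> t"
      using g(8)[OF w'(1)] by (simp add: inner_diff_left inner_commute[of w'])
    then have "norm (w \<bullet> acceleration_vector \<gamma> t) \<le> norm (w - w') * norm (acceleration_vector \<gamma> t)"
      using Cauchy_Schwarz_ineq2[of "w - w'" "acceleration_vector \<gamma> t"] by simp
    also have "\<dots> \<le> (C * \<epsilon> * norm w) * (C * \<nu>^2)"
      using \<open>norm (w - w') \<le> C * \<epsilon> * norm w\<close> geodesic_acceleration_bound[OF M \<gamma> C T s(1)[OF t]] C \<epsilon>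
      unfolding \<nu>_def by (intro mult_mono) auto
    finally show "norm (w \<bullet> acceleration_vector \<gamma> t) \<le> C^2 * \<epsilon> * norm w * \<nu>^2"
      by (simp add: power2_eq_square algebra_simps)
  qed simp
  then show ?thesis by (simp add: \<nu>_def inner_diff_right)
qed

text \<open>An affine function has no remainder: its increment over unit time is its derivative at
  the start, expressed through the gradient there.\<close>

lemma affine_increment:
  assumes M: "smooth_submanifold d M" and f: "affine_function M f" and \<gamma>: "geodesic M UNIV \<gamma>"
    and G: "has_gradient M f (\<gamma> 0) G"
  shows "f (\<gamma> 1) - f (\<gamma> 0) = G \<bullet> velocity \<gamma> 0"
proof -
  note g = geodesicD[OF M \<gamma> UNIV_I]
  obtain a b where ab: "\<And>s. f (\<gamma> s) = a * s + b"
    using affine_along_geodesic[OF M f \<gamma>] by blast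
  have "((\<lambda>s. f (\<gamma> s)) has_vector_derivative G \<bullet> velocity \<gamma> 0) (at 0)"
    by (rule has_gradient_along_curve[OF G g(5) open_UNIV UNIV_I]) (use g(4) in auto)
  moreover have "((\<lambda>s. f (\<gamma> s)) has_vector_derivative a) (at 0)"
    unfolding ab by (auto intro!: derivative_eq_intros simp: has_real_derivative_iff_has_vector_derivative[symmetric])
  ultimately show ?thesis using ab[of 1] ab[of 0] vector_derivative_unique_at by fastforce
qed

text \<open>The gradient is parallel up to second order: comparing the increments of \<open>f\<close> over the three
  sides of a geodesic triangle \<open>x, y, exp\<^sub>y v\<close> with \<open>v\<close> of length \<open>\<bar>x - y\<bar>\<close>, every chord agrees
  with its initial velocity up to third order in tangential directions.\<close>

lemma gradient_variation:
  assumes M: "smooth_submanifold d M" and complete: "geodesically_complete M"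
    and f: "affine_function M f" and p: "p \<in> M"
    and G: "\<And>x. x \<in> M \<Longrightarrow> has_gradient M f x (G x)"
  shows "\<exists>\<delta>>0. \<exists>L\<ge>0. \<forall>x\<in>M \<inter> cball p \<delta>. \<forall>y\<in>M \<inter> cball p \<delta>. \<forall>w\<in>tangent_space M y.
    \<bar>(G y - G x) \<bullet> w\<bar> \<le> L * (norm (x - y))^2 * norm (G x) * norm w"
proof -
  obtain \<rho> C where \<rho>: "\<rho> > 0" and C: "C \<ge> 0" and loc: "\<forall>x\<in>M \<inter> cball p \<rho>. \<forall>y\<in>M \<inter> cball p \<rho>.
    (\<exists>\<gamma>. geodesic M UNIV \<gamma> \<and> \<gamma> 0 = x \<and> \<gamma> 1 = y \<and> norm (velocity \<gamma> 0) \<le> C * norm (x - y)) \<and>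
    (\<forall>u\<in>tangent_space M x. \<exists>u'\<in>tangent_space M y. norm (u - u') \<le> C * norm (x - y) * norm u)"
    using local_geometry[OF M complete f p] by (elim exE conjE)
  have join: "\<exists>\<gamma>. geodesic M UNIV \<gamma> \<and> \<gamma> 0 = x \<and> \<gamma> 1 = y \<and> norm (velocity \<gamma> 0) \<le> C * norm (x - y)"
    and T: "u \<in> tangent_space M x \<Longrightarrow> \<exists>u'\<in>tangent_space M y. norm (u - u') \<le> C * norm (x - y) * norm u"
    if "x \<in> M \<inter> cball p \<rho>" "y \<in> M \<inter> cball p \<rho>" for x y u
    using bspec[OF bspec[OF loc that(1)] that(2)] by blast+
  \<comment> \<open>The geodesics below move away from \<open>x\<close> by at most
    \<open>4 * (C * \<delta>)\<close> or from \<open>y\<close> by at most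
    \<open>2 * \<delta>\<close>; this choice keeps them in the ball of radius
    \<open>\<rho>\<close>.\<close>
  define \<delta> where "\<delta> = \<rho> / (5 + 5 * C)"
  have \<delta>: "\<delta> > 0" "\<delta> + 4 * (C * \<delta>) < \<rho>" "3 * \<delta> < \<rho>"
  proof -
    show "\<delta> > 0" using \<rho> C by (simp add: \<delta>_def add_pos_nonneg)
    have "\<delta> * (5 + 5 * C) = \<rho>" using C by (simp add: \<delta>_def add_nonneg_eq_0_iff)
    then have "\<rho> = 5 * \<delta> + 5 * (C * \<delta>)" by (simp add: algebra_simps)
    moreover have "C * \<delta> \<ge> 0" using C \<open>\<delta> > 0\<close> by simp
    ultimately show "\<delta> + 4 * (C * \<delta>) < \<rho>" "3 * \<delta> < \<rho>" using \<open>\<delta> > 0\<close> by linarith+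
  qed
  \<comment> \<open>The two sides from \<open>x\<close> have sizes \<open>2 * \<epsilon>\<close> and
    \<open>\<epsilon>\<close> and contribute 8 and 1 times \<open>C^5\<close>; the side from
    \<open>y\<close> contributes \<open>2 * C^2\<close>.\<close>
  define L where "L = 9 * C^5 + 2 * C^2"
  have near: "a \<in> ball p \<rho>" if "norm (a - b) \<le> e" "norm (b - p) \<le> e'" "e + e' < \<rho>" for a b e e'
    using norm_triangle_ineq[of "a - b" "b - p"] that by (simp add: dist_norm norm_minus_commute)
  have "\<bar>(G y - G x) \<bullet> w\<bar> \<le> L * (norm (x - y))^2 * norm (G x) * norm w"
    if x: "x \<in> M \<inter> cball p \<delta>" and y: "y \<in> M \<inter> cball p \<delta>" and w: "w \<in> tangent_space M y" for x y w
  proof (cases "x = y \<or> w = 0")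
    case False
    define \<epsilon> where "\<epsilon> = norm (x - y)"
    define v where "v = (\<epsilon> / norm w) *\<^sub>R w"
    define g where "g = G x"
    have \<epsilon>: "\<epsilon> > 0" using False by (simp add: \<epsilon>_def)
    have xp: "norm (x - p) \<le> \<delta>" and yp: "norm (y - p) \<le> \<delta>"
      using x y by (auto simp: dist_norm norm_minus_commute)
    have \<epsilon>2: "\<epsilon> \<le> 2 * \<delta>"
      using norm_triangle_ineq4[of "x - p" "y - p"] xp yp by (simp add: \<epsilon>_def)
    have x\<rho>: "x \<in> M \<inter> cball p \<rho>" and y\<rho>: "y \<in> M \<inter> cball p \<rho>" using x y \<delta> by auto
    have nv: "norm v = \<epsilon>" using False \<epsilon> by (simp add: v_def)
    have vT: "v \<in> tangent_space M y"
      using w subspace_tangent_space[OF M] y by (auto simp: v_def intro: subspace_scale)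
    have gT: "g \<in> tangent_space M x" using G x by (auto simp: g_def has_gradient_def)
    obtain \<eta> where \<eta>: "geodesic M UNIV \<eta>" "\<eta> 0 = y" "velocity \<eta> 0 = v"
      using complete vT y unfolding geodesically_complete_def by blast
    define r where "r = \<eta> 1"
    have \<eta>s: "norm (\<eta> s - y) \<le> \<epsilon>" if "s \<in> {0..1}" for s
      using geodesic_distance_le[OF M \<eta>(1) that] \<eta> nv by simp
    have \<eta>x: "norm (\<eta> s - x) \<le> 2 * \<epsilon>" if "s \<in> {0..1}" for s
      using norm_triangle_ineq[of "\<eta> s - y" "y - x"] \<eta>s[OF that] by (simp add: \<epsilon>_def norm_minus_commute)
    have \<eta>\<rho>: "\<eta> s \<in> ball p \<rho>" if "s \<in> {0..1}" for s
      by (rule near[OF \<eta>s[OF that] yp]) (use \<delta> \<epsilon>2 in auto)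
    have r: "r \<in> M \<inter> cball p \<rho>" "norm (r - x) \<le> 2 * \<epsilon>"
      using \<eta>\<rho>[of 1] \<eta>x[of 1] geodesicD(4)[OF M \<eta>(1) UNIV_I] by (auto simp: r_def)
    have C\<epsilon>: "C * \<epsilon> \<le> 2 * (C * \<delta>)" using mult_left_mono[OF \<epsilon>2 C] by simp
    \<comment> \<open>For a side issuing from \<open>x\<close>: its geodesic has speed at most
      \<open>C * e\<close> and stays within \<open>C * e\<close> of \<open>x\<close>, so the
      deviation is at most \<open>C^2 * (C * e) * norm g * (C * e)^2\<close>.\<close>
    have dev: "\<bar>g \<bullet> (q - x - u)\<bar> \<le> C^5 * e^3 * norm g \<and> f q - f x = g \<bullet> u"
      if "q \<in> M \<inter> cball p \<rho>" "norm (q - x) \<le> e" "C * e \<le> 4 * (C * \<delta>)" "geodesic M UNIV \<gamma>" "\<gamma> 0 = x" "\<gamma> 1 = q"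
        "u = velocity \<gamma> 0" "norm u \<le> C * norm (x - q)" for q u e \<gamma>
    proof
      have e0: "e \<ge> 0" using order_trans[OF norm_ge_zero that(2)] .
      have nu: "norm u \<le> C * e"
        using that(2,8) C by (metis mult_left_mono norm_minus_commute order_trans)
      have \<gamma>x: "norm (\<gamma> s - x) \<le> C * e" if "s \<in> {0..1}" for s
        using geodesic_distance_le[OF M \<open>geodesic M UNIV \<gamma>\<close> that] \<open>\<gamma> 0 = x\<close> nu \<open>u = velocity \<gamma> 0\<close> by simp
      have "\<bar>g \<bullet> (\<gamma> 1 - \<gamma> 0 - velocity \<gamma> 0)\<bar> \<le> C^2 * (C * e) * norm g * (norm (velocity \<gamma> 0))^2"
      proof (rule tangent_component_deviation[OF M that(4) C T])
        show "\<gamma> s \<in> ball p \<rho>" if "s \<in> {0..1}" for s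
          by (rule near[OF \<gamma>x[OF that] xp]) (use \<delta> \<open>C * e \<le> 4 * (C * \<delta>)\<close> in auto)
      qed (use \<gamma>x x\<rho> gT in auto)
      also have "\<dots> \<le> C^2 * (C * e) * norm g * (C * e)^2"
        using nu that(7) C e0 by (intro mult_left_mono power_mono) auto
      also have "\<dots> = C^5 * e^3 * norm g"
        by (simp add: power_numeral_reduce algebra_simps)
      finally show "\<bar>g \<bullet> (q - x - u)\<bar> \<le> C^5 * e^3 * norm g" using that by simp
      show "f q - f x = g \<bullet> u"
        using affine_increment[OF M f that(4), of g] G x that by (auto simp: g_def)
    qed
    have yx: "norm (y - x) \<le> \<epsilon>" by (simp add: \<epsilon>_def norm_minus_commute)
    have "C * \<delta> \<ge> 0" using C \<delta>(1) by simp
    then have C\<epsilon>': "C * \<epsilon> \<le> 4 * (C * \<delta>)" "C * (2 * \<epsilon>) \<le> 4 * (C * \<delta>)" using C\<epsilon> by linarith+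
    obtain \<gamma>1 where \<gamma>1: "geodesic M UNIV \<gamma>1" "\<gamma>1 0 = x" "\<gamma>1 1 = y" "norm (velocity \<gamma>1 0) \<le> C * norm (x - y)"
      using join[OF x\<rho> y\<rho>] by (elim exE conjE)
    obtain \<gamma>2 where \<gamma>2: "geodesic M UNIV \<gamma>2" "\<gamma>2 0 = x" "\<gamma>2 1 = r" "norm (velocity \<gamma>2 0) \<le> C * norm (x - r)"
      using join[OF x\<rho> r(1)] by (elim exE conjE)
    define v1 where "v1 = velocity \<gamma>1 0"
    define v2 where "v2 = velocity \<gamma>2 0"
    have v1: "\<bar>g \<bullet> (y - x - v1)\<bar> \<le> C^5 * \<epsilon>^3 * norm g" "f y - f x = g \<bullet> v1"
      using dev[OF y\<rho> yx C\<epsilon>'(1) \<gamma>1(1,2,3) refl \<gamma>1(4)] unfolding v1_def by blast+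
    have v2: "\<bar>g \<bullet> (r - x - v2)\<bar> \<le> C^5 * (2 * \<epsilon>)^3 * norm g" "f r - f x = g \<bullet> v2"
      using dev[OF r(1,2) C\<epsilon>'(2) \<gamma>2(1,2,3) refl \<gamma>2(4)] unfolding v2_def by blast+
    \<comment> \<open>The side from \<open>y\<close> is tested with \<open>g\<close>, which is
      tangent at \<open>x\<close>; for this the deviation lemma allows a base point off the curve,
      here within \<open>2 * \<epsilon>\<close> of it.\<close>
    have 3: "\<bar>g \<bullet> (r - y - v)\<bar> \<le> C^2 * (2 * \<epsilon>) * norm g * \<epsilon>^2"
      using tangent_component_deviation[OF M \<eta>(1) C T \<eta>\<rho> \<eta>x x\<rho> gT] \<eta>(2,3) nv by (simp add: r_def)
    have "f r - f y = G y \<bullet> v"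
      using affine_increment[OF M f \<eta>(1), of "G y"] G y \<eta> by (auto simp: r_def)
    \<comment> \<open>The chords cancel, since \<open>r - y = (r - x) - (y - x)\<close>, and only
      the three deviations remain.\<close>
    then have "(G y - g) \<bullet> v = - (g \<bullet> (r - x - v2)) + g \<bullet> (y - x - v1) + g \<bullet> (r - y - v)"
      using v1(2) v2(2) by (simp add: inner_diff_right inner_diff_left)
    then have "\<bar>(G y - g) \<bullet> v\<bar> \<le> C^5 * (2 * \<epsilon>)^3 * norm g + C^5 * \<epsilon>^3 * norm g + C^2 * (2 * \<epsilon>) * norm g * \<epsilon>^2"
      using v1(1) v2(1) 3 by linarith
    also have "\<dots> = \<epsilon> * (L * \<epsilon>^2 * norm g)"
      by (simp add: L_def power_mult_distrib power_numeral_reduce algebra_simps)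
    finally have "\<bar>(G y - g) \<bullet> v\<bar> \<le> \<epsilon> * (L * \<epsilon>^2 * norm g)" .
    \<comment> \<open>The test vector \<open>v\<close> itself has length \<open>\<epsilon>\<close>;
      dividing by it turns the third-order bound into a second-order one.\<close>
    moreover have "(G y - g) \<bullet> v = \<epsilon> * (((G y - g) \<bullet> w) / norm w)"
      by (simp add: v_def)
    ultimately have "\<epsilon> * \<bar>((G y - g) \<bullet> w) / norm w\<bar> \<le> \<epsilon> * (L * \<epsilon>^2 * norm g)"
      using \<epsilon> by (simp add: abs_mult)
    then have "\<bar>((G y - g) \<bullet> w) / norm w\<bar> \<le> L * \<epsilon>^2 * norm g"
      using mult_le_cancel_left_pos[OF \<epsilon>] by blast
    then show ?thesis
      using False by (simp add: \<epsilon>_def g_def divide_le_eq)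
  qed auto
  moreover have "L \<ge> 0" using C by (simp add: L_def)
  ultimately show ?thesis using \<delta>(1) by blast
qed

lemma constant_on_derivative_zero:
  fixes h :: "real \<Rightarrow> real"
  assumes "is_interval I" "\<And>s. s \<in> I \<Longrightarrow> (h has_derivative (\<lambda>t. 0)) (at s)"
  shows "h constant_on I"
proof -
  have "\<exists>c. \<forall>s\<in>I. h s = c"
    using assms(2) is_interval_convex[OF assms(1)]
    by (intro has_derivative_zero_constant) (auto intro: has_derivative_at_withinI)
  then show ?thesis by (simp add: constant_on_def)
qed

text \<open>\<open>gradient_variation\<close> only tests against vectors tangent at
  \<open>y\<close>. For the length it is used twice with the points exchanged, each time testing
  with the gradient at its own base point; for the angle it is tested with the velocity.\<close>

lemma geodesic_is_eikonal_helix: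
  assumes M: "smooth_submanifold d M" and complete: "geodesically_complete M"
    and f: "affine_function M f" and \<alpha>: "geodesic M I \<alpha>" "unit_speed I \<alpha>"
  shows "eikonal_helix_curve M f I \<alpha>"
proof -
  define G where "G x = gradient M f x" for x
  have G: "has_gradient M f x (G x)" if x: "x \<in> M" for x
  proof -
    obtain X where X: "has_gradient M f x X" using gradient_exists[OF M complete f x] by blast
    then have "gradient M f x = X"
      unfolding gradient_def using has_gradient_unique[OF subspace_tangent_space[OF M x]] by blast
    then show ?thesis using X by (simp add: G_def)
  qed
  note g = geodesicD[OF M \<alpha>(1)]
  have der: "((\<lambda>t. (norm (G (\<alpha> t)))^2) has_derivative (\<lambda>t. 0)) (at s) \<and>
      ((\<lambda>t. G (\<alpha> t) \<bullet> velocity \<alpha> t) has_derivative (\<lambda>t. 0)) (at s)" if s: "s \<in> I" for s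
  proof -
    define p where "p = \<alpha> s"
    have p: "p \<in> M" using g(4)[OF s] by (simp add: p_def)
    obtain \<delta> L where \<delta>: "\<delta> > 0" "L \<ge> 0" and var: "\<forall>x\<in>M \<inter> cball p \<delta>. \<forall>y\<in>M \<inter> cball p \<delta>. \<forall>w\<in>tangent_space M y.
        \<bar>(G y - G x) \<bullet> w\<bar> \<le> L * (norm (x - y))^2 * norm (G x) * norm w"
      using gradient_variation[OF M complete f p G] by blast
    define a where "a = norm (G p)"
    have "isCont \<alpha> s" using g(5)[OF s] has_vector_derivative_continuous by blast
    moreover have "\<alpha> s \<in> ball p \<delta>" using \<delta>(1) by (simp add: p_def)
    ultimately have "\<forall>\<^sub>F t in at s. \<alpha> t \<in> ball p \<delta>"
      using topological_tendstoD[OF _ open_ball] unfolding isCont_def by blast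
    moreover have "\<forall>\<^sub>F t in at s. t \<in> I"
      using g(1)[OF s] s by (simp add: eventually_at_topological) blast
    ultimately have ev: "\<forall>\<^sub>F t in at s. \<alpha> t \<in> ball p \<delta> \<and> t \<in> I"
      by (rule eventually_conj)
    have sq: "((\<lambda>t. B * (norm (\<alpha> t - p))^2) has_derivative (\<lambda>h. 0)) (at s)" for B
      unfolding p_def
      using has_derivative_square_distance g(5)[OF s] unfolding has_vector_derivative_def by blast
    \<comment> \<open>The bracket bounds the length of the gradient on the whole ball.\<close>
    define B where "B = 2 * L * a * (a + L * \<delta>^2 * a)"
    have "((\<lambda>t. (norm (G (\<alpha> t)))^2) has_derivative (\<lambda>t. 0)) (at s)"
    proof (rule has_derivative_zero_sandwich[OF sq[of B]])
      show "\<forall>\<^sub>F t in at s. norm ((norm (G (\<alpha> t)))^2 - (norm (G (\<alpha> s)))^2) \<le> B * (norm (\<alpha> t - p))^2"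
        using ev
      proof eventually_elim
        case (elim t)
        define q where "q = \<alpha> t"
        define b where "b = norm (G q)"
        define \<epsilon> where "\<epsilon> = norm (q - p)"
        have q: "q \<in> M \<inter> cball p \<delta>" using elim g(4) by (auto simp: q_def)
        have p\<delta>: "p \<in> M \<inter> cball p \<delta>" using p \<delta> by auto
        have \<epsilon>: "\<epsilon> \<le> \<delta>" using q by (auto simp: \<epsilon>_def dist_norm norm_minus_commute)
        have GT: "G p \<in> tangent_space M p" "G q \<in> tangent_space M q"
          using G p q by (auto simp: has_gradient_def)
        have 1: "\<bar>(G q - G p) \<bullet> G q\<bar> \<le> L * \<epsilon>^2 * a * b"
          using var[rule_format, OF p\<delta> q GT(2)] by (simp add: \<epsilon>_def a_def b_def norm_minus_commute)
        have 2: "\<bar>(G p - G q) \<bullet> G p\<bar> \<le> L * \<epsilon>^2 * a * b"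
          using var[rule_format, OF q p\<delta> GT(1)] by (simp add: \<epsilon>_def a_def b_def mult_ac)
        have nn: "a \<ge> 0" "b \<ge> 0" by (auto simp: a_def b_def)
        have "b * b = (G q - G p) \<bullet> G q + G p \<bullet> G q"
          by (simp add: b_def inner_diff_left power2_norm_eq_inner flip: power2_eq_square)
        also have "\<dots> \<le> L * \<epsilon>^2 * a * b + a * b"
          using 1 norm_cauchy_schwarz[of "G p" "G q"] by (simp add: a_def b_def)
        \<comment> \<open>Dividing by \<open>b\<close> bounds the length of the gradient at
          \<open>q\<close> by that at \<open>p\<close>; continuity of the gradient has not been
          shown, so this bound is derived from the variation estimate itself.\<close>
        finally have "b * b \<le> (a + L * \<epsilon>^2 * a) * b" by (simp add: algebra_simps)
        then have "b \<le> a + L * \<epsilon>^2 * a"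
          using nn \<delta>(2) by (cases "b = 0") auto
        also have "\<dots> \<le> a + L * \<delta>^2 * a"
          using \<epsilon> \<delta>(2) nn by (intro add_left_mono mult_right_mono mult_left_mono power_mono) (auto simp: \<epsilon>_def)
        finally have b: "b \<le> a + L * \<delta>^2 * a" .
        \<comment> \<open>Each gradient is tested at its own base point, where it is tangent; the
          mixed products cancel.\<close>
        have "b^2 - a^2 = (G q - G p) \<bullet> G q - (G p - G q) \<bullet> G p"
          by (simp add: a_def b_def power2_norm_eq_inner inner_diff_left inner_commute[of "G q" "G p"])
        then have "\<bar>b^2 - a^2\<bar> \<le> 2 * L * a * b * \<epsilon>^2"
          using 1 2 by (simp add: algebra_simps)
        also have "\<dots> \<le> B * \<epsilon>^2"
          unfolding B_def using b nn \<delta>(2) by (intro mult_right_mono mult_left_mono) auto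
        finally show ?case by (simp add: a_def b_def \<epsilon>_def q_def p_def)
      qed
    qed (simp add: p_def)
    moreover have "((\<lambda>t. G (\<alpha> t) \<bullet> velocity \<alpha> t) has_derivative (\<lambda>t. 0)) (at s)"
    proof -
      \<comment> \<open>The product is split at the fixed vector \<open>G p\<close>. This part is
        quadratically small; the other has derivative zero because \<open>G p\<close> is tangent at
        \<open>p\<close> and the acceleration there is normal.\<close>
      have "((\<lambda>t. (G (\<alpha> t) - G p) \<bullet> velocity \<alpha> t) has_derivative (\<lambda>t. 0)) (at s)"
      proof (rule has_derivative_zero_sandwich[OF sq[of "L * a"]])
        show "\<forall>\<^sub>F t in at s. norm ((G (\<alpha> t) - G p) \<bullet> velocity \<alpha> t - (G (\<alpha> s) - G p) \<bullet> velocity \<alpha> s)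
            \<le> L * a * (norm (\<alpha> t - p))^2"
          using ev
        proof eventually_elim
          case (elim t)
          have "\<alpha> t \<in> M \<inter> cball p \<delta>" "p \<in> M \<inter> cball p \<delta>" using elim g(4) p \<delta>(1) by auto
          then have "\<bar>(G (\<alpha> t) - G p) \<bullet> velocity \<alpha> t\<bar> \<le> L * (norm (p - \<alpha> t))^2 * norm (G p) * norm (velocity \<alpha> t)"
            using var g(7) elim by blast
          moreover have "norm (velocity \<alpha> t) = 1" using \<alpha>(2) elim by (simp add: unit_speed_def)
          ultimately show ?case by (simp add: p_def[symmetric] a_def norm_minus_commute mult_ac)
        qed
      qed (simp add: p_def)
      moreover have "((\<lambda>t. G p \<bullet> velocity \<alpha> t) has_derivative (\<lambda>t. 0)) (at s)"
      proof -
        have "acceleration_vector \<alpha> s \<bullet> G p = 0"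
          using g(8)[OF s] G[OF p] by (simp add: has_gradient_def p_def)
        then show ?thesis
          using bounded_linear.has_vector_derivative[OF bounded_linear_inner_right g(6)[OF s], of "G p"]
          by (simp add: has_vector_derivative_def inner_commute)
      qed
      ultimately have "((\<lambda>t. (G (\<alpha> t) - G p) \<bullet> velocity \<alpha> t + G p \<bullet> velocity \<alpha> t) has_derivative (\<lambda>t. 0 + 0)) (at s)"
        by (rule has_derivative_add)
      then show ?thesis by (simp add: inner_diff_left)
    qed
    ultimately show ?thesis ..
  qed
  have curve: "smooth_curve M I \<alpha>" using \<alpha>(1) by (simp add: geodesic_def)
  then have I: "is_interval I" by (simp add: smooth_curve_def)
  have "(\<lambda>s. (norm (G (\<alpha> s)))^2) constant_on I" "(\<lambda>s. G (\<alpha> s) \<bullet> velocity \<alpha> s) constant_on I"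
    using der by (auto intro!: constant_on_derivative_zero I)
  moreover from this(1) have "(\<lambda>s. norm (G (\<alpha> s))) constant_on I"
    unfolding constant_on_def by (metis norm_ge_zero power2_eq_imp_eq real_sqrt_abs abs_norm_cancel)
  ultimately show ?thesis
    using curve \<alpha>(2) G g(4) unfolding eikonal_helix_curve_def G_def by blast
qed

theorem theorem3p4:
  fixes M :: "(real ^ 'n) set"
    and N :: "'b::euclidean_space set"
    and g :: "'b \<Rightarrow> 'b \<Rightarrow> 'b \<Rightarrow> real"
    and f :: "real ^ 'n \<Rightarrow> real"
    and d k :: nat
  assumes "smooth_submanifold d M"
    and "connected M"
    and "geodesically_complete M"
    and "riemannian_manifold k N g"
    and "isometric M induced_metric (N \<times> (UNIV :: real set)) (product_line_metric g)"
    and "affine_function M f"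
    and "\<not> f constant_on M"
  shows "\<forall>I \<alpha>. geodesic M I \<alpha> \<and> unit_speed I \<alpha> \<longrightarrow> eikonal_helix_curve M f I \<alpha>"
  using geodesic_is_eikonal_helix[OF assms(1,3,6)] by blast

end
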